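(* Let $F$ be a nilpotent CA. There exists $\varepsilon_{\mathsf c}>0$ such that for $\varepsilon<\varepsilon_{\mathsf c}$, every $\varepsilon$-perturbation of $F$ is uniformly ergodic. Furthermore, the unique invariant measure of such a perturbation is spatially mixing and admits a perfect sampling algorithm.
   Context: Let $S$ be a finite set, $d\ge 1$ an integer, and $\mathcal{X}=S^{\mathbb{Z}^d}$ with the product topology. For finite $K\subseteq\mathbb{Z}^d$ and $y_K\in S^K$, the cylinder $[y_K]$ is $\{x\in\mathcal{X}: x_k=y_k\ \forall k\in K\}$; $x_K$ denotes the restriction of $x$ to $K$. For $k\in\mathbb{Z}^d$ the shift is $(\sigma^k x)_i=x_{k+i}$. A map $F:\mathcal{X}\to\mathcal{X}$ is a cellular automaton (CA) if there exist $n_1,\dots,n_m\in\mathbb{Z}^d$ and $f:S^m\to S$ such that $(Fx)_k=f(x_{k+n_1},\dots,x_{k+n_m})$ for all $x\in\mathcal{X}$ and $k\in\mathbb{Z}^d$; the set $\{n_1,\dots,n_m\}$ is called its neighbourhood and $f$ its local rule. $F$ is nilpotent if there is a non-negative integer $N$ such that $F^N$ is a constant function. A probabilistic cellular automaton (PCA) with neighbourhood $\{n_1,\dots,n_m\}$ and local rule $\varphi:S^m\times S\to[0,1]$ (a stochastic matrix) is the Markov kernel $\Phi$ on $\mathcal{X}$ with $\Phi(x,[y_K])=\prod_{k\in K}\varphi(x_{k+n_1},\dots,x_{k+n_m})(y_k)$ for every $x\in\mathcal{X}$ and every cylinder $[y_K]$. A PCA $\Phi$ is an $\varepsilon$-perturbation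 of a CA $F$ if $\Phi$ and $F$ share the same alphabet $S$ and have a common neighbourhood for which their local rules $\varphi$ and $f$ satisfy $\varphi(a_1,\dots,a_m)\big(f(a_1,\dots,a_m)\big)\ge 1-\varepsilon$ for all $a_1,\dots,a_m\in S$. In other words, $\Phi$ is an $\varepsilon$-perturbation of $F$ if $\Phi(x,[(Fx)_K])\ge(1-\varepsilon)^{|K|}$ for every $x\in\mathcal{X}$ and every finite $K\subseteq\mathbb{Z}^d$. A Borel probability measure $\pi$ on $\mathcal{X}$ is invariant under $\Phi$ if $\pi\Phi=\pi$, where $(\pi\Phi)(E)=\int\Phi(x,E)\,\pi(\mathrm{d}x)$. $\Phi$ is uniformly ergodic if it has a unique invariant measure $\pi$ and $\Phi^t(x,[u])\to\pi([u])$ as $t\to\infty$, uniformly in $x\in\mathcal{X}$, for each cylinder $[u]$. The measure $\pi$ is spatially mixing if $\lim_{k\to\infty}\pi([u]\cap\sigma^{-k}[v])=\pi([u])\pi([v])$ for all cylinders $[u],[v]$. A perfect sampling algorithm for a probability measure $\mu$ on $\mathcal{X}$ is an algorithm that, given a finite set $A\subseteq\mathbb{Z}^d$ and using an unbounded source of independent uniform samples from $[0,1]$ (and with access to an, in general infinite, symbolic presentation of the real transition probabilities of the PCA), outputs a random pattern $W_A\in S^A$ with $\mathbb{P}(W_A=w)=\mu([w])$ for all $w\in S^A$.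
   Formalization: The common neighbourhood of F and its perturbation is fixed before ε_c, so ε_c may depend on it; with one ε_c for all neighbourhoods the claim fails (constant-0 CA perturbed to long-range supercritical oriented percolation). *)

theory Defs
  imports "HOL-Probability.Probability" "HOL-Library.Nat_Bijection"
begin

section \<open>Configurations\<close>

text \<open>The lattice \<open>\<int>\<^sup>d\<close> is \<open>int ^ 'd\<close> and the alphabet is a finite type \<open>'s\<close>; types being
  nonempty, \<open>d \<ge> 1\<close> and \<open>S \<noteq> {}\<close>.\<close>

type_synonym ('d, 's) config = "int ^ 'd \<Rightarrow> 's"

definition config_space :: "('d::finite, 's::finite) config measure" where
  "config_space = Pi\<^sub>M UNIV (\<lambda>_. count_space UNIV)"

text \<open>The product \<open>\<sigma>\<close>-algebra is the Borel \<open>\<sigma>\<close>-algebra of the product topology.\<close>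

lemma sets_config_space_eq_borel:
  "sets (config_space :: ('d::finite, 's::finite) config measure) =
     sigma_sets UNIV {U. openin (product_topology (\<lambda>_. discrete_topology UNIV) UNIV) U}"
proof
  let ?T = "product_topology (\<lambda>_::int ^ 'd. discrete_topology (UNIV :: 's set)) UNIV"
  show "sets (config_space :: ('d, 's) config measure) \<subseteq> sigma_sets UNIV {U. openin ?T U}"
    unfolding config_space_def sets_PiM_single space_count_space PiE_UNIV_domain Pi_UNIV
  proof (rule sigma_sets_mono, clarify)
    fix i :: "int ^ 'd" and A :: "'s set"
    have "openin ?T {f \<in> topspace ?T. f i \<in> A}"
      by (rule openin_continuous_map_preimage[OF continuous_map_product_projection]) auto
    moreover have "{f \<in> topspace ?T. f i \<in> A} = {f \<in> UNIV. f i \<in> A}"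
      by (auto simp: PiE_UNIV_domain)
    ultimately show "{f \<in> UNIV. f i \<in> A} \<in> sigma_sets UNIV {U. openin ?T U}"
      by auto
  qed
next
  let ?T = "product_topology (\<lambda>_::int ^ 'd. discrete_topology (UNIV :: 's set)) UNIV"
  let ?M = "config_space :: ('d, 's) config measure"
  have space: "space ?M = UNIV"
    by (simp add: config_space_def space_PiM PiE_UNIV_domain)
  define C where "C l = {x :: ('d, 's) config. \<forall>(k, s) \<in> set l. x k = s}" for l
  have C_sets: "C l \<in> sets ?M" for l
  proof -
    have comp: "(\<lambda>x :: ('d, 's) config. x k) \<in> ?M \<rightarrow>\<^sub>M count_space UNIV" for k
      unfolding config_space_def by (rule measurable_component_singleton) simp
    have "{x \<in> space ?M. \<forall>p \<in> set l. x (fst p) = snd p} \<in> sets ?M"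
    proof (rule sets.sets_Collect_finite_All)
      fix p assume "p \<in> set l"
      have "(\<lambda>x :: ('d, 's) config. x (fst p)) -` {snd p} \<inter> space ?M \<in> sets ?M"
        by (rule measurable_sets[OF comp]) simp
      then show "{x \<in> space ?M. x (fst p) = snd p} \<in> sets ?M"
        by (simp add: vimage_def Int_def conj_commute)
    qed simp
    then show ?thesis
      by (simp add: C_def space case_prod_beta)
  qed
  have "U \<in> sets ?M" if U: "openin ?T U" for U
  proof -
    have "U = (\<Union>l \<in> {l. C l \<subseteq> U}. C l)"
    proof
      show "U \<subseteq> (\<Union>l \<in> {l. C l \<subseteq> U}. C l)"
      proof
        fix x assume "x \<in> U"
        with U obtain V where V: "finite {i. V i \<noteq> (UNIV :: 's set)}" "x \<in> Pi\<^sub>E UNIV V" "Pi\<^sub>E UNIV V \<subseteq> U"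
          unfolding openin_product_topology_alt by fastforce
        obtain ks where ks: "set ks = {i. V i \<noteq> UNIV}"
          using finite_list[OF V(1)] by blast
        let ?l = "map (\<lambda>k. (k, x k)) ks"
        have "C ?l \<subseteq> Pi\<^sub>E UNIV V"
        proof
          fix y assume "y \<in> C ?l"
          then have y: "y k = x k" if "V k \<noteq> UNIV" for k
            using that ks by (auto simp: C_def)
          have "y k \<in> V k" for k
            using y[of k] V(2) by (cases "V k = UNIV") (auto simp: PiE_UNIV_domain)
          then show "y \<in> Pi\<^sub>E UNIV V"
            by (auto simp: PiE_UNIV_domain)
        qed
        moreover have "x \<in> C ?l"
          by (auto simp: C_def)
        ultimately show "x \<in> (\<Union>l \<in> {l. C l \<subseteq> U}. C l)"
          using V(3) by blast
      qed
    qed auto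
    moreover have "(\<Union>l \<in> {l. C l \<subseteq> U}. C l) \<in> sets ?M"
      by (rule sets.countable_UN') (auto intro: C_sets)
    ultimately show ?thesis by simp
  qed
  then have "sigma_sets (space ?M) {U. openin ?T U} \<subseteq> sets ?M"
    by (intro sets.sigma_sets_subset) auto
  then show "sigma_sets UNIV {U. openin ?T U} \<subseteq> sets ?M"
    by (simp add: space)
qed

definition cylinder :: "(int ^ 'd) set \<Rightarrow> ('d::finite, 's) config \<Rightarrow> ('d, 's) config set" where
  "cylinder K y = {x. \<forall>k\<in>K. x k = y k}"

definition shift :: "int ^ 'd \<Rightarrow> ('d::finite, 's) config \<Rightarrow> ('d, 's) config" where
  "shift k x = (\<lambda>i. x (k + i))"


section \<open>Cellular automata and probabilistic cellular automata\<close>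

text \<open>A neighbourhood \<open>{n\<^sub>1, \<dots>, n\<^sub>m}\<close> is given by a list \<open>ns\<close> of length \<open>m\<close>, and \<open>S\<^sup>m\<close> consists of
  the lists of that length; values of local rules at lists of another length are irrelevant.\<close>

definition ca_local_rule ::
    "(int ^ 'd) list \<Rightarrow> ('s list \<Rightarrow> 's) \<Rightarrow> (('d::finite, 's) config \<Rightarrow> ('d, 's) config) \<Rightarrow> bool" where
  "ca_local_rule ns f F \<longleftrightarrow> (\<forall>x k. F x k = f (map (\<lambda>n. x (k + n)) ns))"

definition ca_neighbourhood ::
    "(int ^ 'd) list \<Rightarrow> (('d::finite, 's) config \<Rightarrow> ('d, 's) config) \<Rightarrow> bool" where
  "ca_neighbourhood ns F \<longleftrightarrow> (\<exists>f. ca_local_rule ns f F)"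

definition nilpotent :: "(('d::finite, 's) config \<Rightarrow> ('d, 's) config) \<Rightarrow> bool" where
  "nilpotent F \<longleftrightarrow> (\<exists>N c. \<forall>x. (F ^^ N) x = c)"

text \<open>The stochastic matrix \<open>\<phi>\<close> is given by its rows.\<close>

definition pca_local_rule ::
    "(int ^ 'd) list \<Rightarrow> ('s list \<Rightarrow> 's pmf) \<Rightarrow>
     (('d::finite, 's::finite) config \<Rightarrow> ('d, 's) config measure) \<Rightarrow> bool" where
  "pca_local_rule ns \<phi> \<Phi> \<longleftrightarrow>
     \<Phi> \<in> config_space \<rightarrow>\<^sub>M prob_algebra config_space \<and>
     (\<forall>x K y. finite K \<longrightarrow>
        measure (\<Phi> x) (cylinder K y) = (\<Prod>k\<in>K. pmf (\<phi> (map (\<lambda>n. x (k + n)) ns)) (y k)))"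

text \<open>The common neighbourhood \<open>ns\<close> is a parameter: the bound on the noise in the theorem depends
  on it. For a fixed \<open>\<epsilon> > 0\<close>, already the constant automaton has non-ergodic
  \<open>\<epsilon>\<close>-perturbations on large enough neighbourhoods (let a cell turn 1 with probability \<open>\<epsilon>\<close>
  if some neighbour is 1, and 0 otherwise: this is a supercritical oriented percolation).\<close>

definition perturbation ::
    "(int ^ 'd) list \<Rightarrow> real \<Rightarrow> (('d::finite, 's::finite) config \<Rightarrow> ('d, 's) config) \<Rightarrow>
     (('d, 's) config \<Rightarrow> ('d, 's) config measure) \<Rightarrow> bool" where
  "perturbation ns \<epsilon> F \<Phi> \<longleftrightarrow>
     (\<exists>f \<phi>. ca_local_rule ns f F \<and> pca_local_rule ns \<phi> \<Phi> \<and>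
        (\<forall>a. length a = length ns \<longrightarrow> pmf (\<phi> a) (f a) \<ge> 1 - \<epsilon>))"


section \<open>Ergodicity and mixing\<close>

definition invariant ::
    "(('d::finite, 's::finite) config \<Rightarrow> ('d, 's) config measure) \<Rightarrow> ('d, 's) config measure \<Rightarrow> bool" where
  "invariant \<Phi> \<pi> \<longleftrightarrow> \<pi> \<in> space (prob_algebra config_space) \<and> \<pi> \<bind> \<Phi> = \<pi>"

primrec kernel_pow ::
    "(('d::finite, 's::finite) config \<Rightarrow> ('d, 's) config measure) \<Rightarrow> nat \<Rightarrow>
     ('d, 's) config \<Rightarrow> ('d, 's) config measure" where
  "kernel_pow \<Phi> 0 x = return config_space x"
| "kernel_pow \<Phi> (Suc t) x = kernel_pow \<Phi> t x \<bind> \<Phi>"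

definition uniformly_ergodic ::
    "(('d::finite, 's::finite) config \<Rightarrow> ('d, 's) config measure) \<Rightarrow> bool" where
  "uniformly_ergodic \<Phi> \<longleftrightarrow>
     (\<exists>\<pi>. invariant \<Phi> \<pi> \<and> (\<forall>\<pi>'. invariant \<Phi> \<pi>' \<longrightarrow> \<pi>' = \<pi>) \<and>
        (\<forall>K u. finite K \<longrightarrow>
           uniform_limit UNIV (\<lambda>t x. measure (kernel_pow \<Phi> t x) (cylinder K u))
             (\<lambda>_. measure \<pi> (cylinder K u)) sequentially))"

text \<open>\<open>k \<rightarrow> \<infinity>\<close> in \<open>\<int>\<^sup>d\<close> means that \<open>k\<close> leaves every finite set.\<close>

definition spatially_mixing :: "('d::finite, 's::finite) config measure \<Rightarrow> bool" where
  "spatially_mixing \<pi> \<longleftrightarrow>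
     (\<forall>K u L v. finite K \<longrightarrow> finite L \<longrightarrow>
        ((\<lambda>k. measure \<pi> (cylinder K u \<inter> shift (- k) ` cylinder L v))
           \<longlongrightarrow> measure \<pi> (cylinder K u) * measure \<pi> (cylinder L v)) cofinite)"


section \<open>Perfect sampling algorithms\<close>

text \<open>Algorithms are partial recursive functions relative to two oracles: one presents the transition
  probabilities, the other one the random samples. \<open>None\<close> stands for non-termination, and also for
  ill-formed calls (a missing argument).\<close>

datatype algorithm =
    Zero
  | Succ
  | Proj nat
  | Ask_Rule
  | Ask_Random
  | Comp algorithm "algorithm list"
  | PrimRec algorithm algorithm
  | Mu algorithm

fun run :: "(nat list \<Rightarrow> nat) \<Rightarrow> (nat list \<Rightarrow> nat) \<Rightarrow> algorithm \<Rightarrow> nat list \<Rightarrow> nat option" where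
  "run q r Zero xs = Some 0"
| "run q r Succ xs = (case xs of [] \<Rightarrow> None | x # _ \<Rightarrow> Some (Suc x))"
| "run q r (Proj i) xs = (if i < length xs then Some (xs ! i) else None)"
| "run q r Ask_Rule xs = Some (q xs)"
| "run q r Ask_Random xs = Some (r xs)"
| "run q r (Comp f gs) xs =
     (let ys = map (\<lambda>g. run q r g xs) gs in
      if None \<in> set ys then None else run q r f (map the ys))"
| "run q r (PrimRec f g) xs =
     (case xs of [] \<Rightarrow> None
      | n # zs \<Rightarrow> rec_nat (run q r f zs) (\<lambda>k v. Option.bind v (\<lambda>y. run q r g (k # y # zs))) n)"
| "run q r (Mu f) xs =
     (if \<exists>n. run q r f (n # xs) = Some 0 \<and> (\<forall>m<n. run q r f (m # xs) \<noteq> None)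
      then Some (LEAST n. run q r f (n # xs) = Some 0) else None)"

text \<open>Encodings of the finite data. The choices made by \<open>to_nat\<close> on the alphabet and in \<open>axes\<close> concern
  finite types only, so they do not affect computability (\<open>to_nat\<close> on an infinite type could).\<close>

definition symbol_code :: "'s::finite \<Rightarrow> nat" where
  "symbol_code = to_nat"

definition word_code :: "'s::finite list \<Rightarrow> nat" where
  "word_code a = list_encode (map symbol_code a)"

definition axes :: "'d::finite list" where
  "axes = (SOME js. distinct js \<and> set js = UNIV)"

definition site_code :: "int ^ 'd::finite \<Rightarrow> nat" where
  "site_code k = list_encode (map (\<lambda>j. int_encode (k $ j)) axes)"

definition sites_code :: "(int ^ 'd::finite) list \<Rightarrow> nat" where
  "sites_code ks = list_encode (map site_code ks)"

text \<open>A symbolic presentation of the transition probabilities: dyadic approximations of every entry to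
  every precision. Such a presentation is in general an infinite, non-computable object.\<close>

definition presents :: "(nat list \<Rightarrow> nat) \<Rightarrow> (int ^ 'd::finite) list \<Rightarrow> ('s::finite list \<Rightarrow> 's pmf) \<Rightarrow> bool" where
  "presents q ns \<phi> \<longleftrightarrow>
     (\<forall>a b n. length a = length ns \<longrightarrow>
        \<bar>real (q [word_code a, symbol_code b, n]) / 2 ^ n - pmf (\<phi> a) b\<bar> \<le> 1 / 2 ^ n)"

text \<open>An unbounded source of independent uniform samples from \<open>[0, 1]\<close>, of which the algorithm can read
  the first \<open>n\<close> binary digits of the \<open>i\<close>-th one, for any \<open>i\<close> and \<open>n\<close>.\<close>

definition uniform_source :: "(nat \<Rightarrow> real) measure" where
  "uniform_source = Pi\<^sub>M UNIV (\<lambda>_. uniform_measure lborel {0..1})"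

definition random_digits :: "(nat \<Rightarrow> real) \<Rightarrow> nat list \<Rightarrow> nat" where
  "random_digits \<omega> xs = (case xs of [i, n] \<Rightarrow> nat \<lfloor>2 ^ n * \<omega> i\<rfloor> | _ \<Rightarrow> 0)"

text \<open>A finite set of sites is passed as a list, and a pattern on it is returned as the list of its
  symbols in the same order. The probabilities of the patterns add up to 1, so the algorithm
  terminates almost surely.\<close>

definition perfect_sampler ::
    "(nat list \<Rightarrow> nat) \<Rightarrow> algorithm \<Rightarrow> ('d::finite, 's::finite) config measure \<Rightarrow> bool" where
  "perfect_sampler q P \<mu> \<longleftrightarrow>
     (\<forall>ks w. distinct ks \<longrightarrow>
        (let E = {\<omega> \<in> space uniform_source.
                    run q (random_digits \<omega>) P [sites_code ks] = Some (word_code (map w ks))}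
         in E \<in> sets uniform_source \<and>
            measure uniform_source E = measure \<mu> (cylinder (set ks) w)))"

text \<open>The algorithm may depend on the PCA, but it is a finite object; the real transition probabilities
  are accessible to it only through a presentation, and it has to work with any presentation.\<close>

definition admits_perfect_sampling ::
    "(int ^ 'd) list \<Rightarrow> (('d::finite, 's::finite) config \<Rightarrow> ('d, 's) config measure) \<Rightarrow>
     ('d, 's) config measure \<Rightarrow> bool" where
  "admits_perfect_sampling ns \<Phi> \<mu> \<longleftrightarrow>
     (\<exists>P. \<forall>\<phi> q. pca_local_rule ns \<phi> \<Phi> \<longrightarrow> presents q ns \<phi> \<longrightarrow> perfect_sampler q P \<mu>)"

end

theory Submission
  imports Defs
begin

text \<open>Replace the local rule of the perturbed automaton \<open>\<Phi>\<close>, independently at every site and time, by a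
  random table of values which mostly agrees with the rule of \<open>F\<close>. Then \<open>N\<close> steps of \<open>\<Phi>\<close> apply a random
  map \<open>G\<close>, and \<open>G x k\<close> differs from the constant value of \<open>F ^^ N\<close> only with probability \<open>O(\<epsilon>)\<close>. Hence, if
  \<open>h\<close> depends on the sites in \<open>K\<close>, then \<open>h \<circ> G\<close> depends only on the neighbourhoods of the few
  exceptional sites of \<open>K\<close>; for small \<open>\<epsilon>\<close> their expected number of elements is at most half of \<open>card K\<close>,
  and by induction the oscillation of \<open>h\<close> after \<open>N * n\<close> steps is at most \<open>card K / 2 ^ n\<close>.

  So the expectations of local functions converge to a limit that does not depend on the initial
  configuration, and Kolmogorov's theorem turns the limit functional into the invariant measure. It is
  mixing because the expectation of a product factorises as long as the space-time cones are disjoint.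

  The rate of convergence is explicit, so a presentation of the transition probabilities suffices to
  compute the probabilities of patterns to any precision, and a pattern is sampled by inverting the
  distribution function at a single uniform sample, reading its digits until the pattern is certain.\<close>

section \<open>Local functions\<close>

text \<open>Two initial configurations are compared by feeding the same noise to both, so an
  exceptional site has to be judged for all configurations at once. This is why whole tables are
  randomised: a table can err at any of the \<open>CARD('s) ^ length ns\<close> neighbourhood words,
  and the union bound over them costs this factor. For a given finite \<open>K\<close> only finitely
  many tables matter, so each random map is drawn from a \<open>pmf\<close> with finite support, and
  no measure on a space of maps has to be constructed. The sampler faces another obstacle: from
  approximations alone it cannot decide on which side of a value of the distribution function a
  sample lies. It therefore waits for a certificate, and may wait forever if the sample is exactly
  such a value, an event of probability 0. Iterated neighbourhoods are kept as lists with
  repetitions, because their lengths \<open>length ks * length ns ^ u\<close> are then known in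
  advance; the price is a consistency check at repeated sites.\<close>

definition depends_on :: "(int ^ 'd) set \<Rightarrow> (('d::finite, 's) config \<Rightarrow> 'b) \<Rightarrow> bool" where
  "depends_on K h \<longleftrightarrow> (\<forall>x y. (\<forall>k\<in>K. x k = y k) \<longrightarrow> h x = h y)"

lemma depends_onD: "depends_on K h \<Longrightarrow> (\<And>k. k \<in> K \<Longrightarrow> x k = y k) \<Longrightarrow> h x = h y"
  unfolding depends_on_def by blast

lemma depends_on_mono: "depends_on K h \<Longrightarrow> K \<subseteq> L \<Longrightarrow> depends_on L h"
  unfolding depends_on_def by blast

lemma depends_on_indicator_cylinder: "depends_on K (indicator (cylinder K u) :: _ \<Rightarrow> real)"
  by (auto simp: depends_on_def cylinder_def indicator_def)

lemma space_config_space [simp]: "space config_space = UNIV"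
  by (simp add: config_space_def space_PiM PiE_UNIV_domain)

lemma measurable_config_component [measurable]: "(\<lambda>x. x k) \<in> config_space \<rightarrow>\<^sub>M count_space UNIV"
  unfolding config_space_def by (rule measurable_component_singleton) simp

lemma sets_cylinder [measurable]:
  assumes "finite K"
  shows "cylinder K u \<in> sets config_space"
proof -
  have "{x \<in> space config_space. \<forall>k\<in>K. x k = u k} \<in> sets config_space"
    using assms by measurable
  then show ?thesis
    by (simp add: cylinder_def)
qed

abbreviation patterns :: "(int ^ 'd) set \<Rightarrow> ('d::finite, 's) config set" where
  "patterns K \<equiv> K \<rightarrow>\<^sub>E UNIV"

lemma finite_patterns [intro]: "finite K \<Longrightarrow> finite (patterns K :: ('d::finite, 's::finite) config set)"
  by (intro finite_PiE) auto

lemma mem_cylinder_pattern: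
  "w \<in> patterns K \<Longrightarrow> x \<in> cylinder K w \<longleftrightarrow> w = restrict x K"
  by (auto simp: cylinder_def fun_eq_iff PiE_def extensional_def)

lemma cylinder_restrict [simp]: "cylinder K (restrict x K) = cylinder K x"
  by (auto simp: cylinder_def)

lemma restrict_in_patterns [simp]: "restrict x K \<in> patterns K"
  by auto

text \<open>A pattern is itself a configuration, equal to \<open>undefined\<close> off
  \<open>K\<close>, so \<open>h w\<close> makes sense and is the constant value of \<open>h\<close>
  on \<open>cylinder K w\<close>.\<close>

lemma local_function_eq_sum:
  fixes h :: "('d::finite, 's::finite) config \<Rightarrow> real"
  assumes "finite K" "depends_on K h"
  shows "h x = (\<Sum>w\<in>patterns K. h w * indicator (cylinder K w) x)"
proof -
  have "(\<Sum>w\<in>patterns K. h w * indicator (cylinder K w) x)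
      = (\<Sum>w\<in>patterns K. if w = restrict x K then h w else 0)"
    by (intro sum.cong refl) (auto simp: indicator_def mem_cylinder_pattern)
  also have "\<dots> = h (restrict x K)"
    using assms(1) by (subst sum.delta) auto
  also have "\<dots> = h x"
    by (rule depends_onD[OF assms(2)]) auto
  finally show ?thesis by simp
qed

lemma measurable_local_function [measurable]:
  fixes h :: "('d::finite, 's::finite) config \<Rightarrow> real"
  assumes "finite K" "depends_on K h"
  shows "h \<in> borel_measurable config_space"
proof -
  have "(\<lambda>x. \<Sum>w\<in>patterns K. h w * indicator (cylinder K w) x) \<in> borel_measurable config_space"
    using assms(1) by measurable
  then show ?thesis
    by (simp add: local_function_eq_sum[OF assms, symmetric])
qed

lemma integral_local_function:
  fixes h :: "('d::finite, 's::finite) config \<Rightarrow> real"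
  assumes "finite K" "depends_on K h" "finite_measure M" "sets M = sets config_space"
  shows "(\<integral>x. h x \<partial>M) = (\<Sum>w\<in>patterns K. h w * measure M (cylinder K w))"
proof -
  interpret finite_measure M by fact
  have [simp]: "cylinder K w \<in> sets M" for w
    using assms by simp
  have "(\<integral>x. h x \<partial>M) = (\<integral>x. (\<Sum>w\<in>patterns K. h w * indicator (cylinder K w) x) \<partial>M)"
    by (simp add: local_function_eq_sum[OF assms(1,2), symmetric])
  also have "\<dots> = (\<Sum>w\<in>patterns K. h w * measure M (cylinder K w))"
    by (subst Bochner_Integration.integral_sum) (auto simp: less_top[symmetric])
  finally show ?thesis .
qed

lemma integrable_local_function:
  fixes h :: "('d::finite, 's::finite) config \<Rightarrow> real"
  assumes "finite K" "depends_on K h" "finite_measure M" "sets M = sets config_space"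
  shows "integrable M h"
proof -
  interpret finite_measure M by fact
  have [simp]: "cylinder K w \<in> sets M" for w
    using assms by simp
  have "integrable M (\<lambda>x. \<Sum>w\<in>patterns K. h w * indicator (cylinder K w) x)"
    by (auto simp: less_top[symmetric])
  then show ?thesis
    by (simp add: local_function_eq_sum[OF assms(1,2), symmetric])
qed

lemma prob_algebra_configD:
  assumes "M \<in> space (prob_algebra config_space)"
  shows "prob_space M" "finite_measure M" "sets M = sets config_space" "space M = UNIV"
  using assms sets_eq_imp_space_eq[of M config_space] by (auto simp: space_prob_algebra prob_space.finite_measure)

text \<open>Uniqueness on infinite products is tested on rectangles with arbitrary sides. The
  indicator of a rectangle depends on finitely many sites, so its integral is a combination of
  cylinder masses.\<close>

lemma config_measure_eqI:
  fixes M N :: "('d::finite, 's::finite) config measure"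
  assumes M: "M \<in> space (prob_algebra config_space)" and N: "N \<in> space (prob_algebra config_space)"
    and eq: "\<And>K u. finite K \<Longrightarrow> measure M (cylinder K u) = measure N (cylinder K u)"
  shows "M = N"
proof -
  note MD = prob_algebra_configD[OF M] and ND = prob_algebra_configD[OF N]
  interpret M: prob_space M by (rule MD)
  interpret N: prob_space N by (rule ND)
  show ?thesis
  proof (rule measure_eqI_PiM_infinite)
    show "sets M = sets (Pi\<^sub>M UNIV (\<lambda>_. count_space UNIV))" "sets N = sets (Pi\<^sub>M UNIV (\<lambda>_. count_space UNIV))"
      using MD(3) ND(3) by (simp_all add: config_space_def)
    fix A :: "int ^ 'd \<Rightarrow> 's set" and J :: "(int ^ 'd) set"
    assume J: "finite J"
    define B where "B = prod_emb UNIV (\<lambda>_. count_space UNIV) J (Pi\<^sub>E J A)"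
    have B: "B = {x. \<forall>j\<in>J. x j \<in> A j}"
      by (auto simp: B_def prod_emb_def PiE_def Pi_def)
    have Bsets: "B \<in> sets config_space"
    proof -
      have "{x \<in> space config_space. \<forall>j\<in>J. x j \<in> A j} \<in> sets config_space"
        using J by measurable
      then show ?thesis by (simp add: B)
    qed
    have dep: "depends_on J (indicator B :: _ \<Rightarrow> real)"
      by (auto simp: depends_on_def B indicator_def)
    have "measure M B = (\<integral>x. indicator B x \<partial>M)"
      using Bsets MD(3,4) by simp
    also have "\<dots> = (\<integral>x. indicator B x \<partial>N)"
      unfolding integral_local_function[OF J dep MD(2,3)] integral_local_function[OF J dep ND(2,3)]
      using J eq by simp
    also have "\<dots> = measure N B"
      using Bsets ND(3,4) by simp
    finally show "emeasure M B = emeasure N B"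
      by (simp add: M.emeasure_eq_measure N.emeasure_eq_measure)
  qed (use M.finite_measure_axioms in auto)
qed

section \<open>Extension of positive functionals to measures\<close>

text \<open>The values of \<open>l\<close> on cylinders are finite-dimensional distributions:
  positivity and \<open>l 1 = 1\<close> make them probabilities, and additivity makes them
  consistent, since a cylinder on \<open>H\<close> is a disjoint union of cylinders on any larger
  \<open>J\<close>.\<close>

lemma exists_config_measure:
  fixes l :: "(('d::finite, 's::finite) config \<Rightarrow> real) \<Rightarrow> real"
  assumes sum: "\<And>(I :: ('d, 's) config set) h. finite I \<Longrightarrow> (\<And>i. i \<in> I \<Longrightarrow> \<exists>K. finite K \<and> depends_on K (h i)) \<Longrightarrow>
        l (\<lambda>x. \<Sum>i\<in>I. h i x) = (\<Sum>i\<in>I. l (h i))"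
    and pos: "\<And>h K. finite K \<Longrightarrow> depends_on K h \<Longrightarrow> (\<And>x. 0 \<le> h x) \<Longrightarrow> 0 \<le> l h"
    and one: "l (\<lambda>_. 1) = 1"
  shows "\<exists>\<pi>\<in>space (prob_algebra config_space).
    \<forall>K u. finite K \<longrightarrow> measure \<pi> (cylinder K u) = l (indicator (cylinder K u))"
proof -
  \<comment> \<open>Weight 0 off \<open>patterns J\<close> turns the distribution on patterns into a
    \<open>pmf\<close> on all configurations.\<close>
  define w8 where "w8 J w = (if w \<in> patterns J then l (indicator (cylinder J w)) else 0)" for J w
  define p where "p J = embed_pmf (w8 J)" for J
  have w8_nonneg: "0 \<le> w8 J w" if "finite J" for J w
    using pos[OF that depends_on_indicator_cylinder] by (simp add: w8_def)
  have sum_cyl: "(\<Sum>v | v \<in> patterns J \<and> restrict v H = w. w8 J v) = l (indicator (cylinder H w))"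
    if "finite J" "H \<subseteq> J" "w \<in> patterns H" for J H w
  proof -
    let ?I = "{v. v \<in> patterns J \<and> restrict v H = w}"
    have fin: "finite ?I"
      using finite_patterns[OF that(1)] by (rule finite_subset[rotated]) auto
    have "(\<Sum>v\<in>?I. w8 J v) = (\<Sum>v\<in>?I. l (indicator (cylinder J v)))"
      by (intro sum.cong) (auto simp: w8_def)
    also have "\<dots> = l (\<lambda>x. \<Sum>v\<in>?I. indicator (cylinder J v) x)"
      by (subst sum[OF fin]) (use that(1) depends_on_indicator_cylinder in auto)
    also have "(\<lambda>x. \<Sum>v\<in>?I. indicator (cylinder J v) x :: real) = indicator (cylinder H w)"
    proof
      fix x
      have "(\<Sum>v\<in>?I. indicator (cylinder J v) x :: real) = (\<Sum>v\<in>?I. if v = restrict x J then 1 else 0)"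
        by (intro sum.cong) (auto simp: indicator_def mem_cylinder_pattern)
      also have "\<dots> = (if restrict x J \<in> ?I then 1 else 0)"
        using fin by (subst sum.delta) auto
      also have "restrict x J \<in> ?I \<longleftrightarrow> w = restrict x H"
        using that(2) by (auto simp: inf.absorb2)
      also have "(if w = restrict x H then 1 else 0) = (indicator (cylinder H w) x :: real)"
        using mem_cylinder_pattern[OF that(3)] by (auto simp: indicator_def)
      finally show "(\<Sum>v\<in>?I. indicator (cylinder J v) x :: real) = indicator (cylinder H w) x" .
    qed
    finally show ?thesis .
  qed
  have pmf_p: "pmf (p J) w = w8 J w" if J: "finite J" for J w
    unfolding p_def
  proof (rule pmf_embed_pmf)
    show "0 \<le> w8 J x" for x using w8_nonneg[OF J] .
    have "(\<integral>\<^sup>+x. ennreal (w8 J x) \<partial>count_space UNIV) = (\<Sum>x\<in>patterns J. ennreal (w8 J x))"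
      by (intro nn_integral_count_space' finite_patterns J) (auto simp: w8_def)
    also have "\<dots> = ennreal (\<Sum>x\<in>patterns J. w8 J x)"
      using w8_nonneg[OF J] by (intro sum_ennreal) auto
    \<comment> \<open>The total mass is the instance \<open>H = {}\<close> of
      \<open>sum_cyl\<close>: the only pattern on the empty set is constantly
      \<open>undefined\<close>, and its cylinder is the whole space.\<close>
    also have "(\<Sum>x\<in>patterns J. w8 J x) = (\<Sum>v | v \<in> patterns J \<and> restrict v {} = (\<lambda>_. undefined). w8 J v)"
      by (intro sum.cong) (auto simp: fun_eq_iff)
    also have "\<dots> = l (indicator (cylinder {} (\<lambda>_. undefined)))"
      by (rule sum_cyl) (use J in auto)
    also have "indicator (cylinder {} (\<lambda>_. undefined)) = (\<lambda>_. 1 :: real)"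
      by (auto simp: cylinder_def)
    finally show "(\<integral>\<^sup>+x. ennreal (w8 J x) \<partial>count_space UNIV) = 1"
      using one by simp
  qed
  have p_proj: "map_pmf (\<lambda>w. restrict w H) (p J) = p H" if "finite J" "H \<subseteq> J" for J H
  proof (rule pmf_eqI)
    fix w
    have finH: "finite H" using that finite_subset by blast
    have "pmf (map_pmf (\<lambda>w. restrict w H) (p J)) w = measure (p J) {v. restrict v H = w}"
      by (simp add: pmf_map vimage_def)
    also have "\<dots> = measure (p J) {v \<in> patterns J. restrict v H = w}"
    proof (rule measure_pmf.finite_measure_eq_AE)
      show "AE x in measure_pmf (p J). (x \<in> {v. restrict v H = w}) = (x \<in> {v \<in> patterns J. restrict v H = w})"
        unfolding AE_measure_pmf_iff
        using pmf_p[OF that(1)] by (auto simp: set_pmf_iff w8_def split: if_splits)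
    qed auto
    also have "\<dots> = (\<Sum>v | v \<in> patterns J \<and> restrict v H = w. w8 J v)"
      using finite_patterns[OF that(1)] pmf_p[OF that(1)]
      by (subst measure_measure_pmf_finite) (auto intro: finite_subset)
    also have "\<dots> = w8 H w"
    proof (cases "w \<in> patterns H")
      case True
      then show ?thesis using sum_cyl[OF that True] by (simp add: w8_def)
    next
      case False
      then have "{v. v \<in> patterns J \<and> restrict v H = w} = {}" by auto
      then show ?thesis using False by (simp only: w8_def if_False sum.empty)
    qed
    finally show "pmf (map_pmf (\<lambda>w. restrict w H) (p J)) w = pmf (p H) w"
      by (simp add: pmf_p[OF finH])
  qed
  \<comment> \<open>The extension theorem wants Borel measures on a Polish space. The copy
    \<open>'s discrete\<close> of the alphabet is one; \<open>e\<close> moves patterns there and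
    \<open>D\<close> moves configurations back.\<close>
  let ?B = "\<lambda>_ :: int ^ 'd. borel :: 's discrete measure"
  define e where "e J w = restrict (\<lambda>k. discrete (w k)) J" for J :: "(int ^ 'd) set" and w :: "('d, 's) config"
  define P where "P J = distr (measure_pmf (p J)) (PiM J ?B) (e J)" for J
  have e_meas: "e J \<in> measure_pmf q \<rightarrow>\<^sub>M PiM J ?B" for J q
    by (auto simp: e_def space_PiM)
  interpret polish_projective UNIV P
  proof (unfold polish_projective_def projective_family_def, intro conjI allI impI)
    fix J H :: "(int ^ 'd) set" assume JH: "J \<subseteq> H" "finite H" "H \<subseteq> UNIV"
    have "distr (P H) (PiM J ?B) (\<lambda>f. restrict f J) =
        distr (measure_pmf (p H)) (PiM J ?B) ((\<lambda>f. restrict f J) \<circ> e H)"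
      unfolding P_def using JH by (intro distr_distr e_meas measurable_restrict_subset)
    also have "(\<lambda>f. restrict f J) \<circ> e H = e J \<circ> (\<lambda>w. restrict w J)"
      using JH by (auto simp: e_def fun_eq_iff)
    also have "distr (measure_pmf (p H)) (PiM J ?B) (e J \<circ> (\<lambda>w. restrict w J)) =
        distr (distr (measure_pmf (p H)) (count_space UNIV) (\<lambda>w. restrict w J)) (PiM J ?B) (e J)"
      by (intro distr_distr[symmetric]) (auto simp: e_def space_PiM)
    also have "distr (measure_pmf (p H)) (count_space UNIV) (\<lambda>w. restrict w J) = measure_pmf (p J)"
      using p_proj[OF JH(2,1)] by (simp add: map_pmf_rep_eq[symmetric])
    also have "distr (measure_pmf (p J)) (PiM J ?B) (e J) = P J"
      by (simp add: P_def)
    finally show "P J = distr (P H) (PiM J ?B) (\<lambda>f. restrict f J)" ..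
  next
    fix J :: "(int ^ 'd) set" assume "finite J"
    show "prob_space (P J)"
      unfolding P_def by (intro measure_pmf.prob_space_distr e_meas)
  qed
  define D where "D x = (\<lambda>k. of_discrete (x k))" for x :: "int ^ 'd \<Rightarrow> 's discrete"
  have od: "of_discrete \<in> (borel :: 's discrete measure) \<rightarrow>\<^sub>M count_space UNIV"
    by (rule measurableI) (auto intro: borel_open open_discrete)
  have D_meas: "D \<in> lim \<rightarrow>\<^sub>M config_space"
    unfolding config_space_def D_def
    by (rule measurable_PiM_single') (auto intro!: measurable_compose[OF _ od] measurable_component_singleton
        simp: measurable_cong_sets[OF sets_lim refl])
  define \<pi> where "\<pi> = distr lim config_space D"
  show ?thesis
  proof (intro bexI[of _ \<pi>] allI impI)
    show "\<pi> \<in> space (prob_algebra config_space)"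
      unfolding space_prob_algebra \<pi>_def by (auto intro!: P.prob_space_distr D_meas)
    fix K :: "(int ^ 'd) set" and u :: "('d, 's) config" assume K: "finite K"
    have X: "PiE K (\<lambda>k. {discrete (u k)}) \<in> sets (PiM K ?B)"
      using K by (intro sets_PiM_I_finite) auto
    have "measure \<pi> (cylinder K u) = measure lim (D -` cylinder K u \<inter> space lim)"
      unfolding \<pi>_def using K by (intro measure_distr D_meas) auto
    also have "D -` cylinder K u \<inter> space lim = prod_emb UNIV ?B K (PiE K (\<lambda>k. {discrete (u k)}))"
    proof -
      have "of_discrete a = s \<longleftrightarrow> a = discrete s" for a and s :: 's
        by (metis of_discrete_inverse discrete_inverse UNIV_I)
      then show ?thesis
        by (auto simp: D_def cylinder_def prod_emb_def space_PiM PiE_def Pi_def)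
    qed
    also have "measure lim \<dots> = measure (P K) (PiE K (\<lambda>k. {discrete (u k)}))"
      using K X by (intro measure_lim_emb) auto
    also have "\<dots> = measure (p K) (e K -` PiE K (\<lambda>k. {discrete (u k)}))"
      unfolding P_def using X by (subst measure_distr[OF e_meas]) auto
    also have "e K -` PiE K (\<lambda>k. {discrete (u k)}) = cylinder K u"
      by (auto simp: e_def cylinder_def discrete_inject PiE_def Pi_def)
    also have "measure (p K) (cylinder K u) = pmf (p K) (restrict u K)"
    proof -
      have "measure (p K) (cylinder K u) = measure (p K) {restrict u K}"
      proof (rule measure_pmf.finite_measure_eq_AE)
        show "AE x in measure_pmf (p K). (x \<in> cylinder K u) = (x \<in> {restrict u K})"
          unfolding AE_measure_pmf_iff
        proof
          fix x assume "x \<in> set_pmf (p K)"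
          then have "x \<in> patterns K"
            using pmf_p[OF K] by (auto simp: set_pmf_iff w8_def split: if_splits)
          then show "(x \<in> cylinder K u) = (x \<in> {restrict u K})"
            by (auto simp: cylinder_def fun_eq_iff PiE_def extensional_def)
        qed
      qed auto
      then show ?thesis by (simp add: measure_pmf_single)
    qed
    also have "\<dots> = l (indicator (cylinder K u))"
      by (simp add: pmf_p[OF K] w8_def)
    finally show "measure \<pi> (cylinder K u) = l (indicator (cylinder K u))" .
  qed
qed

section \<open>The transfer operator of a probabilistic cellular automaton\<close>

definition local_function :: "(('d::finite, 's) config \<Rightarrow> real) \<Rightarrow> bool" where
  "local_function h \<longleftrightarrow> (\<exists>K. finite K \<and> depends_on K h)"

lemma local_functionI: "finite K \<Longrightarrow> depends_on K h \<Longrightarrow> local_function h"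
  unfolding local_function_def by blast

lemma local_function_cylinder: "finite K \<Longrightarrow> local_function (indicator (cylinder K u))"
  by (rule local_functionI[OF _ depends_on_indicator_cylinder])

lemma local_function_common:
  assumes "finite I" "\<And>i. i \<in> I \<Longrightarrow> local_function (h i)"
  shows "\<exists>K. finite K \<and> (\<forall>i\<in>I. depends_on K (h i))"
proof -
  define K where "K i = (SOME K. finite K \<and> depends_on K (h i))" for i
  have K: "finite (K i) \<and> depends_on (K i) (h i)" if "i \<in> I" for i
    unfolding K_def by (rule someI_ex) (use assms(2)[OF that] in \<open>simp add: local_function_def\<close>)
  have "depends_on (\<Union>i\<in>I. K i) (h i)" if "i \<in> I" for i
    by (rule depends_on_mono[of "K i"]) (use K[OF that] that in auto)
  moreover have "finite (\<Union>i\<in>I. K i)" using K assms(1) by auto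
  ultimately show ?thesis by blast
qed

lemma local_function_sum:
  fixes h :: "'i \<Rightarrow> ('a::finite, 'b) config \<Rightarrow> real"
  assumes "finite I" "\<And>i. i \<in> I \<Longrightarrow> local_function (h i)"
  shows "local_function (\<lambda>x. \<Sum>i\<in>I. c i * h i x)"
proof -
  obtain K where K: "finite K" "\<And>i. i \<in> I \<Longrightarrow> depends_on K (h i)"
    using local_function_common[of I h, OF assms(1)] assms(2) by auto
  have "depends_on K (\<lambda>x. \<Sum>i\<in>I. c i * h i x)"
    unfolding depends_on_def
  proof (intro allI impI sum.cong refl)
    fix x y :: "('a, 'b) config" and i assume "\<forall>k\<in>K. x k = y k" "i \<in> I"
    then have "h i x = h i y" using depends_onD[OF K(2), of i x y] by blast
    then show "c i * h i x = c i * h i y" by (simp only:)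
  qed
  then show ?thesis using K(1) by (rule local_functionI[rotated])
qed

definition nbrs :: "(int ^ 'd) list \<Rightarrow> (int ^ 'd::finite) set \<Rightarrow> (int ^ 'd) set" where
  "nbrs ns K = (\<Union>k\<in>K. (\<lambda>n. k + n) ` set ns)"

lemma finite_nbrs [simp]: "finite K \<Longrightarrow> finite (nbrs ns K)"
  by (simp add: nbrs_def)

lemma finite_nbrs_pow [simp]: "finite K \<Longrightarrow> finite ((nbrs ns ^^ t) K)"
  by (induction t) auto

lemma card_nbrs:
  assumes "finite K"
  shows "card (nbrs ns K) \<le> length ns * card K"
proof -
  have "card (nbrs ns K) \<le> (\<Sum>k\<in>K. card ((\<lambda>n. k + n) ` set ns))"
    unfolding nbrs_def by (rule card_UN_le[OF assms])
  also have "\<dots> \<le> (\<Sum>k\<in>K. length ns)"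
    by (intro sum_mono order_trans[OF card_image_le card_length]) auto
  finally show ?thesis by (simp add: mult.commute)
qed

lemma card_nbrs_pow:
  assumes "finite K"
  shows "card ((nbrs ns ^^ t) K) \<le> length ns ^ t * card K"
proof (induction t)
  case (Suc t)
  have "card ((nbrs ns ^^ Suc t) K) \<le> length ns * card ((nbrs ns ^^ t) K)"
    using card_nbrs[OF finite_nbrs_pow[OF assms]] by simp
  also have "\<dots> \<le> length ns * (length ns ^ t * card K)"
    using Suc by (rule mult_left_mono) simp
  finally show ?case by (simp add: mult.assoc)
qed simp

lemma nbrs_pow_Un: "(nbrs ns ^^ t) K = (\<Union>k\<in>K. (nbrs ns ^^ t) {k})"
proof (induction t)
  case (Suc t)
  have "(nbrs ns ^^ Suc t) K = nbrs ns (\<Union>k\<in>K. (nbrs ns ^^ t) {k})"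
    using Suc by simp
  also have "\<dots> = (\<Union>k\<in>K. nbrs ns ((nbrs ns ^^ t) {k}))"
    by (auto simp: nbrs_def)
  finally show ?case by simp
qed simp

lemma integrable_if_local_function:
  assumes "M \<in> space (prob_algebra config_space)" "local_function h"
  shows "integrable M h"
proof -
  obtain K where "finite K" "depends_on K h" using assms(2) by (auto simp: local_function_def)
  then show ?thesis
    by (rule integrable_local_function) (use prob_algebra_configD[OF assms(1)] in auto)
qed

locale pca =
  fixes ns :: "(int ^ 'd::finite) list" and \<phi> :: "'s::finite list \<Rightarrow> 's pmf"
    and \<Phi> :: "('d, 's) config \<Rightarrow> ('d, 's) config measure"
  assumes local_rule: "pca_local_rule ns \<phi> \<Phi>"
begin

abbreviation view :: "('d, 's) config \<Rightarrow> int ^ 'd \<Rightarrow> 's list" where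
  "view x k \<equiv> map (\<lambda>n. x (k + n)) ns"

lemma kernel [measurable]: "\<Phi> \<in> config_space \<rightarrow>\<^sub>M prob_algebra config_space"
  using local_rule by (simp add: pca_local_rule_def)

lemma kernel_subprob [measurable]: "\<Phi> \<in> config_space \<rightarrow>\<^sub>M subprob_algebra config_space"
  by (rule measurable_prob_algebraD[OF kernel])

lemma kernel_in: "\<Phi> x \<in> space (prob_algebra config_space)"
  using measurable_space[OF kernel] by simp

lemma measure_kernel_cylinder:
  "finite K \<Longrightarrow> measure (\<Phi> x) (cylinder K y) = (\<Prod>k\<in>K. pmf (\<phi> (view x k)) (y k))"
  using local_rule by (simp add: pca_local_rule_def)

lemma view_cong: "(\<And>j. j \<in> nbrs ns {k} \<Longrightarrow> x j = y j) \<Longrightarrow> view x k = view y k"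
  by (auto simp: nbrs_def)

text \<open>The kernel acting on observables. By \<open>integral_kernel_pow\<close>, the law of the
  automaton at time \<open>t\<close> is recovered from the powers of \<open>T\<close> on local
  functions, so the dynamics can be studied through finite sums.\<close>

definition T :: "(('d, 's) config \<Rightarrow> real) \<Rightarrow> ('d, 's) config \<Rightarrow> real" where
  "T h x = (\<integral>y. h y \<partial>\<Phi> x)"

lemma T_eq:
  assumes "finite K" "depends_on K h"
  shows "T h x = (\<Sum>w\<in>patterns K. h w * (\<Prod>k\<in>K. pmf (\<phi> (view x k)) (w k)))"
  unfolding T_def
  by (subst integral_local_function[OF assms])
     (use prob_algebra_configD[OF kernel_in] assms measure_kernel_cylinder in auto)

lemma T_depends_on:
  assumes "finite K" "depends_on K h"
  shows "depends_on (nbrs ns K) (T h)"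
  unfolding depends_on_def
proof (intro allI impI)
  fix x y :: "('d, 's) config" assume eq: "\<forall>k\<in>nbrs ns K. x k = y k"
  have "view x k = view y k" if "k \<in> K" for k
    using eq that by (intro view_cong) (auto simp: nbrs_def)
  then show "T h x = T h y"
    by (simp add: T_eq[OF assms] del: map_eq_conv)
qed

lemma T_pow_depends_on:
  assumes "finite K" "depends_on K h"
  shows "depends_on ((nbrs ns ^^ t) K) ((T ^^ t) h)"
  by (induction t) (use assms T_depends_on in auto)

lemma local_function_T: "local_function h \<Longrightarrow> local_function (T h)"
  unfolding local_function_def using T_depends_on finite_nbrs by blast

lemma local_function_T_pow: "local_function h \<Longrightarrow> local_function ((T ^^ t) h)"
  by (induction t) (auto intro: local_function_T)

lemma T_sum:
  assumes "finite I" "\<And>i. i \<in> I \<Longrightarrow> local_function (h i)"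
  shows "T (\<lambda>x. \<Sum>i\<in>I. c i * h i x) = (\<lambda>x. \<Sum>i\<in>I. c i * T (h i) x)"
  unfolding T_def
  by (rule ext, subst Bochner_Integration.integral_sum)
     (auto intro!: integrable_mult_right integrable_if_local_function kernel_in assms)

lemma T_pow_sum:
  assumes "finite I" "\<And>i. i \<in> I \<Longrightarrow> local_function (h i)"
  shows "(T ^^ t) (\<lambda>x. \<Sum>i\<in>I. c i * h i x) = (\<lambda>x. \<Sum>i\<in>I. c i * (T ^^ t) (h i) x)"
proof (induction t)
  case (Suc t)
  show ?case
    using Suc T_sum[OF assms(1), of "\<lambda>i. (T ^^ t) (h i)" c] local_function_T_pow[OF assms(2)] by simp
qed simp

lemma T_const: "T (\<lambda>_. c) = (\<lambda>_. c)"
proof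
  fix x
  interpret prob_space "\<Phi> x" by (rule prob_algebra_configD[OF kernel_in])
  show "T (\<lambda>_. c) x = c" using prob_space by (simp add: T_def)
qed

lemma T_pow_const: "(T ^^ t) (\<lambda>_. c) = (\<lambda>_. c)"
  by (induction t) (simp_all add: T_const)

lemma T_bounds:
  assumes "local_function h" "\<And>x. a \<le> h x" "\<And>x. h x \<le> b"
  shows "a \<le> T h x" "T h x \<le> b"
proof -
  interpret prob_space "\<Phi> x" by (rule prob_algebra_configD[OF kernel_in])
  have int: "integrable (\<Phi> x) h" by (rule integrable_if_local_function[OF kernel_in assms(1)])
  show "a \<le> T h x" unfolding T_def
    by (rule integral_ge_const[OF int]) (use assms in auto)
  show "T h x \<le> b" unfolding T_def
    by (rule integral_le_const[OF int]) (use assms in auto)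
qed

lemma T_pow_bounds:
  assumes "local_function h" "\<And>x. a \<le> h x" "\<And>x. h x \<le> b"
  shows "a \<le> (T ^^ t) h x \<and> (T ^^ t) h x \<le> b"
proof (induction t arbitrary: x)
  case (Suc t)
  then show ?case
    using T_bounds[OF local_function_T_pow[OF assms(1), of t], of a b x] by simp
qed (use assms in simp)

lemma bind_in:
  assumes "M \<in> space (prob_algebra config_space)"
  shows "M \<bind> \<Phi> \<in> space (prob_algebra config_space)"
  using prob_space_bind'[OF assms kernel] sets_bind'[OF assms kernel]
  by (simp add: space_prob_algebra)

text \<open>The integral is split into cylinder masses, to which \<open>measure_bind\<close>
  applies, and reassembled by the linearity of \<open>T\<close>.\<close>

lemma integral_bind_kernel:
  assumes M: "M \<in> space (prob_algebra config_space)" and h: "local_function h"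
  shows "(\<integral>x. h x \<partial>(M \<bind> \<Phi>)) = (\<integral>x. T h x \<partial>M)"
proof -
  obtain K where K: "finite K" "depends_on K h" using h by (auto simp: local_function_def)
  note MD = prob_algebra_configD[OF M]
  interpret prob_space M by (rule MD)
  have ker: "\<Phi> \<in> M \<rightarrow>\<^sub>M subprob_algebra config_space"
    using kernel_subprob by (simp add: measurable_cong_sets[OF MD(3) refl])
  have "(\<integral>x. h x \<partial>(M \<bind> \<Phi>)) = (\<Sum>w\<in>patterns K. h w * measure (M \<bind> \<Phi>) (cylinder K w))"
    using prob_algebra_configD[OF bind_in[OF M]] by (intro integral_local_function K) auto
  also have "\<dots> = (\<Sum>w\<in>patterns K. h w * (\<integral>x. T (indicator (cylinder K w)) x \<partial>M))"
  proof (intro sum.cong refl)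
    fix w
    have "measure (M \<bind> \<Phi>) (cylinder K w) = (\<integral>x. measure (\<Phi> x) (cylinder K w) \<partial>M)"
      by (rule measure_bind[OF ker]) (use K(1) in auto)
    also have "\<dots> = (\<integral>x. T (indicator (cylinder K w)) x \<partial>M)"
      by (simp add: T_def prob_algebra_configD[OF kernel_in])
    finally show "h w * measure (M \<bind> \<Phi>) (cylinder K w) = h w * (\<integral>x. T (indicator (cylinder K w)) x \<partial>M)"
      by simp
  qed
  also have "\<dots> = (\<integral>x. (\<Sum>w\<in>patterns K. h w * T (indicator (cylinder K w)) x) \<partial>M)"
    by (subst Bochner_Integration.integral_sum)
       (auto intro!: integrable_mult_right integrable_if_local_function[OF M] local_function_T local_function_cylinder K)
  also have "\<dots> = (\<integral>x. T h x \<partial>M)"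
    by (subst T_sum[OF finite_patterns[OF K(1)], symmetric])
       (auto intro: local_function_cylinder K simp: local_function_eq_sum[OF K, symmetric])
  finally show ?thesis .
qed

lemma kernel_pow_in: "kernel_pow \<Phi> t x \<in> space (prob_algebra config_space)"
proof (induction t)
  case 0
  show ?case by (simp add: space_prob_algebra prob_space_return)
next
  case (Suc t)
  then show ?case by (simp add: bind_in)
qed

lemma integral_kernel_pow:
  assumes "local_function h"
  shows "(\<integral>y. h y \<partial>kernel_pow \<Phi> t x) = (T ^^ t) h x"
  using assms
proof (induction t arbitrary: h)
  case 0
  obtain K where "finite K" "depends_on K h" using 0 by (auto simp: local_function_def)
  then show ?case by (simp add: integral_return)
next
  case (Suc t)
  have "(\<integral>y. h y \<partial>kernel_pow \<Phi> (Suc t) x) = (\<integral>y. T h y \<partial>kernel_pow \<Phi> t x)"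
    by (simp add: integral_bind_kernel kernel_pow_in Suc.prems)
  also have "\<dots> = (T ^^ Suc t) h x"
    using Suc.IH[OF local_function_T[OF Suc.prems]] by (simp add: funpow_swap1)
  finally show ?case .
qed

text \<open>Given the present, distinct sites are updated independently: the product over
  \<open>K \<union> L\<close> splits, and a pattern on the union is a pair of patterns.\<close>

lemma T_mult:
  assumes K: "finite K" "depends_on K h" and L: "finite L" "depends_on L g" and disj: "K \<inter> L = {}"
  shows "T (\<lambda>x. h x * g x) = (\<lambda>x. T h x * T g x)"
proof
  fix x
  let ?P = "\<lambda>k s. pmf (\<phi> (view x k)) s"
  let ?m = "\<lambda>(u, v). \<lambda>k. if k \<in> K then u k else v k"
  have hgd: "depends_on (K \<union> L) (\<lambda>x. h x * g x :: real)"
    unfolding depends_on_def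
  proof (intro allI impI)
    fix x y :: "('d, 's) config" assume "\<forall>k\<in>K \<union> L. x k = y k"
    then have "h x = h y" "g x = g y"
      using depends_onD[OF K(2), of x y] depends_onD[OF L(2), of x y] by auto
    then show "h x * g x = h y * g y" by (simp only:)
  qed
  have bij: "bij_betw ?m (patterns K \<times> patterns L) (patterns (K \<union> L))"
  proof (rule bij_betw_byWitness[where f' = "\<lambda>w. (restrict w K, restrict w L)"])
    show "\<forall>a\<in>patterns K \<times> patterns L. (restrict (?m a) K, restrict (?m a) L) = a"
      using disj by (auto simp: fun_eq_iff PiE_def extensional_def)
    show "\<forall>w\<in>patterns (K \<union> L). ?m (restrict w K, restrict w L) = w"
      by (auto simp: fun_eq_iff PiE_def extensional_def)
    show "?m ` (patterns K \<times> patterns L) \<subseteq> patterns (K \<union> L)"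
      by (auto simp: PiE_def extensional_def)
  qed auto
  have "T (\<lambda>x. h x * g x) x = (\<Sum>w\<in>patterns (K \<union> L). h w * g w * (\<Prod>k\<in>K \<union> L. ?P k (w k)))"
    using K L hgd by (subst T_eq[of "K \<union> L"]) auto
  also have "\<dots> = (\<Sum>a\<in>patterns K \<times> patterns L. h (?m a) * g (?m a) * (\<Prod>k\<in>K \<union> L. ?P k (?m a k)))"
    by (rule sum.reindex_bij_betw[OF bij, symmetric])
  also have "\<dots> = (\<Sum>(u, v)\<in>patterns K \<times> patterns L. (h u * (\<Prod>k\<in>K. ?P k (u k))) * (g v * (\<Prod>k\<in>L. ?P k (v k))))"
  proof (intro sum.cong refl)
    fix a :: "('d, 's) config \<times> ('d, 's) config"
    obtain u v where a: "a = (u, v)" by (cases a)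
    have h: "h (?m (u, v)) = h u" by (rule depends_onD[OF K(2)]) auto
    have g: "g (?m (u, v)) = g v" by (rule depends_onD[OF L(2)]) (use disj in auto)
    have "(\<Prod>k\<in>K \<union> L. ?P k (?m (u, v) k)) = (\<Prod>k\<in>K. ?P k (?m (u, v) k)) * (\<Prod>k\<in>L. ?P k (?m (u, v) k))"
      using K L disj by (intro prod.union_disjoint) auto
    also have "(\<Prod>k\<in>K. ?P k (?m (u, v) k)) = (\<Prod>k\<in>K. ?P k (u k))"
      by (intro prod.cong) auto
    also have "(\<Prod>k\<in>L. ?P k (?m (u, v) k)) = (\<Prod>k\<in>L. ?P k (v k))"
      using disj by (intro prod.cong) auto
    finally show "h (?m a) * g (?m a) * (\<Prod>k\<in>K \<union> L. ?P k (?m a k)) =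
        (case a of (u, v) \<Rightarrow> (h u * (\<Prod>k\<in>K. ?P k (u k))) * (g v * (\<Prod>k\<in>L. ?P k (v k))))"
      unfolding a h g by simp
  qed
  also have "\<dots> = T h x * T g x"
    unfolding T_eq[OF K] T_eq[OF L] sum_product sum.cartesian_product ..
  finally show "T (\<lambda>x. h x * g x) x = T h x * T g x" .
qed

text \<open>Disjointness is required below level \<open>t\<close> only: at level \<open>t\<close>
  the two functions are merely evaluated at the same initial configuration, without any
  averaging.\<close>

lemma T_pow_mult:
  assumes K: "finite K" "depends_on K h" and L: "finite L" "depends_on L g"
    and disj: "\<And>s. s < t \<Longrightarrow> (nbrs ns ^^ s) K \<inter> (nbrs ns ^^ s) L = {}"
  shows "(T ^^ t) (\<lambda>x. h x * g x) = (\<lambda>x. (T ^^ t) h x * (T ^^ t) g x)"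
  using disj
proof (induction t)
  case (Suc t)
  have "(T ^^ Suc t) (\<lambda>x. h x * g x) = T (\<lambda>x. (T ^^ t) h x * (T ^^ t) g x)"
    using Suc by simp
  also have "\<dots> = (\<lambda>x. T ((T ^^ t) h) x * T ((T ^^ t) g) x)"
    by (rule T_mult[OF _ T_pow_depends_on[OF K] _ T_pow_depends_on[OF L]]) (use K L Suc.prems in auto)
  finally show ?case by simp
qed simp

end

section \<open>Contraction of perturbed nilpotent automata\<close>

locale noisy_ca = pca ns \<phi> \<Phi>
  for ns :: "(int ^ 'd::finite) list" and \<phi> :: "'s::finite list \<Rightarrow> 's pmf"
    and \<Phi> :: "('d, 's) config \<Rightarrow> ('d, 's) config measure" +
  fixes f :: "'s list \<Rightarrow> 's" and F :: "('d, 's) config \<Rightarrow> ('d, 's) config" and \<epsilon> :: real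
  assumes ca: "ca_local_rule ns f F"
    and noise: "\<And>a. length a = length ns \<Longrightarrow> pmf (\<phi> a) (f a) \<ge> 1 - \<epsilon>"
begin

lemma F_eq: "F x k = f (view x k)"
  using ca by (simp add: ca_local_rule_def)

lemma noise_nonneg: "0 \<le> \<epsilon>"
  using noise[of "replicate (length ns) undefined"] pmf_le_1[of "\<phi> (replicate (length ns) undefined)"]
  by (metis diff_ge_0_iff_ge diff_le_eq le_add_diff_inverse length_replicate order_trans add.commute)

text \<open>One step of the automaton applies a random deterministic map: independently at every site,
  the local rule is replaced by a random table of values.\<close>

lemma random_map_step:
  assumes K: "finite K"
  obtains \<nu> :: "(('d, 's) config \<Rightarrow> ('d, 's) config) pmf" where
    "finite (set_pmf \<nu>)"
    "\<And>h x. depends_on K h \<Longrightarrow> T h x = measure_pmf.expectation \<nu> (\<lambda>G. h (G x))"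
    "\<And>k. k \<in> K \<Longrightarrow> measure \<nu> {G. \<exists>x. G x k \<noteq> F x k} \<le> real CARD('s) ^ length ns * \<epsilon>"
    "\<And>G k. G \<in> set_pmf \<nu> \<Longrightarrow> depends_on (nbrs ns {k}) (\<lambda>x. G x k)"
proof -
  define W where "W = {a :: 's list. length a = length ns}"
  have finW: "finite W" and cardW: "card W = CARD('s) ^ length ns"
    using finite_lists_length_eq[of "UNIV :: 's set"] card_lists_length_eq[of "UNIV :: 's set"]
    by (auto simp: W_def)
  have viewW: "view x k \<in> W" for x k by (simp add: W_def)
  define \<psi> where "\<psi> = Pi_pmf W undefined \<phi>"
  define \<mu> where "\<mu> = Pi_pmf K undefined (\<lambda>_ :: int ^ 'd. \<psi>)"
  \<comment> \<open>Off \<open>K\<close> the map follows \<open>F\<close>, so the tables at the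
    sites of \<open>K\<close> are the only randomness and the support is finite.\<close>
  define \<G> where "\<G> g = (\<lambda>x k. if k \<in> K then g k (view x k) else F x k)" for g
  have comp: "measure \<psi> {g. g a = b} = pmf (\<phi> a) b" if "a \<in> W" for a b
  proof -
    have "pmf (map_pmf (\<lambda>g. g a) \<psi>) b = pmf (\<phi> a) b"
      using finW that by (simp add: \<psi>_def Pi_pmf_component)
    then show ?thesis by (simp add: pmf_map vimage_def)
  qed
  have fin\<psi>: "finite (set_pmf \<psi>)"
    unfolding \<psi>_def using set_Pi_pmf_subset'[OF finW]
    by (rule finite_subset) (use finW in auto)
  have fin\<mu>: "finite (set_pmf \<mu>)"
    unfolding \<mu>_def using set_Pi_pmf_subset'[OF K]
    by (rule finite_subset) (use K fin\<psi> in auto)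
  show ?thesis
  proof (rule that[of "map_pmf \<G> \<mu>"])
    show "finite (set_pmf (map_pmf \<G> \<mu>))" using fin\<mu> by simp
  next
    fix h :: "('d, 's) config \<Rightarrow> real" and x assume h: "depends_on K h"
    have cyl: "measure \<mu> {g. \<G> g x \<in> cylinder K w} = (\<Prod>k\<in>K. pmf (\<phi> (view x k)) (w k))" for w
    proof -
      have "{g. \<G> g x \<in> cylinder K w} = Pi K (\<lambda>k. {g. g (view x k) = w k})"
        by (auto simp: \<G>_def cylinder_def)
      then show ?thesis
        using K by (simp add: \<mu>_def measure_Pi_pmf_Pi comp[OF viewW])
    qed
    have "measure_pmf.expectation (map_pmf \<G> \<mu>) (\<lambda>G. h (G x)) =
        measure_pmf.expectation \<mu> (\<lambda>g. \<Sum>w\<in>patterns K. h w * indicator {g. \<G> g x \<in> cylinder K w} g)"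
      by (simp add: local_function_eq_sum[OF K h, of "\<G> _ x"] indicator_def)
    also have "\<dots> = (\<Sum>w\<in>patterns K. h w * measure \<mu> {g. \<G> g x \<in> cylinder K w})"
      by (subst Bochner_Integration.integral_sum) (auto intro: integrable_measure_pmf_finite fin\<mu>)
    also have "\<dots> = T h x"
      by (simp add: cyl T_eq[OF K h])
    finally show "T h x = measure_pmf.expectation (map_pmf \<G> \<mu>) (\<lambda>G. h (G x))" ..
  next
    fix k assume k: "k \<in> K"
    have "measure (map_pmf \<G> \<mu>) {G. \<exists>x. G x k \<noteq> F x k} = measure \<mu> {g. \<exists>x. \<G> g x k \<noteq> F x k}"
      by (simp add: vimage_def)
    \<comment> \<open>The event on the right no longer mentions \<open>x\<close>: the table at
      \<open>k\<close> errs at some neighbourhood word. The union bound over \<open>W\<close> gives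
      the factor \<open>CARD('s) ^ length ns\<close>.\<close>
    also have "\<dots> \<le> measure \<mu> {g. g k \<in> {g. \<exists>a\<in>W. g a \<noteq> f a}}"
      by (intro measure_pmf.finite_measure_mono) (use k viewW in \<open>auto simp: \<G>_def F_eq\<close>)
    also have "\<dots> = measure (map_pmf (\<lambda>g. g k) \<mu>) {g. \<exists>a\<in>W. g a \<noteq> f a}"
      by (simp add: vimage_def)
    also have "map_pmf (\<lambda>g. g k) \<mu> = \<psi>"
      using K k by (simp add: \<mu>_def Pi_pmf_component)
    also have "{g. \<exists>a\<in>W. g a \<noteq> f a} = (\<Union>a\<in>W. {g. g a \<noteq> f a})"
      by auto
    also have "measure \<psi> \<dots> \<le> (\<Sum>a\<in>W. measure \<psi> {g. g a \<noteq> f a})"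
      by (intro measure_pmf.finite_measure_subadditive_finite finW) auto
    also have "\<dots> \<le> (\<Sum>a\<in>W. \<epsilon>)"
    proof (intro sum_mono)
      fix a assume a: "a \<in> W"
      have "measure \<psi> {g. g a \<noteq> f a} = 1 - measure \<psi> {g. g a = f a}"
        using measure_pmf.prob_compl[of "{g. g a = f a}" \<psi>] by (simp add: Compl_eq_Diff_UNIV[symmetric] Collect_neg_eq)
      then show "measure \<psi> {g. g a \<noteq> f a} \<le> \<epsilon>"
        using comp[OF a] noise[of a] a by (simp add: W_def)
    qed
    also have "\<dots> = real CARD('s) ^ length ns * \<epsilon>"
      by (simp add: cardW)
    finally show "measure (map_pmf \<G> \<mu>) {G. \<exists>x. G x k \<noteq> F x k} \<le> real CARD('s) ^ length ns * \<epsilon>" .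
  next
    fix G k assume "G \<in> set_pmf (map_pmf \<G> \<mu>)"
    then obtain g where G: "G = \<G> g" by auto
    show "depends_on (nbrs ns {k}) (\<lambda>x. G x k)"
      unfolding depends_on_def
    proof (intro allI impI)
      fix x y :: "('d, 's) config" assume "\<forall>j\<in>nbrs ns {k}. x j = y j"
      then have v: "view x k = view y k" by (intro view_cong) blast
      show "G x k = G y k" unfolding G \<G>_def F_eq v ..
    qed
  qed
qed

text \<open>A deviation at a site after \<open>Suc t\<close> steps comes either from the last table
  used there or from a deviation at one of the at most \<open>length ns\<close> neighbours after
  \<open>t\<close> steps.\<close>

primrec error_bound :: "nat \<Rightarrow> real" where
  "error_bound 0 = 0"
| "error_bound (Suc t) = real CARD('s) ^ length ns * \<epsilon> + length ns * error_bound t"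

lemma random_map_steps:
  assumes "finite K"
  obtains \<nu> :: "(('d, 's) config \<Rightarrow> ('d, 's) config) pmf" where
    "finite (set_pmf \<nu>)"
    "\<And>h x. depends_on K h \<Longrightarrow> (T ^^ t) h x = measure_pmf.expectation \<nu> (\<lambda>G. h (G x))"
    "\<And>k. k \<in> K \<Longrightarrow> measure \<nu> {G. \<exists>x. G x k \<noteq> (F ^^ t) x k} \<le> error_bound t"
    "\<And>G k. G \<in> set_pmf \<nu> \<Longrightarrow> depends_on ((nbrs ns ^^ t) {k}) (\<lambda>x. G x k)"
  using assms
proof (induction t arbitrary: K thesis)
  case 0
  show ?case
    by (rule 0(1)[of "return_pmf (\<lambda>x. x)"]) (auto simp: depends_on_def)
next
  case (Suc t)
  obtain \<nu>1 where \<nu>1: "finite (set_pmf \<nu>1)"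
    "\<And>h x. depends_on K h \<Longrightarrow> T h x = measure_pmf.expectation \<nu>1 (\<lambda>G. h (G x))"
    "\<And>k. k \<in> K \<Longrightarrow> measure \<nu>1 {G. \<exists>x. G x k \<noteq> F x k} \<le> real CARD('s) ^ length ns * \<epsilon>"
    "\<And>G k. G \<in> set_pmf \<nu>1 \<Longrightarrow> depends_on (nbrs ns {k}) (\<lambda>x. G x k)"
    using random_map_step[OF Suc.prems(2)] by blast
  obtain \<nu>2 where \<nu>2: "finite (set_pmf \<nu>2)"
    "\<And>h x. depends_on (nbrs ns K) h \<Longrightarrow> (T ^^ t) h x = measure_pmf.expectation \<nu>2 (\<lambda>G. h (G x))"
    "\<And>k. k \<in> nbrs ns K \<Longrightarrow> measure \<nu>2 {G. \<exists>x. G x k \<noteq> (F ^^ t) x k} \<le> error_bound t"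
    "\<And>G k. G \<in> set_pmf \<nu>2 \<Longrightarrow> depends_on ((nbrs ns ^^ t) {k}) (\<lambda>x. G x k)"
    using Suc.IH[of "nbrs ns K"] Suc.prems(2) by auto
  \<comment> \<open>\<open>G2\<close> performs the first \<open>t\<close> steps and
    \<open>G1\<close>, independent of it, the last one. \<open>G2\<close> must be a valid coupling
    on all of \<open>nbrs ns K\<close>, which is why \<open>K\<close> is arbitrary in the
    induction.\<close>
  define \<nu> where "\<nu> = map_pmf (\<lambda>(G2, G1). G1 \<circ> G2) (pair_pmf \<nu>2 \<nu>1)"
  show ?case
  proof (rule Suc.prems(1)[of \<nu>])
    show "finite (set_pmf \<nu>)"
      using \<nu>1(1) \<nu>2(1) by (simp add: \<nu>_def)
  next
    fix h :: "('d, 's) config \<Rightarrow> real" and x assume h: "depends_on K h"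
    have "(T ^^ Suc t) h x = (T ^^ t) (T h) x"
      by (simp add: funpow_swap1)
    also have "\<dots> = measure_pmf.expectation \<nu>2 (\<lambda>G. T h (G x))"
      by (rule \<nu>2(2)[OF T_depends_on[OF Suc.prems(2) h]])
    also have "\<dots> = measure_pmf.expectation \<nu>2 (\<lambda>G2. measure_pmf.expectation \<nu>1 (\<lambda>G1. h (G1 (G2 x))))"
      by (simp add: \<nu>1(2)[OF h])
    also have "\<dots> = (\<Sum>G2\<in>set_pmf \<nu>2. pmf \<nu>2 G2 * measure_pmf.expectation \<nu>1 (\<lambda>G1. h (G1 (G2 x))))"
      using \<nu>2(1) by (subst integral_measure_pmf_real[of "set_pmf \<nu>2"]) (auto simp: mult.commute)
    also have "\<dots> = measure_pmf.expectation (pair_pmf \<nu>2 \<nu>1) (\<lambda>(G2, G1). h (G1 (G2 x)))"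
      unfolding pair_pmf_def map_pmf_def[symmetric]
      by (subst pmf_expectation_bind[OF \<nu>2(1)]) (use \<nu>1(1) in auto)
    also have "\<dots> = measure_pmf.expectation \<nu> (\<lambda>G. h (G x))"
      by (simp add: \<nu>_def case_prod_beta')
    finally show "(T ^^ Suc t) h x = measure_pmf.expectation \<nu> (\<lambda>G. h (G x))" .
  next
    fix k assume k: "k \<in> K"
    let ?b1 = "{G. \<exists>x. G x k \<noteq> F x k}" and ?b2 = "\<lambda>n. {G. \<exists>x. G x (k + n) \<noteq> (F ^^ t) x (k + n)}"
    let ?p = "pair_pmf \<nu>2 \<nu>1"
    have "measure \<nu> {G. \<exists>x. G x k \<noteq> (F ^^ Suc t) x k} =
        measure ?p {p. \<exists>x. snd p (fst p x) k \<noteq> F ((F ^^ t) x) k}"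
      by (simp add: \<nu>_def vimage_def case_prod_beta)
    also have "\<dots> \<le> measure ?p (snd -` ?b1 \<union> (\<Union>n\<in>set ns. fst -` ?b2 n))"
    proof (intro measure_pmf.finite_measure_mono subsetI)
      fix p :: "(('d, 's) config \<Rightarrow> ('d, 's) config) \<times> (('d, 's) config \<Rightarrow> ('d, 's) config)"
      assume "p \<in> {p. \<exists>x. snd p (fst p x) k \<noteq> F ((F ^^ t) x) k}"
      then obtain x where ne: "snd p (fst p x) k \<noteq> F ((F ^^ t) x) k" by auto
      show "p \<in> snd -` ?b1 \<union> (\<Union>n\<in>set ns. fst -` ?b2 n)"
      proof (cases "p \<in> (\<Union>n\<in>set ns. fst -` ?b2 n)")
        case False
        then have "view (fst p x) k = view ((F ^^ t) x) k" by auto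
        then have "F (fst p x) k = F ((F ^^ t) x) k" by (simp only: F_eq)
        \<comment> \<open>The event \<open>?b1\<close> ranges over all configurations, so the random
          configuration \<open>fst p x\<close> may serve as its witness.\<close>
        with ne have "snd p (fst p x) k \<noteq> F (fst p x) k" by simp
        then show ?thesis by auto
      qed auto
    qed auto
    also have "\<dots> \<le> measure ?p (snd -` ?b1) + measure ?p (\<Union>n\<in>set ns. fst -` ?b2 n)"
      by (intro measure_Un_le) auto
    also have "\<dots> \<le> measure ?p (snd -` ?b1) + (\<Sum>n\<in>set ns. measure ?p (fst -` ?b2 n))"
      by (intro add_left_mono measure_pmf.finite_measure_subadditive_finite) auto
    also have "measure ?p (snd -` ?b1) = measure \<nu>1 ?b1"
      by (metis measure_map_pmf map_snd_pair_pmf)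
    also have "(\<Sum>n\<in>set ns. measure ?p (fst -` ?b2 n)) = (\<Sum>n\<in>set ns. measure \<nu>2 (?b2 n))"
      by (intro sum.cong refl) (metis measure_map_pmf map_fst_pair_pmf)
    also have "measure \<nu>1 ?b1 + (\<Sum>n\<in>set ns. measure \<nu>2 (?b2 n)) \<le>
        real CARD('s) ^ length ns * \<epsilon> + (\<Sum>n\<in>set ns. error_bound t)"
      using \<nu>1(3) \<nu>2(3) k by (intro add_mono sum_mono) (auto simp: nbrs_def)
    also have "\<dots> \<le> error_bound (Suc t)"
    proof -
      have "0 \<le> error_bound t"
        using noise_nonneg by (induction t) auto
      moreover have "real (card (set ns)) \<le> real (length ns)"
        by (simp add: card_length)
      ultimately show ?thesis by (simp add: mult_right_mono)
    qed
    finally show "measure \<nu> {G. \<exists>x. G x k \<noteq> (F ^^ Suc t) x k} \<le> error_bound (Suc t)" .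
  next
    fix G k assume "G \<in> set_pmf \<nu>"
    then obtain G1 G2 where G: "G = G1 \<circ> G2" "G1 \<in> set_pmf \<nu>1" "G2 \<in> set_pmf \<nu>2"
      by (auto simp: \<nu>_def)
    show "depends_on ((nbrs ns ^^ Suc t) {k}) (\<lambda>x. G x k)"
      unfolding depends_on_def
    proof (intro allI impI)
      fix x y assume eq: "\<forall>j\<in>(nbrs ns ^^ Suc t) {k}. x j = (y j :: 's)"
      have G2: "G2 x j = G2 y j" if "j \<in> nbrs ns {k}" for j
      proof (rule depends_onD[OF \<nu>2(4)[OF G(3), of j], of x y])
        fix i assume "i \<in> (nbrs ns ^^ t) {j}"
        then have "i \<in> (nbrs ns ^^ t) (nbrs ns {k})"
          using that by (subst nbrs_pow_Un) auto
        then show "x i = y i" using eq by (simp add: funpow_swap1)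
      qed
      then show "G x k = G y k"
        unfolding G(1) comp_def by (rule depends_onD[OF \<nu>1(4)[OF G(2), of k], of "G2 x" "G2 y"])
    qed
  qed
qed

text \<open>Traced back in blocks of \<open>N\<close> steps, the relevant sites form a branching
  process: a site where \<open>G\<close> is constant dies, any other has at most
  \<open>length ns ^ N\<close> descendants. Assumption \<open>small\<close> says that the mean
  number of descendants is at most 1/2. Only expected sizes enter, so linearity of expectation
  replaces any independence between sites.\<close>

lemma contraction:
  assumes nil: "\<And>x. (F ^^ N) x = c" and small: "error_bound N * length ns ^ N \<le> 1 / 2"
    and "finite K" "depends_on K h" "\<And>x y. \<bar>h x - h y\<bar> \<le> 1"
  shows "\<bar>(T ^^ (N * n)) h x - (T ^^ (N * n)) h y\<bar> \<le> card K * (1 / 2) ^ n"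
  using assms(3-5)
proof (induction n arbitrary: K h)
  case 0
  show ?case
  \<comment> \<open>For empty \<open>K\<close> the claimed bound is 0, and \<open>h\<close> is
    indeed constant.\<close>
  proof (cases "K = {}")
    case True
    then have "h x = h y" by (intro depends_onD[OF 0(2)]) auto
    then show ?thesis by simp
  next
    case False
    then have "1 \<le> card K" using 0(1) by (simp add: Suc_le_eq card_gt_0_iff)
    then show ?thesis using 0(3)[of x y] by simp
  qed
next
  case (Suc n)
  note K = Suc.prems(1,2)
  obtain \<nu> where \<nu>: "finite (set_pmf \<nu>)"
    "\<And>h x. depends_on K h \<Longrightarrow> (T ^^ N) h x = measure_pmf.expectation \<nu> (\<lambda>G. h (G x))"
    "\<And>k. k \<in> K \<Longrightarrow> measure \<nu> {G. \<exists>x. G x k \<noteq> (F ^^ N) x k} \<le> error_bound N"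
    "\<And>G k. G \<in> set_pmf \<nu> \<Longrightarrow> depends_on ((nbrs ns ^^ N) {k}) (\<lambda>x. G x k)"
    using random_map_steps[OF K(1)] by blast
  define B where "B G = {k \<in> K. \<exists>x. G x k \<noteq> c k}" for G :: "('d, 's) config \<Rightarrow> ('d, 's) config"
  define L where "L G = (\<Union>k\<in>B G. (nbrs ns ^^ N) {k})" for G
  have finB: "finite (B G)" for G using K(1) by (simp add: B_def)
  have finL: "finite (L G)" for G using finB by (simp add: L_def)
  have depL: "depends_on (L G) (\<lambda>x. h (G x))" if "G \<in> set_pmf \<nu>" for G
    unfolding depends_on_def
  proof (intro allI impI, rule depends_onD[OF K(2)])
    fix x y :: "('d, 's) config" and k assume eq: "\<forall>k\<in>L G. x k = y k" and "k \<in> K"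
    show "G x k = G y k"
    proof (cases "k \<in> B G")
      case True
      then show ?thesis
        by (intro depends_onD[OF \<nu>(4)[OF that, of k], of x y]) (use eq in \<open>auto simp: L_def\<close>)
    next
      case False
      then show ?thesis using \<open>k \<in> K\<close> by (simp add: B_def)
    qed
  qed
  have cardL: "card (L G) \<le> length ns ^ N * card (B G)" for G
    unfolding L_def nbrs_pow_Un[symmetric] by (rule card_nbrs_pow[OF finB])
  let ?S = "set_pmf \<nu>"
  let ?t = "T ^^ (N * n)"
  \<comment> \<open>The block split off is the one next to \<open>h\<close>, so the induction
    hypothesis applies to each \<open>h \<circ> G\<close> separately, with its own random set
    \<open>L G\<close> in place of \<open>K\<close>.\<close>
  have expand: "(T ^^ (N * Suc n)) h = (\<lambda>x. \<Sum>G\<in>?S. pmf \<nu> G * ?t (\<lambda>x. h (G x)) x)"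
  proof -
    have "(T ^^ (N * Suc n)) h = ?t ((T ^^ N) h)"
      by (metis add.commute comp_apply funpow_add mult_Suc_right)
    also have "(T ^^ N) h = (\<lambda>x. \<Sum>G\<in>?S. pmf \<nu> G * h (G x))"
      using \<nu>(1) by (subst \<nu>(2)[OF K(2), abs_def], subst integral_measure_pmf_real[of ?S]) (auto simp: mult.commute)
    also have "?t \<dots> = (\<lambda>x. \<Sum>G\<in>?S. pmf \<nu> G * ?t (\<lambda>x. h (G x)) x)"
      by (rule T_pow_sum) (use \<nu>(1) finL depL in \<open>auto intro: local_functionI\<close>)
    finally show ?thesis .
  qed
  have "\<bar>(T ^^ (N * Suc n)) h x - (T ^^ (N * Suc n)) h y\<bar> =
      \<bar>\<Sum>G\<in>?S. pmf \<nu> G * (?t (\<lambda>x. h (G x)) x - ?t (\<lambda>x. h (G x)) y)\<bar>"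
    unfolding expand by (simp add: sum_subtractf right_diff_distrib)
  also have "\<dots> \<le> (\<Sum>G\<in>?S. pmf \<nu> G * (real (length ns ^ N * card (B G)) * (1 / 2) ^ n))"
  proof (rule order_trans[OF sum_abs], rule sum_mono)
    fix G assume G: "G \<in> ?S"
    have "\<bar>?t (\<lambda>x. h (G x)) x - ?t (\<lambda>x. h (G x)) y\<bar> \<le> card (L G) * (1 / 2) ^ n"
      using Suc.prems(3) by (intro Suc.IH finL depL G)
    also have "\<dots> \<le> real (length ns ^ N * card (B G)) * (1 / 2) ^ n"
      using cardL[of G] by (intro mult_right_mono) (simp_all only: of_nat_le_iff, simp)
    finally show "\<bar>pmf \<nu> G * (?t (\<lambda>x. h (G x)) x - ?t (\<lambda>x. h (G x)) y)\<bar> \<le>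
        pmf \<nu> G * (real (length ns ^ N * card (B G)) * (1 / 2) ^ n)"
      by (simp add: abs_mult mult_left_mono)
  qed
  also have "\<dots> = length ns ^ N * (1 / 2) ^ n * (\<Sum>G\<in>?S. pmf \<nu> G * card (B G))"
    by (simp add: sum_distrib_left mult_ac)
  also have "(\<Sum>G\<in>?S. pmf \<nu> G * card (B G)) = (\<Sum>G\<in>?S. \<Sum>k\<in>K. pmf \<nu> G * indicator {G. \<exists>x. G x k \<noteq> c k} G)"
  proof (intro sum.cong refl)
    fix G
    have "B G = K \<inter> {k. \<exists>x. G x k \<noteq> c k}" by (auto simp: B_def)
    then have "real (card (B G)) = (\<Sum>k\<in>K. of_bool (\<exists>x. G x k \<noteq> c k))"
      using K(1) by (simp only: sum_of_bool_eq)
    also have "\<dots> = (\<Sum>k\<in>K. indicator {G. \<exists>x. G x k \<noteq> c k} G)"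
      by (intro sum.cong refl) (simp only: indicator_def mem_Collect_eq)
    finally have "real (card (B G)) = (\<Sum>k\<in>K. indicator {G. \<exists>x. G x k \<noteq> c k} G)" .
    then show "pmf \<nu> G * card (B G) = (\<Sum>k\<in>K. pmf \<nu> G * indicator {G. \<exists>x. G x k \<noteq> c k} G)"
      by (simp add: sum_distrib_left)
  qed
  also have "\<dots> = (\<Sum>k\<in>K. \<Sum>G\<in>?S. pmf \<nu> G * indicator {G. \<exists>x. G x k \<noteq> c k} G)"
    by (rule sum.swap)
  also have "\<dots> = (\<Sum>k\<in>K. measure \<nu> {G. \<exists>x. G x k \<noteq> c k})"
  proof (intro sum.cong refl)
    fix k
    have "measure \<nu> {G. \<exists>x. G x k \<noteq> c k} = measure_pmf.expectation \<nu> (indicator {G. \<exists>x. G x k \<noteq> c k})"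
      by simp
    also have "\<dots> = (\<Sum>G\<in>?S. pmf \<nu> G * indicator {G. \<exists>x. G x k \<noteq> c k} G)"
      using \<nu>(1) by (subst integral_measure_pmf_real[of ?S]) (auto simp: mult.commute)
    finally show "(\<Sum>G\<in>?S. pmf \<nu> G * indicator {G. \<exists>x. G x k \<noteq> c k} G) = measure \<nu> {G. \<exists>x. G x k \<noteq> c k}" ..
  qed
  also have "\<dots> \<le> (\<Sum>k\<in>K. error_bound N)"
    using \<nu>(3) by (intro sum_mono) (simp add: nil)
  also have "\<dots> = card K * error_bound N"
    by simp
  finally have "\<bar>(T ^^ (N * Suc n)) h x - (T ^^ (N * Suc n)) h y\<bar> \<le>
      length ns ^ N * (1 / 2) ^ n * (card K * error_bound N)"
    by (simp add: mult_left_mono)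
  also have "\<dots> = card K * (1 / 2) ^ n * (error_bound N * length ns ^ N)"
    by simp
  also have "\<dots> \<le> card K * (1 / 2) ^ n * (1 / 2)"
    by (intro mult_left_mono small) auto
  finally show ?case by simp
qed

end

section \<open>Ergodicity and mixing of contracting automata\<close>

locale contracting_pca = pca ns \<phi> \<Phi>
  for ns :: "(int ^ 'd::finite) list" and \<phi> :: "'s::finite list \<Rightarrow> 's pmf"
    and \<Phi> :: "('d, 's) config \<Rightarrow> ('d, 's) config measure" +
  fixes N :: nat
  assumes N_pos: "0 < N"
    and contraction: "\<And>K h n x y. finite K \<Longrightarrow> depends_on K h \<Longrightarrow> (\<And>x y. \<bar>h x - h y\<bar> \<le> 1) \<Longrightarrow>
      \<bar>(T ^^ (N * n)) h x - (T ^^ (N * n)) h y\<bar> \<le> card K * (1 / 2) ^ n"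
begin

lemma T_pow_scale:
  assumes "local_function h"
  shows "(T ^^ t) (\<lambda>x. c * h x) = (\<lambda>x. c * (T ^^ t) h x)"
  using T_pow_sum[of "{()}" "\<lambda>_. h" t "\<lambda>_. c"] assms by simp

lemma T_pow_near:
  assumes "local_function g" "\<And>x y. \<bar>g x - g y\<bar> \<le> e"
  shows "\<bar>(T ^^ s) g x - g y\<bar> \<le> e"
proof -
  have "g y - e \<le> g z \<and> g z \<le> g y + e" for z
    using assms(2)[of z y] by (simp add: abs_le_iff)
  then show ?thesis
    using T_pow_bounds[OF assms(1), of "g y - e" "g y + e" s x] by (simp add: abs_le_iff)
qed

text \<open>\<open>contraction\<close> covers oscillation 1 and multiples of \<open>N\<close>.
  Dividing by \<open>M\<close> removes the first restriction. The remaining \<open>t mod N\<close>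
  steps and the \<open>s\<close> extra ones are averages, which cannot leave a range of values
  already reached.\<close>

lemma T_pow_cauchy:
  assumes K: "finite K" "depends_on K h" and M: "0 < M" "\<And>x y. \<bar>h x - h y\<bar> \<le> M"
  shows "\<bar>(T ^^ (s + t)) h x - (T ^^ t) h y\<bar> \<le> M * card K * (1 / 2) ^ (t div N)"
proof -
  let ?n = "t div N" and ?m = "t mod N"
  let ?e = "M * card K * (1 / 2) ^ (t div N)"
  have h: "local_function h" using K by (rule local_functionI)
  have 1: "\<bar>(T ^^ (N * ?n)) h x - (T ^^ (N * ?n)) h y\<bar> \<le> ?e" for x y
  proof -
    have "\<bar>(T ^^ (N * ?n)) (\<lambda>x. 1 / M * h x) x - (T ^^ (N * ?n)) (\<lambda>x. 1 / M * h x) y\<bar> \<le> card K * (1 / 2) ^ ?n"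
    proof (rule contraction[OF K(1)])
      show "depends_on K (\<lambda>x. 1 / M * h x)"
        unfolding depends_on_def
      proof (intro allI impI)
        fix x y :: "('d, 's) config" assume "\<forall>k\<in>K. x k = y k"
        then have "h x = h y" using depends_onD[OF K(2), of x y] by blast
        then show "1 / M * h x = 1 / M * h y" by simp
      qed
      show "\<bar>1 / M * h x - 1 / M * h y\<bar> \<le> 1" for x y
        using M(1) M(2)[of x y] by (simp add: diff_divide_distrib[symmetric] abs_divide)
    qed
    then have "\<bar>(T ^^ (N * ?n)) h x - (T ^^ (N * ?n)) h y\<bar> / M \<le> card K * (1 / 2) ^ ?n"
      using M(1) unfolding T_pow_scale[OF h] by (simp add: diff_divide_distrib[symmetric] abs_divide)
    then show ?thesis using M(1) by (simp add: field_simps)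
  qed
  have 2: "\<bar>(T ^^ t) h x - (T ^^ (N * ?n)) h y\<bar> \<le> ?e" for x y
  proof -
    have "(T ^^ t) h = (T ^^ ?m) ((T ^^ (N * ?n)) h)"
      by (metis comp_apply funpow_add mod_mult_div_eq)
    then show ?thesis
      using T_pow_near[OF local_function_T_pow[OF h] 1, of ?m x y] by simp
  qed
  have 3: "\<bar>(T ^^ t) h x - (T ^^ t) h y\<bar> \<le> ?e" for x y
  proof -
    have "(T ^^ t) h x - ?e \<le> (T ^^ (N * ?n)) h z \<and> (T ^^ (N * ?n)) h z \<le> (T ^^ t) h x + ?e" for z
      using 2[of x z] by (simp add: abs_le_iff)
    then have "(T ^^ t) h x - ?e \<le> (T ^^ ?m) ((T ^^ (N * ?n)) h) y \<and>
        (T ^^ ?m) ((T ^^ (N * ?n)) h) y \<le> (T ^^ t) h x + ?e"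
      by (intro T_pow_bounds local_function_T_pow h) auto
    moreover have "(T ^^ ?m) ((T ^^ (N * ?n)) h) = (T ^^ t) h"
      by (metis comp_apply funpow_add mod_mult_div_eq)
    ultimately show ?thesis by (simp add: abs_le_iff)
  qed
  show ?thesis
    using T_pow_near[OF local_function_T_pow[OF h] 3, of s x y] by (simp add: funpow_add)
qed

text \<open>The starting configuration is an arbitrary choice: by \<open>limit_rate\<close> every
  other one leads to the same value.\<close>

definition limit :: "(('d, 's) config \<Rightarrow> real) \<Rightarrow> real" where
  "limit h = lim (\<lambda>t. (T ^^ t) h (\<lambda>_. undefined))"

lemma rate_tendsto_0: "(\<lambda>t. C * (1 / 2) ^ (t div N) :: real) \<longlonglongrightarrow> 0"
proof -
  have "filterlim (\<lambda>t. t div N) at_top sequentially"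
    using N_pos by (intro filterlim_at_top_div_const_nat) auto
  then have "(\<lambda>t. (1 / 2 :: real) ^ (t div N)) \<longlonglongrightarrow> 0"
    by (rule filterlim_compose[OF LIMSEQ_power_zero, rotated]) simp
  then show ?thesis by (rule tendsto_mult_right_zero)
qed

lemma limit_rate:
  assumes K: "finite K" "depends_on K h" and M: "0 < M" "\<And>x y. \<bar>h x - h y\<bar> \<le> M"
  shows "\<bar>(T ^^ t) h x - limit h\<bar> \<le> M * card K * (1 / 2) ^ (t div N)"
proof -
  let ?a = "\<lambda>t. (T ^^ t) h (\<lambda>_. undefined)"
  note C = T_pow_cauchy[OF K M]
  have "Cauchy ?a"
    unfolding Cauchy_altdef
  proof (intro allI impI)
    fix e :: real assume "0 < e"
    then have "\<forall>\<^sub>F t in sequentially. M * card K * (1 / 2) ^ (t div N) < e"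
      by (rule order_tendstoD(2)[OF rate_tendsto_0])
    then obtain t0 where t0: "\<And>t. t \<ge> t0 \<Longrightarrow> M * card K * (1 / 2) ^ (t div N) < e"
      by (auto simp: eventually_sequentially)
    show "\<exists>M. \<forall>m\<ge>M. \<forall>n>m. dist (?a m) (?a n) < e"
    proof (intro exI allI impI)
      fix m n assume mn: "t0 \<le> m" "m < n"
      have "dist (?a m) (?a n) = \<bar>(T ^^ ((n - m) + m)) h (\<lambda>_. undefined) - ?a m\<bar>"
        using mn by (simp add: dist_real_def abs_minus_commute)
      also have "\<dots> < e" using C[of "n - m" m] t0[OF mn(1)] by (rule le_less_trans)
      finally show "dist (?a m) (?a n) < e" .
    qed
  qed
  then have "convergent ?a" by (simp add: Cauchy_convergent_iff)
  then have lim: "?a \<longlonglongrightarrow> limit h" unfolding limit_def by (simp add: convergent_LIMSEQ_iff)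
  \<comment> \<open>The rate follows from \<open>T_pow_cauchy\<close> by sending the extra time
    \<open>s\<close> to infinity.\<close>
  have "(\<lambda>s. \<bar>(T ^^ t) h x - ?a (s + t)\<bar>) \<longlonglongrightarrow> \<bar>(T ^^ t) h x - limit h\<bar>"
    by (intro tendsto_rabs tendsto_diff tendsto_const LIMSEQ_ignore_initial_segment[OF lim])
  then show ?thesis
    by (rule LIMSEQ_le_const2) (use C[of _ t "\<lambda>_. undefined" x] in \<open>auto simp: abs_minus_commute\<close>)
qed

lemma osc_bound:
  fixes h :: "('d, 's) config \<Rightarrow> real"
  assumes "finite K" "depends_on K h"
  obtains M where "0 < M" "\<And>x y. \<bar>h x - h y\<bar> \<le> M"
proof
  let ?S = "\<Sum>w\<in>patterns K. \<bar>h w\<bar>"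
  have S: "\<bar>h x\<bar> \<le> ?S" for x
  proof -
    have "h x = h (restrict x K)" by (intro depends_onD[OF assms(2)]) auto
    then show ?thesis
      using member_le_sum[of "restrict x K" "patterns K" "\<lambda>w. \<bar>h w\<bar>"] finite_patterns[OF assms(1)] by auto
  qed
  show "0 < 2 * ?S + 1" by (simp add: add_nonneg_pos sum_nonneg)
  show "\<bar>h x - h y\<bar> \<le> 2 * ?S + 1" for x y using S[of x] S[of y] by linarith
qed

lemma T_pow_tendsto_limit:
  assumes "local_function h"
  shows "(\<lambda>t. (T ^^ t) h x) \<longlonglongrightarrow> limit h"
proof -
  obtain K where K: "finite K" "depends_on K h" using assms by (auto simp: local_function_def)
  obtain M where M: "0 < M" "\<And>x y. \<bar>h x - h y\<bar> \<le> M" using osc_bound[OF K] by blast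
  show ?thesis
    by (rule Lim_null_comparison[OF _ rate_tendsto_0[of "M * card K"], THEN LIM_zero_cancel])
       (use limit_rate[OF K M] in auto)
qed

lemma limit_eqI: "local_function h \<Longrightarrow> (\<lambda>t. (T ^^ t) h x) \<longlonglongrightarrow> l \<Longrightarrow> limit h = l"
  using LIMSEQ_unique T_pow_tendsto_limit by blast

lemma limit_sum:
  assumes "finite I" "\<And>i. i \<in> I \<Longrightarrow> local_function (h i)"
  shows "limit (\<lambda>x. \<Sum>i\<in>I. c i * h i x) = (\<Sum>i\<in>I. c i * limit (h i))"
proof (rule limit_eqI[OF local_function_sum[OF assms(1)]])
  show "local_function (h i)" if "i \<in> I" for i using assms(2)[OF that] .
  show "(\<lambda>t. (T ^^ t) (\<lambda>x. \<Sum>i\<in>I. c i * h i x) x) \<longlonglongrightarrow> (\<Sum>i\<in>I. c i * limit (h i))" for x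
    using T_pow_sum[of I h _ c, OF assms(1)] assms(2)
    by (auto intro!: tendsto_sum tendsto_mult_left T_pow_tendsto_limit)
qed

lemma limit_T:
  assumes "local_function h"
  shows "limit (T h) = limit h"
proof (rule limit_eqI[OF local_function_T[OF assms]])
  show "(\<lambda>t. (T ^^ t) (T h) x) \<longlonglongrightarrow> limit h" for x
    using LIMSEQ_Suc[OF T_pow_tendsto_limit[OF assms, of x]] by (simp add: funpow_swap1)
qed

section \<open>Existence and uniqueness of the invariant measure, uniform ergodicity\<close>

lemma measure_eq_integral_indicator:
  assumes "M \<in> space (prob_algebra config_space)" "finite K"
  shows "measure M (cylinder K u) = (\<integral>x. indicator (cylinder K u) x \<partial>M)"
  using prob_algebra_configD[OF assms(1)] by simp

text \<open>By invariance \<open>h\<close> may be replaced under the integral by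
  \<open>(T ^^ t) h\<close>, which is uniformly close to the constant \<open>limit h\<close>. Hence
  every invariant measure has the same integrals of local functions, which gives uniqueness.\<close>

lemma invariant_integral:
  assumes "invariant \<Phi> \<pi>" "local_function h"
  shows "(\<integral>x. h x \<partial>\<pi>) = limit h"
proof -
  have \<pi>: "\<pi> \<in> space (prob_algebra config_space)" "\<pi> \<bind> \<Phi> = \<pi>"
    using assms(1) by (auto simp: invariant_def)
  interpret prob_space \<pi> by (rule prob_algebra_configD[OF \<pi>(1)])
  have eq: "(\<integral>x. (T ^^ t) h x \<partial>\<pi>) = (\<integral>x. h x \<partial>\<pi>)" for t
  proof (induction t)
    case (Suc t)
    then show ?case
      using integral_bind_kernel[OF \<pi>(1) local_function_T_pow[OF assms(2), of t]] \<pi>(2) by simp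
  qed simp
  obtain K where K: "finite K" "depends_on K h" using assms(2) by (auto simp: local_function_def)
  obtain M where M: "0 < M" "\<And>x y. \<bar>h x - h y\<bar> \<le> M" using osc_bound[OF K] by blast
  have "\<bar>(\<integral>x. h x \<partial>\<pi>) - limit h\<bar> \<le> M * card K * (1 / 2) ^ (t div N)" for t
  proof -
    let ?e = "M * card K * (1 / 2) ^ (t div N)"
    have int: "integrable \<pi> ((T ^^ t) h)"
      by (rule integrable_if_local_function[OF \<pi>(1) local_function_T_pow[OF assms(2)]])
    have b: "limit h - ?e \<le> (T ^^ t) h x" "(T ^^ t) h x \<le> limit h + ?e" for x
      using limit_rate[OF K M, of t x] by (auto simp: abs_le_iff)
    have "limit h - ?e \<le> (\<integral>x. (T ^^ t) h x \<partial>\<pi>)"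
      by (rule integral_ge_const[OF int]) (use b in auto)
    moreover have "(\<integral>x. (T ^^ t) h x \<partial>\<pi>) \<le> limit h + ?e"
      by (rule integral_le_const[OF int]) (use b in auto)
    ultimately show ?thesis by (simp add: eq abs_le_iff)
  qed
  then have "\<bar>(\<integral>x. h x \<partial>\<pi>) - limit h\<bar> \<le> 0"
    by (intro LIMSEQ_le_const[OF rate_tendsto_0]) auto
  then show ?thesis by simp
qed

lemma measure_invariant:
  assumes "invariant \<Phi> \<pi>" "finite K"
  shows "measure \<pi> (cylinder K u) = limit (indicator (cylinder K u))"
proof -
  have "\<pi> \<in> space (prob_algebra config_space)" using assms(1) by (simp add: invariant_def)
  then have "measure \<pi> (cylinder K u) = (\<integral>x. indicator (cylinder K u) x \<partial>\<pi>)"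
    by (rule measure_eq_integral_indicator[OF _ assms(2)])
  also have "\<dots> = limit (indicator (cylinder K u))"
    by (rule invariant_integral[OF assms(1) local_function_cylinder[OF assms(2)]])
  finally show ?thesis .
qed

lemma exists_invariant: "\<exists>\<pi>. invariant \<Phi> \<pi>"
proof -
  have l_sum: "limit (\<lambda>x. \<Sum>i\<in>I. h i x) = (\<Sum>i\<in>I. limit (h i))"
    if "finite I" "\<And>i. i \<in> I \<Longrightarrow> \<exists>K. finite K \<and> depends_on K (h i)"
    for I :: "('d, 's) config set" and h
    using limit_sum[of I h "\<lambda>_. 1"] that by (simp add: local_function_def)
  have l_pos: "0 \<le> limit h" if lh: "finite K" "depends_on K h" "\<And>x. 0 \<le> h x" for h K
  proof -
    have h: "local_function h" using lh by (auto simp: local_function_def)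
    obtain M where M: "0 < M" "\<And>x y. \<bar>h x - h y\<bar> \<le> M" using osc_bound[OF lh(1,2)] by blast
    have "h x \<le> h (\<lambda>_. undefined) + M" for x
      using M(2)[of x "\<lambda>_. undefined"] by (simp add: abs_le_iff)
    then have "0 \<le> (T ^^ t) h x" for t x
      using T_pow_bounds[OF h, of 0 "h (\<lambda>_. undefined) + M" t x] lh(3) by auto
    then show ?thesis by (intro LIMSEQ_le_const[OF T_pow_tendsto_limit[OF h]]) auto
  qed
  have l_one: "limit (\<lambda>_. 1) = 1"
    by (rule limit_eqI) (auto simp: T_pow_const local_function_def depends_on_def)
  have "\<exists>\<pi>\<in>space (prob_algebra config_space).
      \<forall>K u. finite K \<longrightarrow> measure \<pi> (cylinder K u) = limit (indicator (cylinder K u))"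
    by (rule exists_config_measure) (fact l_sum, fact l_pos, fact l_one)
  then obtain \<pi> where \<pi>: "\<pi> \<in> space (prob_algebra config_space)"
    "\<And>K u. finite K \<Longrightarrow> measure \<pi> (cylinder K u) = limit (indicator (cylinder K u))"
    by blast
  have int: "(\<integral>x. h x \<partial>\<pi>) = limit h" if h: "local_function h" for h
  proof -
    obtain K where K: "finite K" "depends_on K h" using h by (auto simp: local_function_def)
    have "(\<integral>x. h x \<partial>\<pi>) = (\<Sum>w\<in>patterns K. h w * limit (indicator (cylinder K w)))"
      using integral_local_function[OF K] prob_algebra_configD[OF \<pi>(1)] \<pi>(2)[OF K(1)] by simp
    also have "\<dots> = limit (\<lambda>x. \<Sum>w\<in>patterns K. h w * indicator (cylinder K w) x)"
      by (rule limit_sum[symmetric]) (use K in \<open>auto intro: local_function_cylinder\<close>)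
    also have "(\<lambda>x. \<Sum>w\<in>patterns K. h w * indicator (cylinder K w) x) = h"
      by (rule ext, rule local_function_eq_sum[OF K, symmetric])
    finally show ?thesis .
  qed
  have "\<pi> \<bind> \<Phi> = \<pi>"
  proof (rule config_measure_eqI[OF bind_in[OF \<pi>(1)] \<pi>(1)])
    fix K :: "(int ^ 'd) set" and u :: "('d, 's) config" assume K: "finite K"
    note loc = local_function_cylinder[OF K, of u]
    have "measure (\<pi> \<bind> \<Phi>) (cylinder K u) = (\<integral>x. T (indicator (cylinder K u)) x \<partial>\<pi>)"
      using measure_eq_integral_indicator[OF bind_in[OF \<pi>(1)] K] integral_bind_kernel[OF \<pi>(1) loc] by simp
    also have "\<dots> = limit (indicator (cylinder K u))"
      using int[OF local_function_T[OF loc]] limit_T[OF loc] by simp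
    finally show "measure (\<pi> \<bind> \<Phi>) (cylinder K u) = measure \<pi> (cylinder K u)"
      using \<pi>(2)[OF K] by simp
  qed
  then show ?thesis using \<pi>(1) by (auto simp: invariant_def)
qed

lemma kernel_pow_cylinder:
  assumes "finite K"
  shows "measure (kernel_pow \<Phi> t x) (cylinder K u) = (T ^^ t) (indicator (cylinder K u)) x"
  using measure_eq_integral_indicator[OF kernel_pow_in assms]
    integral_kernel_pow[OF local_function_cylinder[OF assms]] by simp

lemma cylinder_rate:
  assumes "finite K"
  shows "\<bar>(T ^^ t) (indicator (cylinder K u)) x - limit (indicator (cylinder K u))\<bar> \<le> card K * (1 / 2) ^ (t div N)"
proof -
  have "\<bar>indicator (cylinder K u) x - indicator (cylinder K u) y\<bar> \<le> (1 :: real)" for x y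
    by (auto simp: indicator_def)
  then show ?thesis
    using limit_rate[OF assms depends_on_indicator_cylinder, of 1 u t x] by simp
qed

lemma uniformly_ergodic: "uniformly_ergodic \<Phi>"
proof -
  obtain \<pi> where \<pi>: "invariant \<Phi> \<pi>" using exists_invariant by blast
  have "\<pi>' = \<pi>" if "invariant \<Phi> \<pi>'" for \<pi>'
    by (rule config_measure_eqI)
       (use that \<pi> measure_invariant in \<open>auto simp: invariant_def\<close>)
  moreover have "uniform_limit UNIV (\<lambda>t x. measure (kernel_pow \<Phi> t x) (cylinder K u))
      (\<lambda>_. measure \<pi> (cylinder K u)) sequentially" if K: "finite K" for K and u :: "('d, 's) config"
    unfolding uniform_limit_iff
  proof (intro allI impI)
    fix e :: real assume "0 < e"
    then have "\<forall>\<^sub>F t in sequentially. card K * (1 / 2) ^ (t div N) < e"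
      by (rule order_tendstoD(2)[OF rate_tendsto_0])
    then show "\<forall>\<^sub>F t in sequentially. \<forall>x\<in>UNIV.
        dist (measure (kernel_pow \<Phi> t x) (cylinder K u)) (measure \<pi> (cylinder K u)) < e"
    proof eventually_elim
      case (elim t)
      show ?case
        unfolding kernel_pow_cylinder[OF K] measure_invariant[OF \<pi> K] dist_real_def
        using cylinder_rate[OF K] elim by (auto intro: le_less_trans)
    qed
  qed
  ultimately show ?thesis
    unfolding uniformly_ergodic_def using \<pi> by blast
qed

section \<open>Translation invariance and spatial mixing\<close>

lemma shift_measurable [measurable]: "shift k \<in> (config_space :: ('d, 's) config measure) \<rightarrow>\<^sub>M config_space"
  unfolding config_space_def shift_def
  by (rule measurable_PiM_single') (auto intro: measurable_component_singleton)

lemma shift_vimage_cylinder: "shift k -` cylinder L v = cylinder ((+) k ` L) (\<lambda>i. v (i - k))"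
  by (auto simp: shift_def cylinder_def)

lemma shift_image_cylinder: "shift (- k) ` cylinder L v = shift k -` cylinder L v"
proof -
  have "shift k (shift (- k) x) = x" "shift (- k) (shift k x) = x" for x :: "('a::finite, 'b) config"
    by (simp_all add: shift_def)
  then show ?thesis
    by (auto simp: image_iff) metis
qed

text \<open>The same local rule acts at every site, so a translation only reindexes the product over
  the sites of a cylinder.\<close>

lemma kernel_shift: "\<Phi> (shift k x) = distr (\<Phi> x) config_space (shift k)"
proof (rule config_measure_eqI[OF kernel_in])
  interpret prob_space "\<Phi> x" by (rule prob_algebra_configD[OF kernel_in])
  have meas: "shift k \<in> \<Phi> x \<rightarrow>\<^sub>M config_space"
    using shift_measurable prob_algebra_configD(3)[OF kernel_in] by (simp cong: measurable_cong_sets)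
  show "distr (\<Phi> x) config_space (shift k) \<in> space (prob_algebra config_space)"
    by (simp add: space_prob_algebra prob_space_distr[OF meas])
  fix K :: "(int ^ 'd) set" and u :: "('d, 's) config" assume K: "finite K"
  have "measure (distr (\<Phi> x) config_space (shift k)) (cylinder K u) =
      measure (\<Phi> x) (cylinder ((+) k ` K) (\<lambda>i. u (i - k)))"
    using K prob_algebra_configD(4)[OF kernel_in] by (simp add: measure_distr[OF meas] shift_vimage_cylinder)
  also have "\<dots> = (\<Prod>i\<in>(+) k ` K. pmf (\<phi> (view x i)) (u (i - k)))"
    using K by (intro measure_kernel_cylinder) auto
  also have "\<dots> = (\<Prod>i\<in>K. pmf (\<phi> (view (shift k x) i)) (u i))"
    by (subst prod.reindex) (auto simp: shift_def add.assoc)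
  also have "\<dots> = measure (\<Phi> (shift k x)) (cylinder K u)"
    by (rule measure_kernel_cylinder[OF K, symmetric])
  finally show "measure (\<Phi> (shift k x)) (cylinder K u) = measure (distr (\<Phi> x) config_space (shift k)) (cylinder K u)" ..
qed

lemma local_function_shift:
  assumes "local_function h"
  shows "local_function (\<lambda>x. h (shift k x))"
proof -
  obtain K where K: "finite K" "depends_on K h" using assms by (auto simp: local_function_def)
  have "depends_on ((+) k ` K) (\<lambda>x. h (shift k x))"
    unfolding depends_on_def
  proof (intro allI impI)
    fix x y :: "('a, 'b) config" assume "\<forall>i\<in>(+) k ` K. x i = y i"
    then show "h (shift k x) = h (shift k y)"
      by (intro depends_onD[OF K(2)]) (auto simp: shift_def)
  qed
  then show ?thesis using K(1) by (auto simp: local_function_def)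
qed

lemma T_pow_shift:
  assumes "local_function h"
  shows "(T ^^ t) (\<lambda>x. h (shift k x)) = (\<lambda>x. (T ^^ t) h (shift k x))"
proof (induction t)
  case (Suc t)
  have "T (\<lambda>x. g (shift k x)) x = T g (shift k x)" if g: "local_function g" for g x
  proof -
    obtain K where K: "finite K" "depends_on K g"
      using g by (auto simp: local_function_def)
    have meas: "shift k \<in> \<Phi> x \<rightarrow>\<^sub>M config_space"
      using shift_measurable prob_algebra_configD(3)[OF kernel_in] by (simp cong: measurable_cong_sets)
    show ?thesis
      unfolding T_def kernel_shift
      by (rule integral_distr[OF meas measurable_local_function[OF K], symmetric])
  qed
  from this[OF local_function_T_pow[OF assms]] show ?case using Suc by auto
qed simp

lemma limit_shift:
  assumes "local_function h"
  shows "limit (\<lambda>x. h (shift k x)) = limit h"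
proof (rule limit_eqI[OF local_function_shift[OF assms]])
  show "(\<lambda>t. (T ^^ t) (\<lambda>x. h (shift k x)) x) \<longlonglongrightarrow> limit h" for x
    unfolding T_pow_shift[OF assms] by (rule T_pow_tendsto_limit[OF assms])
qed

lemma nbrs_pow_translate: "(nbrs ns ^^ s) ((+) k ` L) = (+) k ` (nbrs ns ^^ s) L"
proof (induction s)
  case (Suc s)
  have "nbrs ns ((+) k ` A) = (+) k ` nbrs ns A" for A
    by (auto simp: nbrs_def image_iff add.assoc)
  then show ?case using Suc by simp
qed simp

text \<open>At time \<open>t\<close> the expectation of the product factorises exactly. Passing to
  the limit costs at most \<open>(card K + card L) * (1 / 2) ^ (t div N)\<close> on either side,
  whence the factor 2.\<close>

lemma cylinder_pair_rate:
  assumes K: "finite K" and L: "finite L"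
    and disj: "\<And>s. s < t \<Longrightarrow> (nbrs ns ^^ s) K \<inter> (nbrs ns ^^ s) L = {}"
  shows "\<bar>limit (\<lambda>x. indicator (cylinder K u) x * indicator (cylinder L v) x) -
      limit (indicator (cylinder K u)) * limit (indicator (cylinder L v))\<bar>
      \<le> 2 * (card K + card L) * (1 / 2) ^ (t div N)"
proof -
  let ?h = "indicator (cylinder K u) :: ('d, 's) config \<Rightarrow> real"
    and ?g = "indicator (cylinder L v) :: ('d, 's) config \<Rightarrow> real"
    and ?r = "(1 / 2 :: real) ^ (t div N)"
  fix x :: "('d, 's) config"
  note h = depends_on_indicator_cylinder[of K u] and g = depends_on_indicator_cylinder[of L v]
  have hg: "depends_on (K \<union> L) (\<lambda>x. ?h x * ?g x)"
    by (auto simp: depends_on_def indicator_def cylinder_def)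
  have "\<bar>?h x * ?g x - ?h y * ?g y\<bar> \<le> 1" for x y
    by (auto simp: indicator_def)
  then have 1: "\<bar>(T ^^ t) (\<lambda>x. ?h x * ?g x) x - limit (\<lambda>x. ?h x * ?g x)\<bar> \<le> card (K \<union> L) * ?r"
    using limit_rate[where M = 1 and t = t and x = x, OF _ hg] K L by simp
  have "real (card (K \<union> L)) * ?r \<le> (card K + card L) * ?r"
    using card_Un_le[of K L] by (intro mult_right_mono) (simp_all only: of_nat_le_iff, simp)
  note 1 = order_trans[OF 1 this]
  have m: "(T ^^ t) (\<lambda>x. ?h x * ?g x) x = (T ^^ t) ?h x * (T ^^ t) ?g x"
    using T_pow_mult[OF K h L g disj] by meson
  let ?a = "(T ^^ t) ?h x" and ?b = "(T ^^ t) ?g x" and ?A = "limit ?h" and ?B = "limit ?g"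
  have a: "\<bar>?a - ?A\<bar> \<le> card K * ?r" and b: "\<bar>?b - ?B\<bar> \<le> card L * ?r"
    using cylinder_rate K L by auto
  have b1: "0 \<le> ?b \<and> ?b \<le> 1"
    by (rule T_pow_bounds[OF local_function_cylinder[OF L]]) (auto simp: indicator_def)
  have A1: "\<bar>?A\<bar> \<le> 1"
  proof -
    have "0 \<le> (T ^^ s) ?h x \<and> (T ^^ s) ?h x \<le> 1" for s
      by (rule T_pow_bounds[OF local_function_cylinder[OF K]]) (auto simp: indicator_def)
    moreover have lim: "(\<lambda>s. (T ^^ s) ?h x) \<longlonglongrightarrow> ?A"
      by (rule T_pow_tendsto_limit[OF local_function_cylinder[OF K]])
    ultimately have "0 \<le> ?A" "?A \<le> 1"
      using LIMSEQ_le_const[OF lim, of 0] LIMSEQ_le_const2[OF lim, of 1] by auto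
    then show ?thesis by simp
  qed
  have "\<bar>?a * ?b - ?A * ?B\<bar> = \<bar>(?a - ?A) * ?b + ?A * (?b - ?B)\<bar>"
    by (simp add: algebra_simps)
  also have "\<dots> \<le> \<bar>?a - ?A\<bar> * \<bar>?b\<bar> + \<bar>?A\<bar> * \<bar>?b - ?B\<bar>"
    by (rule order_trans[OF abs_triangle_ineq]) (simp add: abs_mult)
  also have "\<dots> \<le> \<bar>?a - ?A\<bar> * 1 + 1 * \<bar>?b - ?B\<bar>"
    using b1 A1 by (intro add_mono mult_mono) auto
  also have "\<dots> \<le> (card K + card L) * ?r"
    using a b by (simp add: distrib_right)
  finally have 2: "\<bar>?a * ?b - ?A * ?B\<bar> \<le> (card K + card L) * ?r" .
  have "\<bar>limit (\<lambda>x. ?h x * ?g x) - ?A * ?B\<bar> \<le> (card K + card L) * ?r + (card K + card L) * ?r"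
    using 1 2 unfolding m by linarith
  also have "\<dots> = 2 * (card K + card L) * ?r" by simp
  finally show ?thesis .
qed

lemma spatially_mixing:
  assumes "invariant \<Phi> \<pi>"
  shows "spatially_mixing \<pi>"
  unfolding spatially_mixing_def
proof (intro allI impI)
  fix K L :: "(int ^ 'd) set" and u v :: "('d, 's) config"
  assume K: "finite K" and L: "finite L"
  have \<pi>: "\<pi> \<in> space (prob_algebra config_space)" using assms by (simp add: invariant_def)
  let ?h = "indicator (cylinder K u) :: ('d, 's) config \<Rightarrow> real"
    and ?g = "\<lambda>k. indicator (cylinder ((+) k ` L) (\<lambda>i. v (i - k))) :: ('d, 's) config \<Rightarrow> real"
  have eq: "measure \<pi> (cylinder K u \<inter> shift (- k) ` cylinder L v) = limit (\<lambda>x. ?h x * ?g k x)" for k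
  proof -
    have cyl: "finite ((+) k ` L)" using L by simp
    have loc: "local_function (\<lambda>x. ?h x * ?g k x)"
      by (rule local_functionI[of "K \<union> (+) k ` L"]) (use K L in \<open>auto simp: depends_on_def indicator_def cylinder_def\<close>)
    have "measure \<pi> (cylinder K u \<inter> shift (- k) ` cylinder L v) =
        (\<integral>x. indicator (cylinder K u \<inter> cylinder ((+) k ` L) (\<lambda>i. v (i - k))) x \<partial>\<pi>)"
      using prob_algebra_configD[OF \<pi>] by (simp add: shift_image_cylinder shift_vimage_cylinder)
    also have "\<dots> = limit (\<lambda>x. ?h x * ?g k x)"
      unfolding indicator_inter_arith by (rule invariant_integral[OF assms loc])
    finally show ?thesis .
  qed
  have g: "limit (?g k) = measure \<pi> (cylinder L v)" for k
  proof -
    have "?g k = (\<lambda>x. indicator (cylinder L v) (shift k x))"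
      by (auto simp: indicator_def shift_vimage_cylinder[symmetric])
    then show ?thesis
      using limit_shift[OF local_function_cylinder[OF L, of v]] measure_invariant[OF assms L] by simp
  qed
  show "((\<lambda>k. measure \<pi> (cylinder K u \<inter> shift (- k) ` cylinder L v))
      \<longlongrightarrow> measure \<pi> (cylinder K u) * measure \<pi> (cylinder L v)) cofinite"
  proof (rule tendstoI)
    fix e :: real assume "0 < e"
    then have "\<forall>\<^sub>F t in sequentially. 2 * (card K + card L) * (1 / 2) ^ (t div N) < e"
      by (rule order_tendstoD(2)[OF rate_tendsto_0])
    then obtain t where t: "2 * (card K + card L) * (1 / 2) ^ (t div N) < e"
      by (auto simp: eventually_sequentially)
    \<comment> \<open>Level \<open>s\<close> of the cone of the translate \<open>k + L\<close> meets
      that of the cone of \<open>K\<close> exactly if \<open>k\<close> is a difference of their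
      points. The time \<open>t\<close> was chosen before \<open>k\<close>, so finitely many
      \<open>k\<close> are excluded.\<close>
    let ?bad = "\<Union>s<t. (\<lambda>(a, b). a - b) ` ((nbrs ns ^^ s) K \<times> (nbrs ns ^^ s) L)"
    have fin: "finite ?bad" using K L by auto
    have near: "dist (measure \<pi> (cylinder K u \<inter> shift (- k) ` cylinder L v))
        (measure \<pi> (cylinder K u) * measure \<pi> (cylinder L v)) < e" if k: "k \<notin> ?bad" for k
    proof -
      have "(nbrs ns ^^ s) K \<inter> (nbrs ns ^^ s) ((+) k ` L) = {}" if "s < t" for s
      proof (rule ccontr)
        assume "\<not> ?thesis"
        then obtain b where "b \<in> (nbrs ns ^^ s) L" "k + b \<in> (nbrs ns ^^ s) K"
          unfolding nbrs_pow_translate by auto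
        then have "k \<in> (\<lambda>(a, b). a - b) ` ((nbrs ns ^^ s) K \<times> (nbrs ns ^^ s) L)"
          by (intro image_eqI[of _ _ "(k + b, b)"]) auto
        then show False using k that by blast
      qed
      then have "\<bar>limit (\<lambda>x. ?h x * ?g k x) - limit ?h * limit (?g k)\<bar>
          \<le> 2 * (card K + card ((+) k ` L)) * (1 / 2) ^ (t div N)"
        by (intro cylinder_pair_rate K) (use L in auto)
      also have "card ((+) k ` L) = card L" by (simp add: card_image)
      finally show ?thesis
        using t by (simp add: dist_real_def eq g measure_invariant[OF assms K])
    qed
    have "{k. \<not> dist (measure \<pi> (cylinder K u \<inter> shift (- k) ` cylinder L v))
        (measure \<pi> (cylinder K u) * measure \<pi> (cylinder L v)) < e} \<subseteq> ?bad"
      using near by blast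
    then show "\<forall>\<^sub>F k in cofinite. dist (measure \<pi> (cylinder K u \<inter> shift (- k) ` cylinder L v))
        (measure \<pi> (cylinder K u) * measure \<pi> (cylinder L v)) < e"
      unfolding eventually_cofinite using fin by (rule finite_subset)
  qed
qed

end

section \<open>Relatively computable functions\<close>

text \<open>Arguments are addressed by \<open>hd\<close> and \<open>tl\<close>: a binder pushes the bound variable to the front of
  the argument list.\<close>

type_synonym query = "nat list \<Rightarrow> nat"

text \<open>One program serves all oracles, since the sampler must not depend on the presentation or
  on the sample.\<close>

definition computable :: "nat \<Rightarrow> (query \<Rightarrow> query \<Rightarrow> nat list \<Rightarrow> nat) \<Rightarrow> bool" where
  "computable n G \<longleftrightarrow> (\<exists>P. \<forall>q r xs. length xs = n \<longrightarrow> run q r P xs = Some (G q r xs))"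

lemma computableI:
  "(\<And>q r xs. length xs = n \<Longrightarrow> run q r P xs = Some (G q r xs)) \<Longrightarrow> computable n G"
  unfolding computable_def by blast

lemma computable_cong:
  assumes "computable n G" "\<And>q r xs. length xs = n \<Longrightarrow> G q r xs = H q r xs"
  shows "computable n H"
  using assms unfolding computable_def by metis

lemma computable_const: "computable n (\<lambda>q r xs. c)"
proof (rule computableI)
  show "run q r (((\<lambda>P. Comp Succ [P]) ^^ c) Zero) xs = Some c" for q r xs
    by (induction c) auto
qed

lemma computable_hd: "computable (Suc n) (\<lambda>q r xs. hd xs)"
proof (rule computableI)
  show "run q r (Proj 0) xs = Some (hd xs)" if "length xs = Suc n" for q r xs
    using that by (cases xs) auto
qed

lemma run_Comp:
  assumes "map (\<lambda>g. run q r g xs) gs = map Some ys"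
  shows "run q r (Comp P gs) xs = run q r P ys"
proof -
  have "None \<notin> set (map (\<lambda>g. run q r g xs) gs)" unfolding assms by auto
  moreover have "map the (map (\<lambda>g. run q r g xs) gs) = ys" unfolding assms by (simp add: comp_def)
  ultimately show ?thesis by (simp add: Let_def)
qed

lemma computable_comp:
  assumes "computable (length As) G" "\<And>A. A \<in> set As \<Longrightarrow> computable n A"
  shows "computable n (\<lambda>q r xs. G q r (map (\<lambda>A. A q r xs) As))"
proof -
  obtain P where P: "\<And>q r xs. length xs = length As \<Longrightarrow> run q r P xs = Some (G q r xs)"
    using assms(1) unfolding computable_def by blast
  define Q where "Q A = (SOME P. \<forall>q r xs. length xs = n \<longrightarrow> run q r P xs = Some (A q r xs))" for A
  have Q: "run q r (Q A) xs = Some (A q r xs)" if "A \<in> set As" "length xs = n" for A q r xs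
    using someI_ex[OF assms(2)[OF that(1), unfolded computable_def]] that(2) unfolding Q_def by blast
  show ?thesis
  proof (rule computableI)
    fix q r and xs :: "nat list" assume len: "length xs = n"
    have "map (\<lambda>g. run q r g xs) (map Q As) = map Some (map (\<lambda>A. A q r xs) As)"
      using Q len by simp
    then show "run q r (Comp P (map Q As)) xs = Some (G q r (map (\<lambda>A. A q r xs) As))"
      by (subst run_Comp) (auto intro: P)
  qed
qed

lemma computable_nth: "i < n \<Longrightarrow> computable n (\<lambda>q r xs. xs ! i)"
  by (rule computableI[where P = "Proj i"]) simp

text \<open>Weakening: under a binder, a function of the outer variables ignores the new front
  argument.\<close>

lemma computable_tl:
  assumes "computable n (\<lambda>q r xs. G q r xs)"
  shows "computable (Suc n) (\<lambda>q r xs. G q r (tl xs))"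
proof -
  have "computable (Suc n) (\<lambda>q r xs. G q r (map (\<lambda>A. A q r xs) (map (\<lambda>i q r xs. xs ! Suc i) [0..<n])))"
    using assms by (intro computable_comp) (auto intro: computable_nth)
  then show ?thesis
    by (rule computable_cong) (auto simp: comp_def intro!: arg_cong[where f = "G _ _"] nth_equalityI simp: nth_tl)
qed

text \<open>Substitution of a computed value for the front variable.\<close>

lemma computable_let:
  assumes "computable n E" "computable (Suc n) (\<lambda>q r xs. G q r (tl xs) (hd xs))"
  shows "computable n (\<lambda>q r xs. G q r xs (E q r xs))"
proof -
  define As where "As = E # map (\<lambda>i q r xs. xs ! i) [0..<n]"
  have "computable n (\<lambda>q r xs. (\<lambda>xs. G q r (tl xs) (hd xs)) (map (\<lambda>A. A q r xs) As))"
    using assms by (intro computable_comp) (auto simp: As_def intro: computable_nth)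
  then show ?thesis
    by (rule computable_cong) (auto simp: As_def comp_def map_nth)
qed

lemma computable_app1:
  assumes "computable 1 (\<lambda>q r xs. g (hd xs))" "computable n A"
  shows "computable n (\<lambda>q r xs. g (A q r xs))"
  using computable_comp[of "[A]" "\<lambda>q r xs. g (hd xs)" n] assms by auto

text \<open>\<open>PrimRec\<close> recurses on its first argument; \<open>computable_let\<close>
  then puts an arbitrary computable bound in that place. In the body the counter is the front
  argument and the accumulator the next one.\<close>

lemma computable_rec_nat:
  assumes "computable n A" "computable (Suc (Suc n)) (\<lambda>q r xs. B q r (tl (tl xs)) (hd xs) (hd (tl xs)))"
    "computable n K"
  shows "computable n (\<lambda>q r xs. rec_nat (A q r xs) (\<lambda>k y. B q r xs k y) (K q r xs))"
proof -
  obtain P where P: "\<And>q r xs. length xs = n \<Longrightarrow> run q r P xs = Some (A q r xs)"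
    using assms(1) unfolding computable_def by blast
  obtain Q where Q: "\<And>q r xs. length xs = Suc (Suc n) \<Longrightarrow> run q r Q xs = Some (B q r (tl (tl xs)) (hd xs) (hd (tl xs)))"
    using assms(2) unfolding computable_def by blast
  have "computable (Suc n) (\<lambda>q r xs. rec_nat (A q r (tl xs)) (\<lambda>k y. B q r (tl xs) k y) (hd xs))"
  proof (rule computableI)
    fix q r and xs :: "nat list" assume "length xs = Suc n"
    then obtain k ys where xs: "xs = k # ys" "length ys = n" by (cases xs) auto
    have "rec_nat (run q r P ys) (\<lambda>k v. Option.bind v (\<lambda>y. run q r Q (k # y # ys))) k =
        Some (rec_nat (A q r ys) (\<lambda>k y. B q r ys k y) k)"
      by (induction k) (use P Q xs in auto)
    then show "run q r (PrimRec P Q) xs = Some (rec_nat (A q r (tl xs)) (\<lambda>k y. B q r (tl xs) k y) (hd xs))"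
      by (simp add: xs)
  qed
  then show ?thesis
    by (rule computable_let[OF assms(3), where G = "\<lambda>q r xs k. rec_nat (A q r xs) (\<lambda>k y. B q r xs k y) k"])
qed

lemma computable_ask_rule:
  assumes "computable n A" "computable n B" "computable n C"
  shows "computable n (\<lambda>q r xs. q [A q r xs, B q r xs, C q r xs])"
  using computable_comp[of "[A, B, C]" "\<lambda>q r xs. q xs" n] assms computableI[where P = Ask_Rule] by auto

lemma computable_ask_random:
  assumes "computable n A" "computable n B"
  shows "computable n (\<lambda>q r xs. r [A q r xs, B q r xs])"
  using computable_comp[of "[A, B]" "\<lambda>q r xs. r xs" n] assms computableI[where P = Ask_Random] by auto

named_theorems computable

text \<open>The variables with de Bruijn indices 0 to 6.\<close>

lemmas [computable] = computable_const computable_hd computable_tl[OF computable_hd]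
  computable_tl[OF computable_tl[OF computable_hd]]
  computable_tl[OF computable_tl[OF computable_tl[OF computable_hd]]]
  computable_tl[OF computable_tl[OF computable_tl[OF computable_tl[OF computable_hd]]]]
  computable_tl[OF computable_tl[OF computable_tl[OF computable_tl[OF computable_tl[OF computable_hd]]]]]
  computable_tl[OF computable_tl[OF computable_tl[OF computable_tl[OF computable_tl[OF computable_tl[OF computable_hd]]]]]]

section \<open>Arithmetic, bounded sums and bounded products\<close>

lemma computable_Suc [computable]:
  "computable n A \<Longrightarrow> computable n (\<lambda>q r xs. Suc (A q r xs))"
proof (rule computable_app1[of Suc])
  show "computable 1 (\<lambda>q r xs. Suc (hd xs))"
  proof (rule computableI)
    show "run q r Succ xs = Some (Suc (hd xs))" if "length xs = 1" for q r xs
      using that by (cases xs) auto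
  qed
qed

lemma rec_nat_add: "rec_nat a (\<lambda>k y. Suc y) b = a + b"
  by (induction b) auto

lemma computable_add [computable]:
  assumes "computable n A" "computable n B"
  shows "computable n (\<lambda>q r xs. A q r xs + B q r xs)"
proof -
  have "computable n (\<lambda>q r xs. rec_nat (A q r xs) (\<lambda>k y. Suc y) (B q r xs))"
    by (intro computable_rec_nat computable assms)
  then show ?thesis by (simp add: rec_nat_add)
qed

lemma computable_sum [computable]:
  assumes "computable n K" "computable (Suc n) (\<lambda>q r xs. B q r (tl xs) (hd xs))"
  shows "computable n (\<lambda>q r xs. \<Sum>i<K q r xs. B q r xs i)"
proof -
  \<comment> \<open>Inside the recursion the second argument is the accumulator, of which the
    summand knows nothing; the projections skip it.\<close>
  have "computable (Suc (Suc n)) (\<lambda>q r xs. (\<lambda>xs. B q r (tl xs) (hd xs)) (map (\<lambda>A. A q r xs)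
      ((\<lambda>q r xs. hd xs) # map (\<lambda>i q r xs. xs ! Suc (Suc i)) [0..<n])))"
    using assms(2) by (intro computable_comp) (auto intro: computable_nth computable)
  then have B: "computable (Suc (Suc n)) (\<lambda>q r xs. B q r (tl (tl xs)) (hd xs))"
    by (rule computable_cong) (auto simp: comp_def nth_tl intro!: arg_cong[where f = "\<lambda>xs. B _ _ xs _"] nth_equalityI)
  have "computable n (\<lambda>q r xs. rec_nat 0 (\<lambda>k y. y + B q r xs k) (K q r xs))"
    by (intro computable_rec_nat computable B assms)
  moreover have "rec_nat 0 (\<lambda>k y. y + g k) m = (\<Sum>i<m. g i)" for g :: "nat \<Rightarrow> nat" and m
    by (induction m) auto
  ultimately show ?thesis by simp
qed

lemma computable_mult [computable]:
  assumes "computable n A" "computable n B"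
  shows "computable n (\<lambda>q r xs. A q r xs * B q r xs)"
proof -
  have "computable n (\<lambda>q r xs. \<Sum>i<B q r xs. A q r xs)"
    by (intro computable_sum assms computable_tl)
  then show ?thesis by (simp add: mult.commute)
qed

lemma computable_prod [computable]:
  assumes "computable n K" "computable (Suc n) (\<lambda>q r xs. B q r (tl xs) (hd xs))"
  shows "computable n (\<lambda>q r xs. \<Prod>i<K q r xs. B q r xs i)"
proof -
  have "computable (Suc (Suc n)) (\<lambda>q r xs. (\<lambda>xs. B q r (tl xs) (hd xs)) (map (\<lambda>A. A q r xs)
      ((\<lambda>q r xs. hd xs) # map (\<lambda>i q r xs. xs ! Suc (Suc i)) [0..<n])))"
    using assms(2) by (intro computable_comp) (auto intro: computable_nth computable)
  then have B: "computable (Suc (Suc n)) (\<lambda>q r xs. B q r (tl (tl xs)) (hd xs))"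
    by (rule computable_cong) (auto simp: comp_def nth_tl intro!: arg_cong[where f = "\<lambda>xs. B _ _ xs _"] nth_equalityI)
  have "computable n (\<lambda>q r xs. rec_nat 1 (\<lambda>k y. y * B q r xs k) (K q r xs))"
    by (intro computable_rec_nat computable B assms)
  moreover have "rec_nat 1 (\<lambda>k y. y * g k) m = (\<Prod>i<m. g i)" for g :: "nat \<Rightarrow> nat" and m
    by (induction m) auto
  ultimately show ?thesis by simp
qed

lemma computable_power [computable]:
  assumes "computable n A" "computable n B"
  shows "computable n (\<lambda>q r xs. A q r xs ^ B q r xs)"
proof -
  have "computable n (\<lambda>q r xs. \<Prod>i<B q r xs. A q r xs)"
    by (intro computable_prod assms computable_tl)
  then show ?thesis by simp
qed

lemma computable_diff [computable]:
  assumes "computable n A" "computable n B"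
  shows "computable n (\<lambda>q r xs. A q r xs - B q r xs)"
proof -
  have "rec_nat 0 (\<lambda>k y. k) a = a - 1" for a :: nat by (cases a) auto
  moreover have "computable 1 (\<lambda>q r xs. rec_nat 0 (\<lambda>k y. k) (hd xs))"
    using computable_rec_nat[of 1 "\<lambda>q r xs. 0" "\<lambda>q r xs k y. k" "\<lambda>q r xs. hd xs"]
    by (simp add: computable computable_hd[of 0, simplified])
  ultimately have pred: "computable m (\<lambda>q r xs. C q r xs - 1)" if "computable m C" for m C
    using computable_app1[of "\<lambda>a. a - 1", OF _ that] by simp
  have "computable n (\<lambda>q r xs. rec_nat (A q r xs) (\<lambda>k y. y - 1) (B q r xs))"
    by (intro computable_rec_nat pred computable assms)
  moreover have "rec_nat a (\<lambda>k y. y - 1) b = a - b" for a b :: nat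
    by (induction b) auto
  ultimately show ?thesis by simp
qed

subsection \<open>Decidable predicates\<close>

abbreviation decidable :: "nat \<Rightarrow> (query \<Rightarrow> query \<Rightarrow> nat list \<Rightarrow> bool) \<Rightarrow> bool" where
  "decidable n P \<equiv> computable n (\<lambda>q r xs. of_bool (P q r xs))"

lemma decidable_le [computable]:
  assumes "computable n A" "computable n B"
  shows "decidable n (\<lambda>q r xs. A q r xs \<le> B q r xs)"
proof -
  have "computable n (\<lambda>q r xs. 1 - (A q r xs - B q r xs))"
    by (intro computable assms)
  then show ?thesis by (rule computable_cong) auto
qed

lemma decidable_not [computable]:
  assumes "decidable n P"
  shows "decidable n (\<lambda>q r xs. \<not> P q r xs)"
proof -
  have "computable n (\<lambda>q r xs. 1 - of_bool (P q r xs))"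
    by (intro computable assms)
  then show ?thesis by (rule computable_cong) auto
qed

lemma decidable_conj [computable]:
  assumes "decidable n P" "decidable n Q"
  shows "decidable n (\<lambda>q r xs. P q r xs \<and> Q q r xs)"
proof -
  have "computable n (\<lambda>q r xs. of_bool (P q r xs) * of_bool (Q q r xs))"
    by (intro computable assms)
  then show ?thesis by (rule computable_cong) auto
qed

lemma decidable_imp [computable]:
  assumes "decidable n P" "decidable n Q"
  shows "decidable n (\<lambda>q r xs. P q r xs \<longrightarrow> Q q r xs)"
proof -
  have "decidable n (\<lambda>q r xs. \<not> (P q r xs \<and> \<not> Q q r xs))"
    by (intro computable assms)
  then show ?thesis by (rule computable_cong) auto
qed

lemma decidable_eq [computable]:
  assumes "computable n A" "computable n B"
  shows "decidable n (\<lambda>q r xs. A q r xs = B q r xs)"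
proof -
  have "decidable n (\<lambda>q r xs. A q r xs \<le> B q r xs \<and> B q r xs \<le> A q r xs)"
    by (intro computable assms)
  then show ?thesis by (rule computable_cong) auto
qed

lemma decidable_less [computable]:
  assumes "computable n A" "computable n B"
  shows "decidable n (\<lambda>q r xs. A q r xs < B q r xs)"
proof -
  have "decidable n (\<lambda>q r xs. \<not> B q r xs \<le> A q r xs)"
    by (intro computable assms)
  then show ?thesis by (rule computable_cong) auto
qed

lemma decidable_all [computable]:
  assumes "computable n K" "decidable (Suc n) (\<lambda>q r xs. P q r (tl xs) (hd xs))"
  shows "decidable n (\<lambda>q r xs. \<forall>i<K q r xs. P q r xs i)"
proof -
  have "computable n (\<lambda>q r xs. \<Prod>i<K q r xs. of_bool (P q r xs i))"
    by (intro computable assms)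
  moreover have "(\<Prod>i<m. of_bool (p i) :: nat) = of_bool (\<forall>i<m. p i)" for p and m :: nat
    by (induction m) (auto simp: less_Suc_eq)
  ultimately show ?thesis by simp
qed

lemma decidable_ex [computable]:
  assumes "computable n K" "decidable (Suc n) (\<lambda>q r xs. P q r (tl xs) (hd xs))"
  shows "decidable n (\<lambda>q r xs. \<exists>i<K q r xs. P q r xs i)"
proof -
  have "decidable n (\<lambda>q r xs. \<not> (\<forall>i<K q r xs. \<not> P q r xs i))"
    by (intro computable assms)
  then show ?thesis by (rule computable_cong) auto
qed

lemma computable_if [computable]:
  assumes "decidable n P" "computable n A" "computable n B"
  shows "computable n (\<lambda>q r xs. if P q r xs then A q r xs else B q r xs)"
proof -
  have "computable n (\<lambda>q r xs. of_bool (P q r xs) * A q r xs + of_bool (\<not> P q r xs) * B q r xs)"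
    by (intro computable assms)
  then show ?thesis by (rule computable_cong) auto
qed

text \<open>The quotient counts the positive multiples of the divisor up to the dividend. Division
  by 0 yields 0 and is a separate case, since then the count would be wrong.\<close>

lemma computable_div [computable]:
  assumes "computable n A" "computable n B"
  shows "computable n (\<lambda>q r xs. A q r xs div B q r xs)"
proof -
  have "computable n (\<lambda>q r xs. if B q r xs = 0 then 0
      else \<Sum>i<A q r xs. of_bool (Suc i * B q r xs \<le> A q r xs))"
    by (intro computable assms computable_tl)
  moreover have "(if b = 0 then 0 else \<Sum>i<a. of_bool (Suc i * b \<le> a)) = a div b" for a b :: nat
  proof (cases "b = 0")
    case False
    then have "(\<Sum>i<a. of_bool (Suc i * b \<le> a)) = (\<Sum>i<a. of_bool (i < a div b) :: nat)"
      by (intro sum.cong refl) (simp add: less_eq_div_iff_mult_less_eq[symmetric] Suc_le_eq del: mult_Suc)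
    also have "\<dots> = card ({..<a} \<inter> {i. i < a div b})"
      by simp
    also have "{..<a} \<inter> {i. i < a div b} = {..<a div b}"
      by (auto intro: less_le_trans[OF _ div_le_dividend])
    finally show ?thesis using False by simp
  qed simp
  ultimately show ?thesis by simp
qed

lemma computable_mod [computable]:
  assumes "computable n A" "computable n B"
  shows "computable n (\<lambda>q r xs. A q r xs mod B q r xs)"
proof -
  have "computable n (\<lambda>q r xs. A q r xs - A q r xs div B q r xs * B q r xs)"
    by (intro computable assms)
  then show ?thesis by (simp add: minus_div_mult_eq_mod)
qed

lemma computable_min [computable]:
  assumes "computable n A" "computable n B"
  shows "computable n (\<lambda>q r xs. min (A q r xs) (B q r xs))"
  unfolding min_def by (intro computable assms)

text \<open>\<open>g\<close> may be arbitrary, because its values below \<open>m\<close> can be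
  written into the program. In this way the coordinates of the neighbourhood and the codes of the
  symbols become part of it.\<close>

lemma computable_table:
  assumes "computable n A"
  shows "computable n (\<lambda>q r xs. if A q r xs < m then g (A q r xs) else 0)"
proof (induction m)
  case 0
  show ?case by (simp add: computable_const)
next
  case (Suc m)
  have "computable n (\<lambda>q r xs. if A q r xs = m then g m else if A q r xs < m then g (A q r xs) else 0)"
    by (intro computable_if computable_const decidable_eq assms Suc)
  then show ?case by (rule computable_cong) (auto simp: less_Suc_eq)
qed

subsection \<open>Codes of lists\<close>

text \<open>A nonempty list is coded by the successor of the code of the pair of its head and the
  code of its tail; hence the predecessor.\<close>

definition code_hd :: "nat \<Rightarrow> nat" where "code_hd X = fst (prod_decode (X - 1))"
definition code_tl :: "nat \<Rightarrow> nat" where "code_tl X = snd (prod_decode (X - 1))"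
definition code_drop :: "nat \<Rightarrow> nat \<Rightarrow> nat" where "code_drop X i = rec_nat X (\<lambda>k y. code_tl y) i"
definition code_nth :: "nat \<Rightarrow> nat \<Rightarrow> nat" where "code_nth X i = code_hd (code_drop X i)"
text \<open>The length is the number of nonempty suffixes, and a search below \<open>X\<close> finds
  them all because a list is never longer than its code.\<close>

definition code_length :: "nat \<Rightarrow> nat" where "code_length X = (\<Sum>i<X. of_bool (0 < code_drop X i))"

lemma code_hd_Cons [simp]: "code_hd (list_encode (x # xs)) = x"
  by (simp add: code_hd_def)

lemma code_tl_list_encode [simp]: "code_tl (list_encode xs) = list_encode (tl xs)"
proof (cases xs)
  case Nil
  \<comment> \<open>Truncated subtraction sends the code 0 of the empty list to 0, so the empty list
    is its own tail.\<close>
  have "prod_encode (0, 0) = 0" by (simp add: prod_encode_def)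
  then have "prod_decode 0 = (0, 0)" by (metis prod_encode_inverse)
  then show ?thesis using Nil by (simp add: code_tl_def)
qed (simp add: code_tl_def)

lemma code_drop_list_encode [simp]: "code_drop (list_encode xs) i = list_encode (drop i xs)"
  unfolding code_drop_def by (induction i) (simp_all add: drop_Suc tl_drop)

lemma code_nth_list_encode [simp]: "i < length xs \<Longrightarrow> code_nth (list_encode xs) i = xs ! i"
  by (simp add: code_nth_def Cons_nth_drop_Suc[symmetric] del: list_encode.simps)

lemma length_le_list_encode: "length xs \<le> list_encode xs"
proof (induction xs)
  case (Cons x xs)
  then show ?case using le_prod_encode_2[of "list_encode xs" x] by simp
qed simp

lemma code_length_list_encode [simp]: "code_length (list_encode xs) = length xs"
proof -
  have "0 < list_encode ys \<longleftrightarrow> ys \<noteq> []" for ys by (cases ys) auto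
  then have "code_length (list_encode xs) = card ({..<list_encode xs} \<inter> {i. i < length xs})"
    unfolding code_length_def code_drop_list_encode by (simp del: list_encode.simps add: not_le)
  also have "{..<list_encode xs} \<inter> {i. i < length xs} = {..<length xs}"
    using length_le_list_encode[of xs] by auto
  finally show ?thesis by simp
qed

lemma computable_prod_encode [computable]:
  assumes "computable n A" "computable n B"
  shows "computable n (\<lambda>q r xs. prod_encode (A q r xs, B q r xs))"
  unfolding prod_encode_def triangle_def prod.case by (intro computable assms)

text \<open>Neither component exceeds the code, so decoding is a bounded search: exactly one pair of
  indices contributes to the double sum.\<close>

lemma prod_decode_eq_sum:
  "fst (prod_decode z) = (\<Sum>a<Suc z. \<Sum>b<Suc z. of_bool (prod_encode (a, b) = z) * a)"
  "snd (prod_decode z) = (\<Sum>a<Suc z. \<Sum>b<Suc z. of_bool (prod_encode (a, b) = z) * b)"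
proof -
  obtain a b where z: "z = prod_encode (a, b)" by (metis prod_decode_inverse surj_pair)
  have ab: "a < Suc z" "b < Suc z"
    using le_prod_encode_1[of a b] le_prod_encode_2[of b a] by (simp_all add: z)
  have eq: "of_bool (prod_encode (a', b') = z) = (of_bool (a' = a) * of_bool (b' = b) :: nat)" for a' b'
    unfolding z by (simp only: prod_encode_eq) auto
  have "(\<Sum>a'<Suc z. \<Sum>b'<Suc z. of_bool (prod_encode (a', b') = z) * g a' b') = g a b" for g :: "nat \<Rightarrow> nat \<Rightarrow> nat"
  proof -
    have "(\<Sum>a'<Suc z. \<Sum>b'<Suc z. of_bool (prod_encode (a', b') = z) * g a' b') =
        (\<Sum>a'<Suc z. if a' = a then (\<Sum>b'<Suc z. if b' = b then g a' b' else 0) else 0)"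
      unfolding eq by (intro sum.cong refl) (auto intro!: sum.cong sum.neutral)
    also have "\<dots> = g a b" using ab by (simp only: sum.delta finite_lessThan lessThan_iff if_True)
    finally show ?thesis .
  qed
  from this[of "\<lambda>a b. a"] this[of "\<lambda>a b. b"] show
    "fst (prod_decode z) = (\<Sum>a<Suc z. \<Sum>b<Suc z. of_bool (prod_encode (a, b) = z) * a)"
    "snd (prod_decode z) = (\<Sum>a<Suc z. \<Sum>b<Suc z. of_bool (prod_encode (a, b) = z) * b)"
    by (simp_all only: z prod_encode_inverse fst_conv snd_conv)
qed

lemma computable_code_hd [computable]:
  assumes "computable n A"
  shows "computable n (\<lambda>q r xs. code_hd (A q r xs))"
  unfolding code_hd_def prod_decode_eq_sum by (intro computable computable_tl assms)

lemma computable_code_tl [computable]: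
  assumes "computable n A"
  shows "computable n (\<lambda>q r xs. code_tl (A q r xs))"
  unfolding code_tl_def prod_decode_eq_sum by (intro computable computable_tl assms)

lemma computable_code_drop [computable]:
  assumes "computable n A" "computable n B"
  shows "computable n (\<lambda>q r xs. code_drop (A q r xs) (B q r xs))"
  unfolding code_drop_def by (intro computable_rec_nat computable computable_tl assms)

lemma computable_code_nth [computable]:
  assumes "computable n A" "computable n B"
  shows "computable n (\<lambda>q r xs. code_nth (A q r xs) (B q r xs))"
  unfolding code_nth_def by (intro computable assms)

lemma computable_code_length [computable]:
  assumes "computable n A"
  shows "computable n (\<lambda>q r xs. code_length (A q r xs))"
  unfolding code_length_def by (intro computable computable_tl assms)

text \<open>Codes of lists grow at the front, so the recursion lists the entries from the last to
  the first: round \<open>k\<close> prepends entry \<open>m - Suc k\<close>.\<close>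

lemma list_encode_map_upt:
  "list_encode (map g [0..<m]) = rec_nat 0 (\<lambda>k y. Suc (prod_encode (g (m - Suc k), y))) m"
proof -
  have "k \<le> m \<Longrightarrow> rec_nat 0 (\<lambda>k y. Suc (prod_encode (g (m - Suc k), y))) k = list_encode (map g [m - k..<m])" for k
  proof (induction k)
    case (Suc k)
    then have "[m - Suc k..<m] = (m - Suc k) # [m - k..<m]"
      by (simp add: upt_conv_Cons Suc_diff_Suc)
    then show ?case using Suc by simp
  qed simp
  from this[of m] show ?thesis by simp
qed

lemma computable_list_encode [computable]:
  assumes "computable n K" "computable (Suc n) (\<lambda>q r xs. B q r (tl xs) (hd xs))"
  shows "computable n (\<lambda>q r xs. list_encode (map (\<lambda>i. B q r xs i) [0..<K q r xs]))"
proof -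
  define E where "E = (\<lambda>(q :: query) (r :: query) (xs :: nat list). K q r (tl (tl xs)) - Suc (hd xs))"
  have E: "computable (Suc (Suc n)) E"
    unfolding E_def by (intro computable computable_tl assms)
  have "computable (Suc (Suc n)) (\<lambda>q r xs. (\<lambda>xs. B q r (tl xs) (hd xs)) (map (\<lambda>A. A q r xs)
      (E # map (\<lambda>i q r xs. xs ! Suc (Suc i)) [0..<n])))"
    using assms(2) E by (intro computable_comp) (auto intro: computable_nth)
  then have B: "computable (Suc (Suc n)) (\<lambda>q r xs. B q r (tl (tl xs)) (K q r (tl (tl xs)) - Suc (hd xs)))"
    by (rule computable_cong) (auto simp: E_def comp_def nth_tl intro!: arg_cong[where f = "\<lambda>xs. B _ _ xs _"] nth_equalityI)
  show ?thesis
    unfolding list_encode_map_upt by (intro computable_rec_nat computable B assms)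
qed

section \<open>The sampling program\<close>

text \<open>Words of length \<open>l\<close> over \<open>c\<close> letters are represented by the
  numbers below \<open>c ^ l\<close>, so sums over words become bounded sums.\<close>

definition digit :: "nat \<Rightarrow> nat \<Rightarrow> nat \<Rightarrow> nat" where
  "digit c V i = V div c ^ i mod c"

lemma digit_0: "digit c V 0 = V mod c"
  by (simp add: digit_def)

lemma digit_Suc: "digit c V (Suc i) = digit c (V div c) i"
  by (simp add: digit_def div_mult2_eq)

lemma digit_less: "0 < c \<Longrightarrow> digit c V i < c"
  by (simp add: digit_def)

lemma exists_digits:
  assumes "0 < c" "\<And>i. i < l \<Longrightarrow> v i < c"
  shows "\<exists>V<c ^ l. \<forall>i<l. digit c V i = v i"
  using assms(2)
proof (induction l arbitrary: v)
  case 0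
  show ?case by simp
next
  case (Suc l)
  obtain V where V: "V < c ^ l" "\<And>i. i < l \<Longrightarrow> digit c V i = v (Suc i)"
    using Suc.IH[of "\<lambda>i. v (Suc i)"] Suc.prems by auto
  let ?V = "v 0 + c * V"
  have v0: "v 0 < c" using Suc.prems by simp
  have "?V < c * (V + 1)" using v0 by simp
  also have "\<dots> \<le> c * c ^ l" using V(1) by (intro mult_left_mono) auto
  finally have "?V < c ^ Suc l" by simp
  moreover have "digit c ?V i = v i" if "i < Suc l" for i
    using that v0 V(2) assms(1) by (cases i) (auto simp: digit_0 digit_Suc)
  ultimately show ?case by blast
qed

lemma digits_inject:
  assumes "V < c ^ l" "W < c ^ l" "\<And>i. i < l \<Longrightarrow> digit c V i = digit c W i"
  shows "V = W"
  using assms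
proof (induction l arbitrary: V W)
  case (Suc l)
  have "V div c = W div c"
  proof (rule Suc.IH)
    show "V div c < c ^ l" "W div c < c ^ l"
      using Suc.prems(1,2) by (auto intro: less_mult_imp_div_less simp: mult.commute)
    show "digit c (V div c) i = digit c (W div c) i" if "i < l" for i
      using Suc.prems(3)[of "Suc i"] that by (simp add: digit_Suc)
  qed
  moreover have "V mod c = W mod c"
    using Suc.prems(3)[of 0] by (simp add: digit_0)
  ultimately show ?case by (metis div_mult_mod_eq)
qed simp

definition table :: "nat \<Rightarrow> (nat \<Rightarrow> nat) \<Rightarrow> nat \<Rightarrow> nat" where
  "table m g x = (if x < m then g x else 0)"

text \<open>\<open>int_encode\<close> sends \<open>z\<close> to \<open>2 * z\<close> if
  \<open>z\<close> is non-negative and to \<open>- 2 * z - 1\<close> otherwise. The two parts are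
  natural numbers whose difference is \<open>z\<close>.\<close>

definition pos_part :: "nat \<Rightarrow> nat" where
  "pos_part e = (if e mod 2 = 0 then e div 2 else 0)"

definition neg_part :: "nat \<Rightarrow> nat" where
  "neg_part e = (if e mod 2 = 0 then 0 else Suc (e div 2))"

lemma int_encode_parts: "int (pos_part (int_encode z)) - int (neg_part (int_encode z)) = z"
  by (auto simp: pos_part_def neg_part_def int_encode_def sum_encode_def)

text \<open>The parameters are the size \<open>c\<close> of the alphabet, the size \<open>r\<close> of the neighbourhood, the
  dimension \<open>d\<close>, the number \<open>N\<close> of steps after which the automaton forgets its past, the coordinates
  \<open>off\<close> of the neighbourhood (shifted to make them non-negative) and the codes \<open>sc\<close> of the symbols.
  Site number \<open>i\<close> of the \<open>u\<close>-fold neighbourhood of the given sites is reached from site number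
  \<open>i div r ^ u\<close> by the steps given by the digits of \<open>i\<close> to base \<open>r\<close>.\<close>

locale sampling_program =
  fixes c r d N :: nat and off sc :: "nat \<Rightarrow> nat"
begin

definition coord :: "nat \<Rightarrow> nat \<Rightarrow> nat \<Rightarrow> nat" where
  "coord X i j = code_nth (code_nth X i) j"

definition level_size :: "nat \<Rightarrow> nat \<Rightarrow> nat" where
  "level_size X u = code_length X * r ^ u"

text \<open>Coordinate \<open>j\<close> of the total displacement coded by \<open>i\<close>,
  enlarged by the shift hidden in \<open>off\<close> once per step. For two sites of the same level
  these shifts cancel.\<close>

definition drift :: "nat \<Rightarrow> nat \<Rightarrow> nat \<Rightarrow> nat" where
  "drift u i j = (\<Sum>s<u. table (r * d) off (digit r i s * d + j))"

text \<open>Equality of integer coordinates, with the negative parts moved to the opposite side so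
  that only natural numbers are added.\<close>

definition same_site :: "nat \<Rightarrow> nat \<Rightarrow> nat \<Rightarrow> nat \<Rightarrow> bool" where
  "same_site X u i i' \<longleftrightarrow> (\<forall>j<d.
     pos_part (coord X (i div r ^ u) j) + neg_part (coord X (i' div r ^ u) j) + drift u i j =
     pos_part (coord X (i' div r ^ u) j) + neg_part (coord X (i div r ^ u) j) + drift u i' j)"

definition symbol :: "nat \<Rightarrow> nat \<Rightarrow> nat" where
  "symbol V i = table c sc (digit c V i)"

text \<open>The neighbours of place \<open>i\<close> of a level occupy the places from
  \<open>i * r\<close> to \<open>i * r + r - 1\<close> of the next level.\<close>

definition view_code :: "nat \<Rightarrow> nat \<Rightarrow> nat" where
  "view_code V i = list_encode (map (\<lambda>j. symbol V (i * r + j)) [0..<r])"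

text \<open>\<open>factor\<close>, \<open>transition\<close> and \<open>weights\<close> are numerators. Every factor has the denominator \<open>2 ^ p\<close>,
  also those that are equal to 0 or 1, so that the common denominator is known in advance.\<close>

definition factor :: "query \<Rightarrow> nat \<Rightarrow> nat \<Rightarrow> nat \<Rightarrow> nat \<Rightarrow> nat \<Rightarrow> nat \<Rightarrow> nat" where
  "factor q X p u V W i =
     (if \<exists>i'<i. same_site X u i' i
      then if \<forall>i'<i. same_site X u i' i \<longrightarrow> digit c W i' = digit c W i then 2 ^ p else 0
      else min (q [view_code V i, symbol W i, p]) (2 ^ p))"

definition transition :: "query \<Rightarrow> nat \<Rightarrow> nat \<Rightarrow> nat \<Rightarrow> nat \<Rightarrow> nat \<Rightarrow> nat" where
  "transition q X p u V W = (\<Prod>i<level_size X u. factor q X p u V W i)"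

definition weights :: "query \<Rightarrow> nat \<Rightarrow> nat \<Rightarrow> nat \<Rightarrow> nat" where
  "weights q X p t = rec_nat (list_encode (map (\<lambda>V. of_bool (V = 0)) [0..<c ^ level_size X t]))
     (\<lambda>k y. list_encode (map (\<lambda>W. \<Sum>V<c ^ level_size X (t - k).
        transition q X p (t - Suc k) V W * code_nth y V) [0..<c ^ level_size X (t - Suc k)])) t"

text \<open>A bound on the rounding error of \<open>t\<close> steps of the recursion, in units of \<open>1 / 2 ^ p\<close>.\<close>

definition error :: "nat \<Rightarrow> nat \<Rightarrow> nat" where
  "error X t = (c ^ (code_length X * Suc r ^ t) * Suc (code_length X * Suc r ^ t)) ^ t"

text \<open>As \<open>error X t\<close> is at most \<open>2 ^ error X t\<close>, this many digits
  bring the total rounding error below \<open>1 / 2 ^ n\<close> without computing a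
  logarithm.\<close>

definition precision :: "nat \<Rightarrow> nat \<Rightarrow> nat" where
  "precision X n = n + error X (N * n)"

definition scale :: "nat \<Rightarrow> nat \<Rightarrow> nat" where
  "scale X n = 2 ^ (precision X n * (\<Sum>u<N * n. level_size X u))"

definition cumulative :: "query \<Rightarrow> nat \<Rightarrow> nat \<Rightarrow> nat \<Rightarrow> nat" where
  "cumulative q X n W = (\<Sum>V<W. code_nth (weights q X (precision X n) (N * n)) V)"

text \<open>At stage \<open>n\<close> each pattern probability is known up to
  \<open>Suc (code_length X) / 2 ^ n\<close>: 1 for rounding, the rest for the forgotten past. The
  distribution function adds at most \<open>c ^ code_length X\<close> of them.\<close>

definition margin :: "nat \<Rightarrow> nat" where
  "margin X = c ^ code_length X * Suc (code_length X)"

text \<open>Inverse transform sampling: \<open>a\<close> consists of the first \<open>n\<close> digits of a uniform sample \<open>x\<close>. The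
  pattern \<open>W\<close> is accepted as soon as the approximations at stage \<open>n\<close> certify that \<open>x\<close> lies between the
  values of the distribution function at \<open>W\<close> and \<open>Suc W\<close>.\<close>

definition accepted :: "query \<Rightarrow> nat \<Rightarrow> nat \<Rightarrow> nat \<Rightarrow> nat \<Rightarrow> bool" where
  "accepted q X n W a \<longleftrightarrow>
     cumulative q X n W * 2 ^ n + margin X * scale X n \<le> a * scale X n \<and>
     Suc a * scale X n + margin X * scale X n \<le> cumulative q X n (Suc W) * 2 ^ n"

text \<open>\<open>z\<close> codes both the stage (quotient) and the pattern (remainder), so that a
  single unbounded search tries all pairs. Only the sample with index 0 is ever read.\<close>

definition accepted_code :: "query \<Rightarrow> query \<Rightarrow> nat \<Rightarrow> nat \<Rightarrow> bool" where
  "accepted_code q s X z \<longleftrightarrow>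
     accepted q X (z div c ^ code_length X) (z mod c ^ code_length X) (s [0, z div c ^ code_length X])"

definition pattern_code :: "nat \<Rightarrow> nat \<Rightarrow> nat" where
  "pattern_code X z = list_encode (map (\<lambda>i. symbol (z mod c ^ code_length X) i) [0..<code_length X])"

section \<open>Computability of the program\<close>

lemma computable_digit [computable]:
  assumes "computable n A" "computable n B" "computable n C"
  shows "computable n (\<lambda>q s xs. digit (A q s xs) (B q s xs) (C q s xs))"
  unfolding digit_def by (intro computable assms)

lemma computable_table' [computable]:
  assumes "computable n A"
  shows "computable n (\<lambda>q s xs. table m g (A q s xs))"
  unfolding table_def by (rule computable_table[OF assms])

lemma computable_parts [computable]:
  assumes "computable n A"
  shows "computable n (\<lambda>q s xs. pos_part (A q s xs))" "computable n (\<lambda>q s xs. neg_part (A q s xs))"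
  unfolding pos_part_def neg_part_def by (intro computable assms)+

lemma computable_coord [computable]:
  assumes "computable n A" "computable n B" "computable n C"
  shows "computable n (\<lambda>q s xs. coord (A q s xs) (B q s xs) (C q s xs))"
  unfolding coord_def by (intro computable assms)

lemma computable_level_size [computable]:
  assumes "computable n A" "computable n B"
  shows "computable n (\<lambda>q s xs. level_size (A q s xs) (B q s xs))"
  unfolding level_size_def by (intro computable assms)

lemma computable_drift [computable]:
  assumes "computable n A" "computable n B" "computable n C"
  shows "computable n (\<lambda>q s xs. drift (A q s xs) (B q s xs) (C q s xs))"
  unfolding drift_def by (intro computable computable_tl assms)

lemma decidable_same_site [computable]:
  assumes "computable n A" "computable n B" "computable n C" "computable n D"
  shows "decidable n (\<lambda>q s xs. same_site (A q s xs) (B q s xs) (C q s xs) (D q s xs))"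
  unfolding same_site_def by (intro computable computable_tl assms)

lemma computable_symbol [computable]:
  assumes "computable n A" "computable n B"
  shows "computable n (\<lambda>q s xs. symbol (A q s xs) (B q s xs))"
  unfolding symbol_def by (intro computable assms)

lemma computable_view_code [computable]:
  assumes "computable n A" "computable n B"
  shows "computable n (\<lambda>q s xs. view_code (A q s xs) (B q s xs))"
  unfolding view_code_def by (intro computable computable_tl assms)

lemma computable_factor [computable]:
  assumes "computable n A" "computable n B" "computable n C" "computable n D" "computable n E"
    "computable n I"
  shows "computable n (\<lambda>q s xs. factor q (A q s xs) (B q s xs) (C q s xs) (D q s xs) (E q s xs) (I q s xs))"
  unfolding factor_def by (intro computable computable_ask_rule computable_tl assms)

lemma computable_transition [computable]:
  assumes "computable n A" "computable n B" "computable n C" "computable n D" "computable n E"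
  shows "computable n (\<lambda>q s xs. transition q (A q s xs) (B q s xs) (C q s xs) (D q s xs) (E q s xs))"
  unfolding transition_def by (intro computable computable_tl assms)

lemma computable_weights [computable]:
  assumes "computable n A" "computable n B" "computable n C"
  shows "computable n (\<lambda>q s xs. weights q (A q s xs) (B q s xs) (C q s xs))"
  unfolding weights_def by (intro computable computable_rec_nat computable_tl assms)

lemma computable_error [computable]:
  assumes "computable n A" "computable n B"
  shows "computable n (\<lambda>q s xs. error (A q s xs) (B q s xs))"
  unfolding error_def by (intro computable assms)

lemma computable_precision [computable]:
  assumes "computable n A" "computable n B"
  shows "computable n (\<lambda>q s xs. precision (A q s xs) (B q s xs))"
  unfolding precision_def by (intro computable assms)

lemma computable_scale [computable]:
  assumes "computable n A" "computable n B"
  shows "computable n (\<lambda>q s xs. scale (A q s xs) (B q s xs))"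
  unfolding scale_def by (intro computable computable_tl assms)

lemma computable_cumulative [computable]:
  assumes "computable n A" "computable n B" "computable n C"
  shows "computable n (\<lambda>q s xs. cumulative q (A q s xs) (B q s xs) (C q s xs))"
  unfolding cumulative_def by (intro computable computable_tl assms)

lemma computable_margin [computable]:
  assumes "computable n A"
  shows "computable n (\<lambda>q s xs. margin (A q s xs))"
  unfolding margin_def by (intro computable assms)

lemma decidable_accepted [computable]:
  assumes "computable n A" "computable n B" "computable n C" "computable n D"
  shows "decidable n (\<lambda>q s xs. accepted q (A q s xs) (B q s xs) (C q s xs) (D q s xs))"
  unfolding accepted_def by (intro computable assms)

lemma decidable_accepted_code [computable]:
  assumes "computable n A" "computable n B"
  shows "decidable n (\<lambda>q s xs. accepted_code q s (A q s xs) (B q s xs))"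
  unfolding accepted_code_def by (intro computable computable_ask_random assms)

lemma computable_pattern_code [computable]:
  assumes "computable n A" "computable n B"
  shows "computable n (\<lambda>q s xs. pattern_code (A q s xs) (B q s xs))"
  unfolding pattern_code_def by (intro computable computable_tl assms)

lemma exists_sampling_algorithm:
  "\<exists>P. \<forall>q s X. run q s P [X] =
     (if \<exists>z. accepted_code q s X z then Some (pattern_code X (LEAST z. accepted_code q s X z)) else None)"
proof -
  \<comment> \<open>\<open>Mu\<close> looks for a zero, hence the negation.\<close>
  have "decidable (Suc (Suc 0)) (\<lambda>q s xs. \<not> accepted_code q s (hd (tl xs)) (hd xs))"
    by (intro computable)
  then obtain A where "\<And>q s xs. length xs = Suc (Suc 0) \<Longrightarrow>
      run q s A xs = Some (of_bool (\<not> accepted_code q s (hd (tl xs)) (hd xs)))"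
    unfolding computable_def by blast
  from this[of "[z, X]" for z X]
  have A: "run q s A [z, X] = Some (of_bool (\<not> accepted_code q s X z))" for q s z X
    by simp
  have "computable (Suc (Suc 0)) (\<lambda>q s xs. pattern_code (hd (tl xs)) (hd xs))"
    by (intro computable)
  then obtain B where "\<And>q s xs. length xs = Suc (Suc 0) \<Longrightarrow>
      run q s B xs = Some (pattern_code (hd (tl xs)) (hd xs))"
    unfolding computable_def by blast
  from this[of "[z, X]" for z X]
  have B: "run q s B [z, X] = Some (pattern_code X z)" for q s z X
    by simp
  have "run q s (Comp B [Mu A, Proj 0]) [X] =
      (if \<exists>z. accepted_code q s X z then Some (pattern_code X (LEAST z. accepted_code q s X z)) else None)" for q s X
    by (simp add: A B Let_def)
  then show ?thesis by blast
qed

text \<open>The entries of the lists handled by \<open>weights\<close>: after \<open>k\<close>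
  rounds \<open>W\<close> is a word on level \<open>t - k\<close>. The start is the point mass at
  the word 0 on level \<open>t\<close>, that is, a constant initial configuration.\<close>

fun weight :: "query \<Rightarrow> nat \<Rightarrow> nat \<Rightarrow> nat \<Rightarrow> nat \<Rightarrow> nat \<Rightarrow> nat" where
  "weight q X p t 0 W = of_bool (W = 0)"
| "weight q X p t (Suc k) W =
     (\<Sum>V<c ^ level_size X (t - k). transition q X p (t - Suc k) V W * weight q X p t k V)"

lemma weights_eq: "weights q X p t = list_encode (map (weight q X p t t) [0..<c ^ level_size X 0])"
proof -
  have "rec_nat (list_encode (map (\<lambda>V. of_bool (V = 0)) [0..<c ^ level_size X t]))
     (\<lambda>k y. list_encode (map (\<lambda>W. \<Sum>V<c ^ level_size X (t - k).
        transition q X p (t - Suc k) V W * code_nth y V) [0..<c ^ level_size X (t - Suc k)])) k =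
     list_encode (map (weight q X p t k) [0..<c ^ level_size X (t - k)])" for k
  proof (induction k)
    case (Suc k)
    show ?case
      unfolding old.nat.simps(7) Suc
      by (intro arg_cong[where f = list_encode] map_cong refl) simp
  qed simp
  from this[of t] show ?thesis by (simp add: weights_def)
qed

lemma code_nth_weights:
  "W < c ^ code_length X \<Longrightarrow> code_nth (weights q X p t) W = weight q X p t t W"
  by (simp add: weights_eq level_size_def)

end

section \<open>Probabilities of patterns on lists of sites\<close>

text \<open>Letters are attached to places of the list rather than to sites; if a repeated site
  receives two different letters, the event is empty.\<close>

definition list_event :: "(int ^ 'd::finite) list \<Rightarrow> (nat \<Rightarrow> 's) \<Rightarrow> ('d, 's) config set" where
  "list_event L w = {x. \<forall>i<length L. x (L ! i) = w i}"

lemma depends_on_list_event: "depends_on (set L) (indicator (list_event L w) :: _ \<Rightarrow> real)"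
  by (auto simp: depends_on_def list_event_def indicator_def)

lemma local_function_list_event: "local_function (indicator (list_event L w))"
  by (rule local_functionI[OF _ depends_on_list_event]) simp

text \<open>Whether a place is a first occurrence depends on earlier places only, so the induction
  appends at the end.\<close>

lemma prod_first_occurrences:
  fixes g :: "'a \<Rightarrow> 'b::comm_monoid_mult"
  shows "(\<Prod>i<length L. if \<exists>i'<i. L ! i' = L ! i then 1 else g (L ! i)) = (\<Prod>k\<in>set L. g k)"
proof (induction L rule: rev_induct)
  case (snoc k L)
  have "(\<Prod>i<length L. if \<exists>i'<i. (L @ [k]) ! i' = (L @ [k]) ! i then 1 else g ((L @ [k]) ! i)) =
      (\<Prod>i<length L. if \<exists>i'<i. L ! i' = L ! i then 1 else g (L ! i))"
  proof (intro prod.cong refl)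
    fix i assume i: "i \<in> {..<length L}"
    have ex: "(\<exists>i'<i. (L @ [k]) ! i' = (L @ [k]) ! i) \<longleftrightarrow> (\<exists>i'<i. L ! i' = L ! i)"
      by (intro ex_cong1 conj_cong refl) (use i in \<open>simp add: nth_append\<close>)
    have nth: "(L @ [k]) ! i = L ! i" using i by (simp add: nth_append)
    show "(if \<exists>i'<i. (L @ [k]) ! i' = (L @ [k]) ! i then 1 else g ((L @ [k]) ! i)) =
        (if \<exists>i'<i. L ! i' = L ! i then 1 else g (L ! i))"
      unfolding ex by (simp only: nth)
  qed
  note first = this
  have "(\<exists>i'<length L. (L @ [k]) ! i' = (L @ [k]) ! length L) \<longleftrightarrow> k \<in> set L"
    by (auto simp: nth_append in_set_conv_nth)
  then have last: "(if \<exists>i'<length L. (L @ [k]) ! i' = (L @ [k]) ! length L then 1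
      else g ((L @ [k]) ! length L)) = (if k \<in> set L then 1 else g k)"
    by (simp only: nth_append_length)
  show ?case
    unfolding length_append_singleton prod.lessThan_Suc first last snoc
    by (simp add: insert_absorb mult.commute)
qed simp

definition nbr_list :: "(int ^ 'd::finite) list \<Rightarrow> (int ^ 'd) list \<Rightarrow> (int ^ 'd) list" where
  "nbr_list ns L = concat (map (\<lambda>k. map (\<lambda>n. k + n) ns) L)"

lemma length_nbr_list [simp]: "length (nbr_list ns L) = length L * length ns"
  by (induction L) (auto simp: nbr_list_def)

lemma nth_nbr_list:
  "i < length L * length ns \<Longrightarrow> nbr_list ns L ! i = L ! (i div length ns) + ns ! (i mod length ns)"
proof (induction L arbitrary: i)
  case (Cons k L)
  have eq: "nbr_list ns (k # L) = map (\<lambda>n. k + n) ns @ nbr_list ns L" by (simp add: nbr_list_def)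
  show ?case
  proof (cases "i < length ns")
    case True
    then show ?thesis by (simp add: eq nth_append)
  next
    case False
    moreover have "length ns \<noteq> 0" using Cons.prems by auto
    ultimately have "i div length ns = Suc ((i - length ns) div length ns)"
      "i mod length ns = (i - length ns) mod length ns"
      by (simp_all add: le_div_geq le_mod_geq)
    then show ?thesis
      using False Cons.IH[of "i - length ns"] Cons.prems by (simp add: eq nth_append)
  qed
qed simp

primrec level :: "(int ^ 'd::finite) list \<Rightarrow> (int ^ 'd) list \<Rightarrow> nat \<Rightarrow> (int ^ 'd) list" where
  "level ns ks 0 = ks"
| "level ns ks (Suc u) = nbr_list ns (level ns ks u)"

lemma length_level [simp]: "length (level ns ks u) = length ks * length ns ^ u"
  by (induction u) (auto simp: mult.assoc mult.commute)

context pca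
begin

text \<open>The factor of a repeated site only checks that the pattern is consistent.\<close>

definition kernel_factor ::
    "(int ^ 'd) list \<Rightarrow> (nat \<Rightarrow> 's) \<Rightarrow> (nat \<Rightarrow> 's) \<Rightarrow> nat \<Rightarrow> real" where
  "kernel_factor L w v i = (if \<exists>i'<i. L ! i' = L ! i
     then of_bool (\<forall>i'<i. L ! i' = L ! i \<longrightarrow> w i' = w i)
     else pmf (\<phi> (map (\<lambda>j. v (i * length ns + j)) [0..<length ns])) (w i))"

lemma kernel_factor_bounds: "0 \<le> kernel_factor L w v i" "kernel_factor L w v i \<le> 1"
  by (auto simp: kernel_factor_def pmf_le_1)

lemma view_nbr_list:
  assumes "i < length L"
  shows "map (\<lambda>j. x (nbr_list ns L ! (i * length ns + j))) [0..<length ns] = view x (L ! i)"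
proof (rule nth_equalityI)
  fix j assume "j < length (map (\<lambda>j. x (nbr_list ns L ! (i * length ns + j))) [0..<length ns])"
  then have j: "j < length ns" by simp
  have "i * length ns + j < Suc i * length ns" using j by simp
  also have "\<dots> \<le> length L * length ns" using assms by (intro mult_right_mono) auto
  finally show "map (\<lambda>j. x (nbr_list ns L ! (i * length ns + j))) [0..<length ns] ! j = view x (L ! i) ! j"
    using j div_mult_self3[of "length ns" i j] by (cases "ns = []") (simp_all add: nth_nbr_list)
qed simp

text \<open>A consistent word describes a cylinder, whose probability counts each site once, at its
  first occurrence. For an inconsistent word the event is empty and the factor at a contradicting
  place vanishes.\<close>

lemma T_list_event:
  "T (indicator (list_event L w)) x = (\<Prod>i<length L. kernel_factor L w (\<lambda>i. x (nbr_list ns L ! i)) i)"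
proof (cases "\<forall>i<length L. \<forall>i'<i. L ! i' = L ! i \<longrightarrow> w i' = w i")
  case True
  define u where "u k = w (LEAST i. L ! i = k)" for k
  have u: "u (L ! i) = w i" if "i < length L" for i
  proof -
    let ?j = "LEAST j. L ! j = L ! i"
    have "L ! ?j = L ! i" "?j \<le> i" by (rule LeastI[of _ i], rule refl) (rule Least_le, rule refl)
    then show ?thesis using True that by (cases "?j = i") (auto simp: u_def)
  qed
  have "list_event L w = cylinder (set L) u"
    using u by (auto simp: list_event_def cylinder_def all_set_conv_all_nth)
  then have "T (indicator (list_event L w)) x = (\<Prod>k\<in>set L. pmf (\<phi> (view x k)) (u k))"
    using measure_kernel_cylinder[of "set L" x u] prob_algebra_configD[OF kernel_in, of x] by (simp add: T_def)
  also have "\<dots> = (\<Prod>i<length L. if \<exists>i'<i. L ! i' = L ! i then 1 else pmf (\<phi> (view x (L ! i))) (u (L ! i)))"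
    by (rule prod_first_occurrences[symmetric])
  also have "\<dots> = (\<Prod>i<length L. kernel_factor L w (\<lambda>i. x (nbr_list ns L ! i)) i)"
  proof (intro prod.cong refl)
    fix i assume "i \<in> {..<length L}"
    then have i: "i < length L" by simp
    have all: "(\<forall>i'<i. L ! i' = L ! i \<longrightarrow> w i' = w i) \<longleftrightarrow> True" using True i by blast
    show "(if \<exists>i'<i. L ! i' = L ! i then 1 else pmf (\<phi> (view x (L ! i))) (u (L ! i))) =
        kernel_factor L w (\<lambda>i. x (nbr_list ns L ! i)) i"
      unfolding kernel_factor_def view_nbr_list[OF i] u[OF i] all by (simp only: of_bool_eq)
  qed
  finally show ?thesis .
next
  case False
  then obtain i i' where i: "i < length L" "i' < i" "L ! i' = L ! i" "w i' \<noteq> w i" by blast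
  have "x \<notin> list_event L w" for x
  proof
    assume "x \<in> list_event L w"
    then have "x (L ! i') = w i'" "x (L ! i) = w i" using i(1,2) by (auto simp: list_event_def)
    then show False using i(3,4) by simp
  qed
  then have "indicator (list_event L w) = (\<lambda>_ :: ('d, 's) config. 0 :: real)"
    by (simp add: indicator_def fun_eq_iff)
  moreover have "kernel_factor L w (\<lambda>i. x (nbr_list ns L ! i)) i = 0"
    using i by (auto simp: kernel_factor_def)
  then have "(\<Prod>i<length L. kernel_factor L w (\<lambda>i. x (nbr_list ns L ! i)) i) = 0"
    using i(1) by (intro prod_zero) auto
  ultimately show ?thesis by (simp add: T_const)
qed

end

section \<open>Correctness of the sampling program\<close>

locale pca_sampler =
  contracting_pca ns \<phi> \<Phi> N + sampling_program "CARD('s)" "length ns" "CARD('d)" N off sc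
  for ns :: "(int ^ 'd::finite) list" and \<phi> :: "'s::finite list \<Rightarrow> 's pmf"
    and \<Phi> :: "('d, 's) config \<Rightarrow> ('d, 's) config measure" and N off sc +
  fixes en :: "nat \<Rightarrow> 's" and \<rho> :: int
  assumes en: "bij_betw en {..<CARD('s)} UNIV"
    and sc: "\<And>i. i < CARD('s) \<Longrightarrow> sc i = symbol_code (en i)"
    and off: "\<And>a j. a < length ns \<Longrightarrow> j < CARD('d) \<Longrightarrow> int (off (a * CARD('d) + j)) = ns ! a $ (axes ! j) + \<rho>"
begin

lemma axes: "distinct (axes :: 'd list)" "set (axes :: 'd list) = UNIV" "length (axes :: 'd list) = CARD('d)"
proof -
  have "\<exists>js :: 'd list. distinct js \<and> set js = UNIV"
    using finite_distinct_list[of "UNIV :: 'd set"] by auto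
  from someI_ex[OF this] show 1: "distinct (axes :: 'd list)" "set (axes :: 'd list) = UNIV"
    by (auto simp: axes_def)
  then show "length (axes :: 'd list) = CARD('d)"
    using distinct_card by fastforce
qed

lemma card_pos [simp]: "0 < CARD('s)"
  by (simp add: card_gt_0_iff)

lemma drift_Suc:
  "drift (Suc u) i j = table (length ns * CARD('d)) off (i mod length ns * CARD('d) + j) + drift u (i div length ns) j"
  unfolding drift_def by (subst sum.lessThan_Suc_shift) (simp add: digit_0 digit_Suc)

text \<open>Place \<open>i\<close> arises from place \<open>i div length ns\<close> of the previous
  level by the step \<open>i mod length ns\<close>. Each step adds one \<open>\<rho>\<close> to
  \<open>drift\<close>, which the left-hand side compensates.\<close>

lemma nth_level:
  assumes "i < length ks * length ns ^ u" "j < CARD('d)"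
  shows "level ns ks u ! i $ (axes ! j) + int u * \<rho> = ks ! (i div length ns ^ u) $ (axes ! j) + int (drift u i j)"
  using assms(1)
proof (induction u arbitrary: i)
  case (Suc u)
  let ?r = "length ns"
  have r: "0 < ?r" using Suc.prems by (cases "?r = 0") auto
  have i: "i < length ks * ?r ^ u * ?r" using Suc.prems by (simp add: mult_ac)
  then have div: "i div ?r < length ks * ?r ^ u" by (simp add: less_mult_imp_div_less)
  have mod: "i mod ?r < ?r" using r by simp
  have "i mod ?r * CARD('d) + j < Suc (i mod ?r) * CARD('d)" using assms(2) by simp
  also have "\<dots> \<le> ?r * CARD('d)" using mod by (intro mult_right_mono) auto
  finally have tab: "int (table (?r * CARD('d)) off (i mod ?r * CARD('d) + j)) = ns ! (i mod ?r) $ (axes ! j) + \<rho>"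
    using off[OF mod assms(2)] by (simp add: table_def)
  have "level ns ks (Suc u) ! i = level ns ks u ! (i div ?r) + ns ! (i mod ?r)"
    using i by (simp add: nth_nbr_list)
  moreover have "i div ?r ^ Suc u = i div ?r div ?r ^ u"
    by (simp add: div_mult2_eq)
  ultimately show ?case
    using Suc.IH[OF div] tab by (simp add: drift_Suc algebra_simps)
qed (simp add: drift_def)

lemma code_length_sites [simp]: "code_length (sites_code ks) = length ks"
  by (simp add: sites_code_def)

lemma coord_sites:
  fixes ks :: "(int ^ 'd) list"
  shows "i < length ks \<Longrightarrow> j < CARD('d) \<Longrightarrow> coord (sites_code ks) i j = int_encode (ks ! i $ (axes ! j))"
  by (simp add: coord_def sites_code_def site_code_def axes(3))

lemma same_site_iff:
  assumes i: "i < length (level ns ks u)" "i' < length (level ns ks u)"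
  shows "same_site (sites_code ks) u i i' \<longleftrightarrow> level ns ks u ! i = level ns ks u ! i'"
proof -
  let ?r = "length ns"
  let ?a = "i div ?r ^ u" and ?a' = "i' div ?r ^ u" and ?X = "sites_code ks"
  have a: "?a < length ks" "?a' < length ks"
    using i by (simp_all add: less_mult_imp_div_less)
  have "(pos_part (coord ?X ?a j) + neg_part (coord ?X ?a' j) + drift u i j =
      pos_part (coord ?X ?a' j) + neg_part (coord ?X ?a j) + drift u i' j) \<longleftrightarrow>
      level ns ks u ! i $ (axes ! j) = level ns ks u ! i' $ (axes ! j)" if j: "j < CARD('d)" for j
  proof -
    have 1: "level ns ks u ! i $ (axes ! j) + int u * \<rho> = ks ! ?a $ (axes ! j) + int (drift u i j)"
      "level ns ks u ! i' $ (axes ! j) + int u * \<rho> = ks ! ?a' $ (axes ! j) + int (drift u i' j)"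
      using i j by (auto intro!: nth_level)
    show ?thesis
      using int_encode_parts[of "ks ! ?a $ (axes ! j)"] int_encode_parts[of "ks ! ?a' $ (axes ! j)"] 1
      unfolding coord_sites[OF a(1) j] coord_sites[OF a(2) j] by linarith
  qed
  then have "same_site ?X u i i' \<longleftrightarrow> (\<forall>j<CARD('d). level ns ks u ! i $ (axes ! j) = level ns ks u ! i' $ (axes ! j))"
    unfolding same_site_def by blast
  also have "\<dots> \<longleftrightarrow> (\<forall>m\<in>set axes. level ns ks u ! i $ m = level ns ks u ! i' $ m)"
    by (simp add: all_set_conv_all_nth axes(3))
  also have "\<dots> \<longleftrightarrow> level ns ks u ! i = level ns ks u ! i'"
    by (simp add: axes(2) vec_eq_iff)
  finally show ?thesis .
qed

definition letter :: "nat \<Rightarrow> nat \<Rightarrow> 's" where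
  "letter V i = en (digit CARD('s) V i)"

lemma symbol_eq: "symbol V i = symbol_code (letter V i)"
  by (simp add: symbol_def letter_def table_def digit_less sc)

lemma en_eq_iff: "i < CARD('s) \<Longrightarrow> j < CARD('s) \<Longrightarrow> en i = en j \<longleftrightarrow> i = j"
  using en by (auto simp: bij_betw_def inj_on_def)

lemma letter_eq_iff: "letter V i = letter W j \<longleftrightarrow> digit CARD('s) V i = digit CARD('s) W j"
  by (simp add: letter_def en_eq_iff digit_less)

lemma exists_letters:
  obtains V where "V < CARD('s) ^ l" "\<And>i. i < l \<Longrightarrow> letter V i = v i"
proof -
  have "\<exists>a<CARD('s). en a = s" for s
  proof -
    have "s \<in> en ` {..<CARD('s)}" using en by (simp add: bij_betw_def)
    then show ?thesis by auto
  qed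
  then obtain a where a: "\<And>s. a s < CARD('s)" "\<And>s. en (a s) = s" by metis
  obtain V where "V < CARD('s) ^ l" "\<forall>i<l. digit CARD('s) V i = a (v i)"
    using exists_digits[of "CARD('s)" l "\<lambda>i. a (v i)"] a by auto
  then show ?thesis using that[of V] a by (simp add: letter_def)
qed

lemma letters_inject:
  assumes "V < CARD('s) ^ l" "W < CARD('s) ^ l" "\<And>i. i < l \<Longrightarrow> letter V i = letter W i"
  shows "V = W"
  using digits_inject[OF assms(1,2)] assms(3) by (simp add: letter_eq_iff)

text \<open>Exactly one code below \<open>CARD('s) ^ l\<close> spells the first \<open>l\<close>
  letters of \<open>v\<close>.\<close>

lemma sum_letters:
  fixes g :: "(nat \<Rightarrow> 's) \<Rightarrow> real"
  assumes "\<And>v v'. (\<And>i. i < l \<Longrightarrow> v i = v' i) \<Longrightarrow> g v = g v'"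
  shows "(\<Sum>V<CARD('s) ^ l. g (letter V) * of_bool (\<forall>i<l. v i = letter V i)) = g v"
proof -
  obtain V where V: "V < CARD('s) ^ l" "\<And>i. i < l \<Longrightarrow> letter V i = v i"
    using exists_letters[of l v] by metis
  have "(\<Sum>W<CARD('s) ^ l. g (letter W) * of_bool (\<forall>i<l. v i = letter W i)) =
      (\<Sum>W<CARD('s) ^ l. if W = V then g v else 0)"
  proof (intro sum.cong refl)
    fix W assume W: "W \<in> {..<CARD('s) ^ l}"
    have "(\<forall>i<l. v i = letter W i) \<longleftrightarrow> W = V"
      using letters_inject[of W l V] W V by auto
    then show "g (letter W) * of_bool (\<forall>i<l. v i = letter W i) = (if W = V then g v else 0)"
      using assms[of "letter V" v] V(2) by simp
  qed
  also have "\<dots> = g v" using V(1) by simp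
  finally show ?thesis .
qed

definition exact_transition :: "(int ^ 'd) list \<Rightarrow> nat \<Rightarrow> nat \<Rightarrow> real" where
  "exact_transition L V W = (\<Prod>i<length L. kernel_factor L (letter W) (letter V) i)"

text \<open>The exact counterpart of one round of \<open>weight\<close>: \<open>T\<close> turns an
  event on a level into a combination of events on the next level.\<close>

lemma T_list_event_eq_sum:
  "T (indicator (list_event L (letter W))) = (\<lambda>x. \<Sum>V<CARD('s) ^ length (nbr_list ns L).
     exact_transition L V W * indicator (list_event (nbr_list ns L) (letter V)) x)"
proof
  fix x
  let ?l = "length (nbr_list ns L)"
  let ?g = "\<lambda>v. \<Prod>i<length L. kernel_factor L (letter W) v i"
  have "?g v = ?g v'" if eq: "\<And>i. i < ?l \<Longrightarrow> v i = v' i" for v v'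
  proof (intro prod.cong refl)
    fix i assume "i \<in> {..<length L}"
    then have "Suc i * length ns \<le> length L * length ns" by (intro mult_right_mono) auto
    then have "map (\<lambda>j. v (i * length ns + j)) [0..<length ns] = map (\<lambda>j. v' (i * length ns + j)) [0..<length ns]"
      using eq by (intro map_cong refl) simp
    then show "kernel_factor L (letter W) v i = kernel_factor L (letter W) v' i"
      by (simp only: kernel_factor_def)
  qed
  then have sum: "(\<Sum>V<CARD('s) ^ ?l. ?g (letter V) * of_bool (\<forall>i<?l. x (nbr_list ns L ! i) = letter V i)) =
      ?g (\<lambda>i. x (nbr_list ns L ! i))"
    by (rule sum_letters)
  have ind: "(of_bool (\<forall>i<?l. x (nbr_list ns L ! i) = letter V i) :: real) =
      indicator (list_event (nbr_list ns L) (letter V)) x" for V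
    by (simp only: list_event_def indicator_def mem_Collect_eq)
  show "T (indicator (list_event L (letter W))) x = (\<Sum>V<CARD('s) ^ ?l.
     exact_transition L V W * indicator (list_event (nbr_list ns L) (letter V)) x)"
    unfolding T_list_event exact_transition_def using sum by (simp only: ind)
qed

text \<open>The probability of seeing \<open>W\<close> on level \<open>t - k\<close> after
  \<open>k\<close> steps from the constant configuration \<open>en 0\<close>. Levels are numbered
  backwards in time: level \<open>u\<close> holds the sites that matter \<open>u\<close> steps
  before the end.\<close>

definition exact_weight :: "(int ^ 'd) list \<Rightarrow> nat \<Rightarrow> nat \<Rightarrow> nat \<Rightarrow> real" where
  "exact_weight ks t k W = (T ^^ k) (indicator (list_event (level ns ks (t - k)) (letter W))) (\<lambda>_. en 0)"

lemma exact_weight_bounds: "0 \<le> exact_weight ks t k W" "exact_weight ks t k W \<le> 1"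
  using T_pow_bounds[OF local_function_list_event, of 0 "level ns ks (t - k)" "letter W" 1 k "\<lambda>_. en 0"]
  by (auto simp: exact_weight_def indicator_def)

lemma level_size_sites: "level_size (sites_code ks) u = length (level ns ks u)"
  by (simp add: level_size_def)

lemma exact_weight_0:
  assumes "W < CARD('s) ^ level_size (sites_code ks) t"
  shows "exact_weight ks t 0 W = of_bool (W = 0)"
proof -
  have 0: "letter 0 i = en 0" for i by (simp add: letter_def digit_def)
  have "(\<forall>i<length (level ns ks t). en 0 = letter W i) \<longleftrightarrow> W = 0"
  proof
    assume "\<forall>i<length (level ns ks t). en 0 = letter W i"
    then show "W = 0"
      using assms by (intro letters_inject[of W "length (level ns ks t)" 0]) (auto simp: level_size_sites 0)
  qed (simp add: 0)
  then show ?thesis by (simp add: exact_weight_def list_event_def indicator_def)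
qed

lemma exact_weight_Suc:
  assumes "Suc k \<le> t"
  shows "exact_weight ks t (Suc k) W = (\<Sum>V<CARD('s) ^ level_size (sites_code ks) (t - k).
    exact_transition (level ns ks (t - Suc k)) V W * exact_weight ks t k V)"
proof -
  let ?L = "level ns ks (t - Suc k)"
  have lev: "level ns ks (t - k) = nbr_list ns ?L"
    using assms by (simp add: Suc_diff_Suc[symmetric] Suc_le_eq)
  have "exact_weight ks t (Suc k) W = (T ^^ k) (T (indicator (list_event ?L (letter W)))) (\<lambda>_. en 0)"
    by (simp add: exact_weight_def funpow_swap1)
  also have "\<dots> = (\<Sum>V<CARD('s) ^ length (nbr_list ns ?L). exact_transition ?L V W *
      (T ^^ k) (indicator (list_event (nbr_list ns ?L) (letter V))) (\<lambda>_. en 0))"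
    unfolding T_list_event_eq_sum by (subst T_pow_sum) (auto intro: local_function_list_event)
  finally show ?thesis
    by (simp only: exact_weight_def level_size_sites lev)
qed

context
  fixes q :: query
  assumes q: "presents q ns \<phi>"
begin

text \<open>An answer of the oracle may exceed 1. Cutting it off at 1 does not increase its distance
  to a probability and keeps the factor in the unit interval, as the estimate of products
  requires.\<close>

lemma factor_approx:
  fixes ks :: "(int ^ 'd) list" and u V W p i :: nat
  assumes i: "i < length (level ns ks u)"
  defines "e \<equiv> real (factor q (sites_code ks) p u V W i) / 2 ^ p"
  shows "0 \<le> e" "e \<le> 1" "\<bar>e - kernel_factor (level ns ks u) (letter W) (letter V) i\<bar> \<le> 1 / 2 ^ p"
proof -
  let ?L = "level ns ks u" and ?X = "sites_code ks"
  have same: "same_site ?X u i' i \<longleftrightarrow> ?L ! i' = ?L ! i" if "i' < i" for i'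
    by (rule same_site_iff) (use that i in auto)
  have ex: "(\<exists>i'<i. same_site ?X u i' i) \<longleftrightarrow> (\<exists>i'<i. ?L ! i' = ?L ! i)"
    using same by blast
  have all: "(\<forall>i'<i. same_site ?X u i' i \<longrightarrow> digit CARD('s) W i' = digit CARD('s) W i) \<longleftrightarrow>
      (\<forall>i'<i. ?L ! i' = ?L ! i \<longrightarrow> letter W i' = letter W i)"
    using same by (auto simp: letter_eq_iff)
  show "0 \<le> e" by (simp add: e_def)
  show "e \<le> 1" by (simp add: e_def factor_def)
  show "\<bar>e - kernel_factor ?L (letter W) (letter V) i\<bar> \<le> 1 / 2 ^ p"
  proof (cases "\<exists>i'<i. ?L ! i' = ?L ! i")
    case True
    define b where "b \<longleftrightarrow> (\<forall>i'<i. ?L ! i' = ?L ! i \<longrightarrow> letter W i' = letter W i)"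
    show ?thesis
      unfolding e_def factor_def kernel_factor_def ex all b_def[symmetric] if_P[OF True] by (cases b) auto
  next
    case False
    let ?a = "map (\<lambda>j. letter V (i * length ns + j)) [0..<length ns]"
    let ?Q = "real (q [word_code ?a, symbol_code (letter W i), p]) / 2 ^ p" and ?f = "pmf (\<phi> ?a) (letter W i)"
    have vc: "view_code V i = word_code ?a"
      by (simp add: view_code_def word_code_def symbol_eq comp_def)
    have "e = min ?Q 1"
      unfolding e_def factor_def ex if_not_P[OF False] vc symbol_eq by (simp add: min_def field_simps)
    moreover have "kernel_factor ?L (letter W) (letter V) i = ?f"
      using False by (simp only: kernel_factor_def if_False)
    moreover have "\<bar>?Q - ?f\<bar> \<le> 1 / 2 ^ p"
      using q unfolding presents_def by simp
    moreover have "?f \<le> 1" by (rule pmf_le_1)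
    moreover have "\<bar>min a 1 - b\<bar> \<le> e" if "\<bar>a - b\<bar> \<le> e" "b \<le> 1" for a b e :: real
      using that by (cases "a \<le> 1") auto
    ultimately show ?thesis by simp
  qed
qed

text \<open>For numbers of absolute value at most 1, the difference of two products is at most the
  sum of the differences of the factors; so rounding errors add up.\<close>

lemma transition_approx:
  defines "e \<equiv> \<lambda>ks p u V W. real (transition q (sites_code ks) p u V W) / 2 ^ (p * level_size (sites_code ks) u)"
  shows "0 \<le> e ks p u V W" "e ks p u V W \<le> 1"
    "\<bar>e ks p u V W - exact_transition (level ns ks u) V W\<bar> \<le> level_size (sites_code ks) u / 2 ^ p"
proof -
  let ?l = "length (level ns ks u)"
  let ?e = "\<lambda>i. real (factor q (sites_code ks) p u V W i) / 2 ^ p"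
  have eq: "e ks p u V W = (\<Prod>i<?l. ?e i)"
    by (simp only: e_def transition_def level_size_sites prod_dividef of_nat_prod prod_constant card_lessThan power_mult)
  have e: "0 \<le> ?e i" "?e i \<le> 1"
    "\<bar>?e i - kernel_factor (level ns ks u) (letter W) (letter V) i\<bar> \<le> 1 / 2 ^ p" if "i \<in> {..<?l}" for i
    using factor_approx[of i ks u p V W] that by (simp_all only: lessThan_iff)
  show "0 \<le> e ks p u V W" "e ks p u V W \<le> 1"
    unfolding eq using e by (auto intro!: prod_nonneg prod_le_1)
  have "norm ((\<Prod>i<?l. ?e i) - (\<Prod>i<?l. kernel_factor (level ns ks u) (letter W) (letter V) i)) \<le>
      (\<Sum>i<?l. norm (?e i - kernel_factor (level ns ks u) (letter W) (letter V) i))"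
  proof (rule norm_prod_diff)
    show "norm (?e i) \<le> 1" if "i \<in> {..<?l}" for i
      using e(1,2)[OF that] by (simp only: real_norm_def abs_of_nonneg)
    show "norm (kernel_factor (level ns ks u) (letter W) (letter V) i) \<le> 1" if "i \<in> {..<?l}" for i
      using kernel_factor_bounds[of "level ns ks u" "letter W" "letter V" i] by simp
  qed
  also have "\<dots> \<le> (\<Sum>i<?l. 1 / 2 ^ p)"
    by (intro sum_mono) (use e(3) in \<open>simp only: real_norm_def\<close>)
  also have "\<dots> = level_size (sites_code ks) u / 2 ^ p"
    by (simp only: level_size_sites) simp
  finally show "\<bar>e ks p u V W - exact_transition (level ns ks u) V W\<bar> \<le> level_size (sites_code ks) u / 2 ^ p"
    by (simp only: eq exact_transition_def real_norm_def)
qed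

text \<open>In units of \<open>1 / 2 ^ p\<close>, a round turns an error \<open>e\<close> into at
  most \<open>c ^ A * (e + A)\<close>, where \<open>A\<close> bounds the level sizes. For
  \<open>e \<ge> 1\<close> this is at most \<open>E * e\<close> with
  \<open>E = c ^ A * Suc A\<close>, so the error stays below \<open>E ^ k\<close>.\<close>

lemma weight_approx:
  fixes ks :: "(int ^ 'd) list"
  defines "X \<equiv> sites_code ks"
  assumes "k \<le> t" "W < CARD('s) ^ level_size X (t - k)"
  shows "\<bar>real (weight q X p t k W) / 2 ^ (p * (\<Sum>u\<in>{t - k..<t}. level_size X u)) - exact_weight ks t k W\<bar>
    \<le> (CARD('s) ^ (length ks * Suc (length ns) ^ t) * Suc (length ks * Suc (length ns) ^ t)) ^ k / 2 ^ p"
  using assms(2,3)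
proof (induction k arbitrary: W)
  case 0
  then show ?case using exact_weight_0[of W ks t] by (simp add: X_def)
next
  case (Suc k)
  \<comment> \<open>The base \<open>Suc (length ns)\<close> keeps the powers monotone even for an
    empty neighbourhood, where \<open>length ns ^ u\<close> drops from 1 to 0.\<close>
  let ?c = "CARD('s)" and ?A = "length ks * Suc (length ns) ^ t"
  let ?E = "?c ^ ?A * Suc ?A"
  let ?u = "t - Suc k"
  let ?l = "level_size X ?u" and ?l' = "level_size X (t - k)"
  let ?S = "\<lambda>k. \<Sum>u\<in>{t - k..<t}. level_size X u"
  let ?tr = "\<lambda>V. real (transition q X p ?u V W) / 2 ^ (p * ?l)"
  let ?w = "\<lambda>V. real (weight q X p t k V) / 2 ^ (p * ?S k)"
  let ?TR = "\<lambda>V. exact_transition (level ns ks ?u) V W" and ?W = "\<lambda>V. exact_weight ks t k V"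
  have size: "level_size X u \<le> ?A" if "u \<le> t" for u
  proof -
    have "length ns ^ u \<le> Suc (length ns) ^ u" by (rule power_mono) auto
    also have "\<dots> \<le> Suc (length ns) ^ t" using that by (intro power_increasing) auto
    finally show ?thesis by (simp add: level_size_def X_def)
  qed
  have "{?u..<t} = insert ?u {t - k..<t}" using Suc.prems(1) by auto
  then have S: "?S (Suc k) = ?l + ?S k" using Suc.prems(1) by simp
  have "real (weight q X p t (Suc k) W) / 2 ^ (p * ?S (Suc k)) = (\<Sum>V<?c ^ ?l'. ?tr V * ?w V)"
    unfolding S weight.simps of_nat_sum of_nat_mult sum_divide_distrib
    by (intro sum.cong refl) (simp add: distrib_left power_add)
  moreover have "exact_weight ks t (Suc k) W = (\<Sum>V<?c ^ ?l'. ?TR V * ?W V)"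
    unfolding X_def by (rule exact_weight_Suc[OF Suc.prems(1)])
  ultimately have "\<bar>real (weight q X p t (Suc k) W) / 2 ^ (p * ?S (Suc k)) - exact_weight ks t (Suc k) W\<bar> =
      \<bar>\<Sum>V<?c ^ ?l'. ?tr V * ?w V - ?TR V * ?W V\<bar>"
    by (simp only: sum_subtractf)
  also have "\<dots> \<le> (\<Sum>V<?c ^ ?l'. real (?E ^ k) / 2 ^ p + ?A / 2 ^ p)"
  proof (rule order_trans[OF sum_abs], rule sum_mono)
    fix V assume "V \<in> {..<?c ^ ?l'}"
    then have IH: "\<bar>?w V - ?W V\<bar> \<le> real (?E ^ k) / 2 ^ p"
      using Suc.IH[of V] Suc.prems(1) by simp
    have tr: "0 \<le> ?tr V" "?tr V \<le> 1" "\<bar>?tr V - ?TR V\<bar> \<le> ?l / 2 ^ p"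
      unfolding X_def by (rule transition_approx)+
    have l: "real ?l / 2 ^ p \<le> ?A / 2 ^ p"
      using size[of ?u] by (intro divide_right_mono) (simp_all only: of_nat_le_iff diff_le_self, simp)
    have "\<bar>?tr V * ?w V - ?TR V * ?W V\<bar> = \<bar>?tr V * (?w V - ?W V) + (?tr V - ?TR V) * ?W V\<bar>"
      by (simp add: algebra_simps)
    also have "\<dots> \<le> \<bar>?tr V\<bar> * \<bar>?w V - ?W V\<bar> + \<bar>?tr V - ?TR V\<bar> * \<bar>?W V\<bar>"
      by (rule order_trans[OF abs_triangle_ineq]) (simp add: abs_mult)
    also have "\<dots> \<le> 1 * \<bar>?w V - ?W V\<bar> + \<bar>?tr V - ?TR V\<bar> * 1"
      using tr exact_weight_bounds[of ks t k V] by (intro add_mono mult_mono) auto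
    also have "\<dots> \<le> real (?E ^ k) / 2 ^ p + ?A / 2 ^ p"
      using IH tr(3) l by linarith
    finally show "\<bar>?tr V * ?w V - ?TR V * ?W V\<bar> \<le> real (?E ^ k) / 2 ^ p + ?A / 2 ^ p" .
  qed
  also have "\<dots> = real (?c ^ ?l' * (?E ^ k + ?A)) / 2 ^ p"
    by (simp add: add_divide_distrib[symmetric] del: of_nat_Suc)
  also have "\<dots> \<le> real (?E ^ Suc k) / 2 ^ p"
  proof (intro divide_right_mono)
    have "1 \<le> ?E ^ k" by (intro one_le_power) (simp add: Suc_le_eq)
    then have "?A * 1 \<le> ?A * ?E ^ k" by (rule mult_left_mono) simp
    then have "?E ^ k + ?A \<le> Suc ?A * ?E ^ k" by simp
    moreover have "?c ^ ?l' \<le> ?c ^ ?A"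
      using size[of "t - k"] by (intro power_increasing) (auto simp: Suc_le_eq)
    ultimately have "?c ^ ?l' * (?E ^ k + ?A) \<le> ?c ^ ?A * (Suc ?A * ?E ^ k)"
      by (intro mult_mono) auto
    also have "\<dots> = ?E ^ Suc k" by (simp only: power_Suc mult_ac)
    finally show "real (?c ^ ?l' * (?E ^ k + ?A)) \<le> real (?E ^ Suc k)"
      by (simp only: of_nat_le_iff)
  qed simp
  finally show ?case .
qed

end

end

context pca_sampler
begin

lemma measure_list_event:
  assumes "invariant \<Phi> \<pi>"
  shows "measure \<pi> (list_event L w) = limit (indicator (list_event L w))"
proof -
  have \<pi>: "\<pi> \<in> space (prob_algebra config_space)" using assms by (simp add: invariant_def)
  have "measure \<pi> (list_event L w) = (\<integral>x. indicator (list_event L w) x \<partial>\<pi>)"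
    using prob_algebra_configD(4)[OF \<pi>] by simp
  also have "\<dots> = limit (indicator (list_event L w))"
    by (rule invariant_integral[OF assms local_function_list_event])
  finally show ?thesis .
qed

lemma sets_list_event: "list_event L w \<in> sets config_space"
proof -
  have "{x \<in> space config_space. \<forall>i\<in>{..<length L}. x (L ! i) = w i} \<in> sets config_space"
    by measurable
  then show ?thesis by (simp add: list_event_def lessThan_def)
qed

lemma exact_weight_rate:
  assumes "invariant \<Phi> \<pi>"
  shows "\<bar>exact_weight ks (N * n) (N * n) W - measure \<pi> (list_event ks (letter W))\<bar> \<le> length ks / 2 ^ n"
proof -
  let ?h = "indicator (list_event ks (letter W)) :: ('d, 's) config \<Rightarrow> real"
  have "\<bar>?h x - ?h y\<bar> \<le> 1" for x y by (auto simp: indicator_def)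
  then have "\<bar>(T ^^ (N * n)) ?h (\<lambda>_. en 0) - limit ?h\<bar> \<le> 1 * real (card (set ks)) * (1 / 2) ^ (N * n div N)"
    by (intro limit_rate depends_on_list_event) auto
  also have "1 * real (card (set ks)) * (1 / 2) ^ (N * n div N) \<le> real (length ks) * (1 / 2) ^ n"
    using N_pos card_length[of ks] by (simp add: mult_right_mono)
  also have "\<dots> = length ks / 2 ^ n" by (simp add: power_one_over)
  finally show ?thesis
    unfolding exact_weight_def measure_list_event[OF assms] diff_self_eq_0 level.simps .
qed

lemma scale_pos: "0 < scale X n"
  by (simp add: scale_def)

text \<open>Patterns are ordered by their codes; the pattern \<open>W\<close> owns the interval from
  \<open>cdf W\<close> to \<open>cdf (Suc W)\<close>.\<close>

definition cdf :: "('d, 's) config measure \<Rightarrow> (int ^ 'd) list \<Rightarrow> nat \<Rightarrow> real" where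
  "cdf \<pi> ks W = (\<Sum>V<W. measure \<pi> (list_event ks (letter V)))"

lemma cdf_mono: "V \<le> W \<Longrightarrow> cdf \<pi> ks V \<le> cdf \<pi> ks W"
  unfolding cdf_def by (intro sum_mono2) auto

lemma cdf_nonneg: "0 \<le> cdf \<pi> ks W"
  unfolding cdf_def by (intro sum_nonneg) auto

lemma cdf_le_1:
  assumes \<pi>: "\<pi> \<in> space (prob_algebra config_space)" and W: "W \<le> CARD('s) ^ length ks"
  shows "cdf \<pi> ks W \<le> 1"
proof -
  note \<pi>D = prob_algebra_configD[OF \<pi>]
  interpret prob_space \<pi> by (rule \<pi>D)
  have disj: "disjoint_family_on (\<lambda>V. list_event ks (letter V)) {..<W}"
    unfolding disjoint_family_on_def
  proof (intro ballI impI)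
    fix V V' assume V: "V \<in> {..<W}" "V' \<in> {..<W}" "V \<noteq> V'"
    show "list_event ks (letter V) \<inter> list_event ks (letter V') = {}"
    proof (rule ccontr)
      assume "list_event ks (letter V) \<inter> list_event ks (letter V') \<noteq> {}"
      then obtain x where "x \<in> list_event ks (letter V)" "x \<in> list_event ks (letter V')" by blast
      then have "letter V i = letter V' i" if "i < length ks" for i
        using that by (auto simp: list_event_def)
      then have "V = V'" using letters_inject[of V "length ks" V'] V(1,2) W by simp
      then show False using V(3) by simp
    qed
  qed
  have "cdf \<pi> ks W = measure \<pi> (\<Union>V<W. list_event ks (letter V))"
    unfolding cdf_def using \<pi>D(3) sets_list_event
    by (intro finite_measure_finite_Union[symmetric] disj) auto
  then show ?thesis by simp
qed

lemma cumulative_rate: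
  fixes ks :: "(int ^ 'd) list"
  defines "X \<equiv> sites_code ks"
  assumes q: "presents q ns \<phi>" and inv: "invariant \<Phi> \<pi>" and W: "W \<le> CARD('s) ^ length ks"
  shows "\<bar>real (cumulative q X n W) / scale X n - cdf \<pi> ks W\<bar> \<le> margin X / 2 ^ n"
proof -
  let ?t = "N * n" and ?p = "precision X n"
  let ?w = "\<lambda>V. code_nth (weights q X ?p ?t) V" and ?m = "\<lambda>V. measure \<pi> (list_event ks (letter V))"
  have len: "code_length X = length ks" by (simp add: X_def)
  have rate: "\<bar>real (?w V) / scale X n - ?m V\<bar> \<le> Suc (length ks) / 2 ^ n" if V: "V \<in> {..<W}" for V
  proof -
    have V: "V < CARD('s) ^ length ks" using V W by simp
    have w: "?w V = weight q X ?p ?t ?t V" using V by (simp add: code_nth_weights len)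
    have "\<bar>real (weight q X ?p ?t ?t V) / 2 ^ (?p * (\<Sum>u\<in>{?t - ?t..<?t}. level_size X u)) - exact_weight ks ?t ?t V\<bar>
        \<le> (CARD('s) ^ (length ks * Suc (length ns) ^ ?t) * Suc (length ks * Suc (length ns) ^ ?t)) ^ ?t / 2 ^ ?p"
      unfolding X_def by (rule weight_approx[OF q]) (use V in \<open>simp_all add: level_size_def\<close>)
    then have "\<bar>real (?w V) / scale X n - exact_weight ks ?t ?t V\<bar> \<le> real (error X ?t) / 2 ^ ?p"
      unfolding w scale_def error_def len diff_self_eq_0 atLeast0LessThan by (simp only: of_nat_power of_nat_numeral)
    also have "\<dots> \<le> 1 / 2 ^ n"
    proof -
      have "real (error X ?t) \<le> 2 ^ error X ?t"
        using of_nat_less_two_power[of "error X ?t", where 'a = real] by simp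
      then show ?thesis by (simp add: precision_def power_add field_simps)
    qed
    finally have 1: "\<bar>real (?w V) / scale X n - exact_weight ks ?t ?t V\<bar> \<le> 1 / 2 ^ n" .
    have "\<bar>exact_weight ks ?t ?t V - ?m V\<bar> \<le> length ks / 2 ^ n"
      by (rule exact_weight_rate[OF inv])
    then have "\<bar>real (?w V) / scale X n - ?m V\<bar> \<le> 1 / 2 ^ n + length ks / 2 ^ n"
      using 1 by linarith
    also have "\<dots> = Suc (length ks) / 2 ^ n" by (simp add: add_divide_distrib)
    finally show ?thesis .
  qed
  have "\<bar>real (cumulative q X n W) / scale X n - cdf \<pi> ks W\<bar> = \<bar>\<Sum>V<W. real (?w V) / scale X n - ?m V\<bar>"
    by (simp only: cumulative_def cdf_def of_nat_sum sum_divide_distrib sum_subtractf)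
  also have "\<dots> \<le> (\<Sum>V<W. Suc (length ks) / 2 ^ n)"
    by (rule order_trans[OF sum_abs sum_mono]) (use rate in blast)
  also have "\<dots> = real (W * Suc (length ks)) / 2 ^ n"
    by (simp add: algebra_simps add_divide_distrib)
  also have "\<dots> \<le> real (margin X) / 2 ^ n"
    unfolding margin_def len using W by (intro divide_right_mono) (simp_all only: of_nat_le_iff mult_le_mono1, simp)
  finally show ?thesis .
qed

lemma accepted_iff_real:
  "accepted q X n W b \<longleftrightarrow>
     real (cumulative q X n W) / scale X n * 2 ^ n + margin X \<le> b \<and>
     real b + 1 + margin X \<le> real (cumulative q X n (Suc W)) / scale X n * 2 ^ n"
proof -
  have s: "0 < real (scale X n)" using scale_pos by simp
  have "accepted q X n W b \<longleftrightarrow>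
     real (cumulative q X n W) * 2 ^ n + margin X * real (scale X n) \<le> b * real (scale X n) \<and>
     (real b + 1) * scale X n + margin X * real (scale X n) \<le> real (cumulative q X n (Suc W)) * 2 ^ n"
    unfolding accepted_def of_nat_le_iff[symmetric, where 'a = real] by (simp add: algebra_simps)
  also have "\<dots> \<longleftrightarrow>
     real (cumulative q X n W) / scale X n * 2 ^ n + margin X \<le> b \<and>
     real b + 1 + margin X \<le> real (cumulative q X n (Suc W)) / scale X n * 2 ^ n"
    using s by (simp add: field_simps)
  finally show ?thesis .
qed

lemma margin_pos: "1 \<le> real (margin X)"
proof -
  have "0 < margin X" by (simp add: margin_def)
  then show ?thesis by simp
qed

lemma accepted_imp_between:
  assumes q: "presents q ns \<phi>" and inv: "invariant \<Phi> \<pi>" and W: "W < CARD('s) ^ length ks"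
    and acc: "accepted q (sites_code ks) n W (nat \<lfloor>2 ^ n * a\<rfloor>)"
  shows "cdf \<pi> ks W \<le> a" "a < cdf \<pi> ks (Suc W)"
proof -
  let ?X = "sites_code ks"
  let ?b = "nat \<lfloor>2 ^ n * a\<rfloor>" and ?D = "real (margin ?X)"
  let ?C = "\<lambda>W. real (cumulative q ?X n W) / scale ?X n"
  have C: "\<bar>?C W - cdf \<pi> ks W\<bar> \<le> ?D / 2 ^ n" "\<bar>?C (Suc W) - cdf \<pi> ks (Suc W)\<bar> \<le> ?D / 2 ^ n"
    by (rule cumulative_rate[OF q inv], use W in simp)+
  have C': "cdf \<pi> ks W * 2 ^ n \<le> ?C W * 2 ^ n + ?D" "?C (Suc W) * 2 ^ n \<le> cdf \<pi> ks (Suc W) * 2 ^ n + ?D"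
    using C by (simp_all add: abs_le_iff field_simps)
  have acc': "?C W * 2 ^ n + ?D \<le> ?b" "real ?b + 1 + ?D \<le> ?C (Suc W) * 2 ^ n"
    using acc unfolding accepted_iff_real by auto
  \<comment> \<open>\<open>nat\<close> would disguise a negative floor as 0. Acceptance excludes
    this: the margin is at least 1, so \<open>?b\<close> is positive.\<close>
  have "0 \<le> ?C W * 2 ^ n" by simp
  then have "0 < real ?b" using acc'(1) margin_pos[of ?X] by linarith
  then have "real ?b = of_int \<lfloor>2 ^ n * a\<rfloor>" by simp
  then have b: "real ?b \<le> a * 2 ^ n" "a * 2 ^ n < real ?b + 1"
    using of_int_floor_le[of "2 ^ n * a"] floor_correct[of "2 ^ n * a"] by (simp_all add: mult.commute)
  have "cdf \<pi> ks W * 2 ^ n \<le> a * 2 ^ n"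
    using acc'(1) b(1) C'(1) by linarith
  then show "cdf \<pi> ks W \<le> a" by simp
  have "a * 2 ^ n < cdf \<pi> ks (Suc W) * 2 ^ n"
    using acc'(2) b(2) C'(2) by linarith
  then show "a < cdf \<pi> ks (Suc W)" by simp
qed

lemma between_imp_accepted:
  assumes q: "presents q ns \<phi>" and inv: "invariant \<Phi> \<pi>" and W: "W < CARD('s) ^ length ks"
    and a: "cdf \<pi> ks W < a" "a < cdf \<pi> ks (Suc W)"
  shows "\<exists>n. accepted q (sites_code ks) n W (nat \<lfloor>2 ^ n * a\<rfloor>)"
proof -
  let ?X = "sites_code ks"
  let ?D = "real (margin ?X)" and ?C = "\<lambda>n W. real (cumulative q ?X n W) / scale ?X n"
  define g where "g = min (a - cdf \<pi> ks W) (cdf \<pi> ks (Suc W) - a)"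
  have g: "0 < g" using a by (simp add: g_def)
  \<comment> \<open>The gap to both ends must exceed the margin twice, once for the error of the
    approximation and once for the test itself, plus 1 for the unread digits of the sample.\<close>
  obtain n where "(2 * ?D + 1) / g < 2 ^ n"
    using real_arch_pow[of 2 "(2 * ?D + 1) / g"] by auto
  then have n: "2 * ?D + 1 < 2 ^ n * g" using g by (simp add: field_simps)
  have "2 ^ n * g \<le> 2 ^ n * (a - cdf \<pi> ks W)" "2 ^ n * g \<le> 2 ^ n * (cdf \<pi> ks (Suc W) - a)"
    by (simp_all add: g_def)
  then have n': "cdf \<pi> ks W * 2 ^ n + 2 * ?D + 1 \<le> 2 ^ n * a"
    "2 ^ n * a + 2 * ?D + 1 \<le> cdf \<pi> ks (Suc W) * 2 ^ n"
    using n by (simp_all add: right_diff_distrib mult.commute)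
  have C: "\<bar>?C n W - cdf \<pi> ks W\<bar> \<le> ?D / 2 ^ n" "\<bar>?C n (Suc W) - cdf \<pi> ks (Suc W)\<bar> \<le> ?D / 2 ^ n"
    by (rule cumulative_rate[OF q inv], use W in simp)+
  have C': "?C n W * 2 ^ n \<le> cdf \<pi> ks W * 2 ^ n + ?D" "cdf \<pi> ks (Suc W) * 2 ^ n \<le> ?C n (Suc W) * 2 ^ n + ?D"
    using C by (simp_all add: abs_le_iff field_simps)
  have "0 \<le> a" using cdf_nonneg[of \<pi> ks W] a(1) by simp
  then have "real (nat \<lfloor>2 ^ n * a\<rfloor>) = of_int \<lfloor>2 ^ n * a\<rfloor>" by simp
  then have b: "real (nat \<lfloor>2 ^ n * a\<rfloor>) \<le> 2 ^ n * a" "2 ^ n * a < real (nat \<lfloor>2 ^ n * a\<rfloor>) + 1"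
    by (simp_all add: of_int_floor_le)
  have "accepted q ?X n W (nat \<lfloor>2 ^ n * a\<rfloor>)"
    unfolding accepted_iff_real using n' C' b by linarith
  then show ?thesis ..
qed

end

section \<open>The law of the output\<close>

lemma prob_space_unit_interval: "prob_space (uniform_measure lborel {0..1 :: real})"
  by (rule prob_space_uniform_measure) auto

lemma space_uniform_source [simp]: "space uniform_source = UNIV"
  by (simp add: uniform_source_def space_PiM PiE_UNIV_domain)

lemma prob_space_uniform_source: "prob_space uniform_source"
  unfolding uniform_source_def by (rule prob_space_PiM) (rule prob_space_unit_interval)

lemma measurable_source_component [measurable]: "(\<lambda>\<omega>. \<omega> i) \<in> borel_measurable uniform_source"
proof -
  have "(\<lambda>\<omega>. \<omega> i) \<in> uniform_source \<rightarrow>\<^sub>M uniform_measure lborel {0..1 :: real}"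
    unfolding uniform_source_def by (rule measurable_component_singleton) simp
  then show ?thesis by (simp cong: measurable_cong_sets)
qed

lemma measure_uniform_source:
  assumes A: "A \<in> sets borel"
  shows "measure uniform_source {\<omega>. \<omega> i \<in> A} = measure lborel ({0..1} \<inter> A)"
proof -
  let ?U = "uniform_measure lborel {0..1 :: real}"
  have "distr uniform_source ?U (\<lambda>\<omega>. \<omega> i) = ?U"
    unfolding uniform_source_def by (rule distr_PiM_component) (simp_all add: prob_space_unit_interval)
  moreover have "measure (distr uniform_source ?U (\<lambda>\<omega>. \<omega> i)) A = measure uniform_source {\<omega>. \<omega> i \<in> A}"
    using A by (subst measure_distr) (auto simp: vimage_def uniform_source_def intro: measurable_component_singleton
        simp: space_PiM PiE_UNIV_domain)
  ultimately have "measure uniform_source {\<omega>. \<omega> i \<in> A} = measure ?U A" by simp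
  also have "\<dots> = measure lborel ({0..1} \<inter> A)"
    using A by (subst measure_uniform_measure) auto
  finally show ?thesis .
qed

lemma measure_uniform_source_interval:
  assumes "0 \<le> a" "a \<le> b" "b \<le> 1"
  shows "measure uniform_source {\<omega>. \<omega> i \<in> {a..b}} = b - a" "measure uniform_source {\<omega>. \<omega> i \<in> {a<..<b}} = b - a"
proof -
  have "{0..1} \<inter> {a..b} = {a..b}" "{0..1} \<inter> {a<..<b} = {a<..<b}" using assms by auto
  then show "measure uniform_source {\<omega>. \<omega> i \<in> {a..b}} = b - a"
    "measure uniform_source {\<omega>. \<omega> i \<in> {a<..<b}} = b - a"
    using measure_uniform_source[of "{a..b}" i] measure_uniform_source[of "{a<..<b}" i] assms
    by (simp_all only: measure_lborel_Icc measure_lborel_Ioo sets.sets_Collect atLeastAtMost_borel greaterThanLessThan_borel)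
qed

context pca_sampler
begin

lemma pattern_code_eq_iff:
  assumes W: "W < CARD('s) ^ length ks" and letters: "\<And>i. i < length ks \<Longrightarrow> letter W i = w (ks ! i)"
  shows "pattern_code (sites_code ks) z = word_code (map w ks) \<longleftrightarrow> z mod CARD('s) ^ length ks = W"
proof -
  let ?V = "z mod CARD('s) ^ length ks"
  have inj: "symbol_code a = symbol_code b \<longleftrightarrow> a = b" for a b :: 's
    by (simp add: symbol_code_def)
  have "pattern_code (sites_code ks) z = word_code (map w ks) \<longleftrightarrow>
      map (\<lambda>i. symbol_code (letter ?V i)) [0..<length ks] = map (\<lambda>i. symbol_code (w (ks ! i))) [0..<length ks]"
    by (simp add: pattern_code_def word_code_def symbol_eq list_encode_eq map_equality_iff Ball_def)
  also have "\<dots> \<longleftrightarrow> (\<forall>i<length ks. letter ?V i = letter W i)"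
    by (auto simp: inj letters)
  also have "\<dots> \<longleftrightarrow> ?V = W"
    using letters_inject[of ?V "length ks" W] W by auto
  finally show ?thesis .
qed

text \<open>The pattern is output whenever the sample lies in the open interval it owns, and only if
  it lies in the closed one. Both have the length
  \<open>measure \<pi> (cylinder (set ks) w)\<close>, so the behaviour at the end points is
  irrelevant.\<close>

lemma perfect_sampler_if_run:
  assumes q: "presents q ns \<phi>" and inv: "invariant \<Phi> \<pi>"
    and P: "\<And>s X. run q s P [X] =
     (if \<exists>z. accepted_code q s X z then Some (pattern_code X (LEAST z. accepted_code q s X z)) else None)"
  shows "perfect_sampler q P \<pi>"
  unfolding perfect_sampler_def Let_def
proof (intro allI impI)
  fix ks :: "(int ^ 'd) list" and w :: "('d, 's) config" assume ks: "distinct ks"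
  interpret U: prob_space "uniform_source" by (rule prob_space_uniform_source)
  have \<pi>: "\<pi> \<in> space (prob_algebra config_space)" using inv by (simp add: invariant_def)
  let ?X = "sites_code ks" and ?D = "CARD('s) ^ length ks"
  let ?E = "{\<omega> \<in> space uniform_source. run q (random_digits \<omega>) P [?X] = Some (word_code (map w ks))}"
  define A where "A \<omega> z \<longleftrightarrow> accepted_code q (random_digits \<omega>) ?X z" for \<omega> z
  have A: "A \<omega> z \<longleftrightarrow> accepted q ?X (z div ?D) (z mod ?D) (nat \<lfloor>2 ^ (z div ?D) * \<omega> 0\<rfloor>)" for \<omega> z
    by (simp add: A_def accepted_code_def random_digits_def)
  obtain W where W: "W < ?D" "\<And>i. i < length ks \<Longrightarrow> letter W i = w (ks ! i)"
    using exists_letters[of "length ks" "\<lambda>i. w (ks ! i)"] by metis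
  have event: "list_event ks (letter W) = cylinder (set ks) w"
    using W(2) by (auto simp: list_event_def cylinder_def all_set_conv_all_nth)
  have between: "cdf \<pi> ks (z mod ?D) \<le> \<omega> 0" "\<omega> 0 < cdf \<pi> ks (Suc (z mod ?D))" if "A \<omega> z" for \<omega> z
    using accepted_imp_between[OF q inv, of "z mod ?D" ks] that by (auto simp: A)
  \<comment> \<open>Acceptance puts the sample into a half-open interval, and those of different
    patterns are disjoint. Hence the least accepted code carries the same pattern as any other
    accepted code.\<close>
  have unique: "z mod ?D = z' mod ?D" if "A \<omega> z" "A \<omega> z'" for \<omega> z z'
  proof (rule ccontr)
    assume "z mod ?D \<noteq> z' mod ?D"
    then consider "Suc (z mod ?D) \<le> z' mod ?D" | "Suc (z' mod ?D) \<le> z mod ?D" by linarith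
    then show False
      using between[OF that(1)] between[OF that(2)] cdf_mono[of _ _ \<pi> ks] by cases fastforce+
  qed
  have E: "?E = {\<omega> \<in> space uniform_source. \<exists>z. A \<omega> z \<and> z mod ?D = W}"
  proof (intro Collect_cong conj_cong refl)
    fix \<omega>
    let ?z = "LEAST z. A \<omega> z"
    have "run q (random_digits \<omega>) P [?X] = Some (word_code (map w ks)) \<longleftrightarrow> (\<exists>z. A \<omega> z) \<and> ?z mod ?D = W"
      unfolding P A_def[symmetric] using pattern_code_eq_iff[OF W, of ?z] by auto
    also have "\<dots> \<longleftrightarrow> (\<exists>z. A \<omega> z \<and> z mod ?D = W)"
    proof
      assume *: "(\<exists>z. A \<omega> z) \<and> ?z mod ?D = W"
      then have "A \<omega> ?z" by (blast intro: LeastI)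
      then show "\<exists>z. A \<omega> z \<and> z mod ?D = W" using * by blast
    next
      assume "\<exists>z. A \<omega> z \<and> z mod ?D = W"
      then obtain z where z: "A \<omega> z" "z mod ?D = W" by blast
      then have "A \<omega> ?z" by (blast intro: LeastI)
      then show "(\<exists>z. A \<omega> z) \<and> ?z mod ?D = W" using unique[OF _ z(1)] z by blast
    qed
    finally show "run q (random_digits \<omega>) P [?X] = Some (word_code (map w ks)) \<longleftrightarrow> (\<exists>z. A \<omega> z \<and> z mod ?D = W)" .
  qed
  have meas: "?E \<in> sets uniform_source"
  proof -
    have [measurable]: "Measurable.pred uniform_source (\<lambda>\<omega>. A \<omega> z)" for z
    proof -
      have "(\<lambda>\<omega>. nat \<lfloor>2 ^ (z div ?D) * \<omega> 0\<rfloor>) \<in> uniform_source \<rightarrow>\<^sub>M count_space UNIV"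
        by measurable
      then show ?thesis
        unfolding A by (rule measurable_compose) simp
    qed
    show ?thesis unfolding E by measurable
  qed
  let ?a = "cdf \<pi> ks W" and ?b = "cdf \<pi> ks (Suc W)"
  have ab: "0 \<le> ?a" "?a \<le> ?b" "?b \<le> 1"
    using W(1) cdf_nonneg cdf_mono cdf_le_1[OF \<pi>] by auto
  have "?E \<subseteq> {\<omega>. \<omega> 0 \<in> {?a..?b}}"
    unfolding E using between by fastforce
  then have "measure uniform_source ?E \<le> measure uniform_source {\<omega>. \<omega> 0 \<in> {?a..?b}}"
  proof (rule U.finite_measure_mono)
    have "{\<omega> \<in> space uniform_source. \<omega> 0 \<in> {?a..?b}} \<in> sets uniform_source" by measurable
    then show "{\<omega>. \<omega> 0 \<in> {?a..?b}} \<in> sets uniform_source" by simp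
  qed
  moreover have "{\<omega>. \<omega> 0 \<in> {?a<..<?b}} \<subseteq> ?E"
  proof
    fix \<omega> :: "nat \<Rightarrow> real" assume "\<omega> \<in> {\<omega>. \<omega> 0 \<in> {?a<..<?b}}"
    then obtain n where n: "accepted q ?X n W (nat \<lfloor>2 ^ n * \<omega> 0\<rfloor>)"
      using between_imp_accepted[OF q inv W(1), of "\<omega> 0"] by auto
    have "(n * ?D + W) div ?D = n" "(n * ?D + W) mod ?D = W" using W(1) by simp_all
    then have "A \<omega> (n * ?D + W) \<and> (n * ?D + W) mod ?D = W" using n unfolding A by simp
    then show "\<omega> \<in> ?E" unfolding E by (simp only: space_uniform_source) blast
  qed
  then have "measure uniform_source {\<omega>. \<omega> 0 \<in> {?a<..<?b}} \<le> measure uniform_source ?E"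
    using meas by (rule U.finite_measure_mono)
  ultimately have "measure uniform_source ?E = ?b - ?a"
    using measure_uniform_source_interval[OF ab, of 0] by simp
  also have "\<dots> = measure \<pi> (cylinder (set ks) w)"
    by (simp add: cdf_def event)
  finally show "?E \<in> sets uniform_source \<and> measure uniform_source ?E = measure \<pi> (cylinder (set ks) w)"
    using meas by blast
qed

end

section \<open>Perturbations of nilpotent automata\<close>

text \<open>The factor of \<open>\<epsilon>\<close> in \<open>error_bound\<close>, stated outside
  the locale because the threshold must be fixed before \<open>\<epsilon>\<close> and
  \<open>\<Phi>\<close> are given.\<close>

primrec error_coeff :: "real \<Rightarrow> real \<Rightarrow> nat \<Rightarrow> real" where
  "error_coeff A r 0 = 0"
| "error_coeff A r (Suc t) = A + r * error_coeff A r t"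

lemma error_coeff_nonneg: "0 \<le> A \<Longrightarrow> 0 \<le> r \<Longrightarrow> 0 \<le> error_coeff A r t"
  by (induction t) auto

lemma (in noisy_ca) error_bound_eq:
  "error_bound t = \<epsilon> * error_coeff (real CARD('s) ^ length ns) (length ns) t"
  by (induction t) (auto simp: algebra_simps)

lemma (in contracting_pca) admits_perfect_sampling:
  assumes inv: "invariant \<Phi> \<pi>"
  shows "admits_perfect_sampling ns \<Phi> \<pi>"
proof -
  define d where "d = CARD('d)"
  \<comment> \<open>The sum of all absolute values of coordinates is a crude shift that makes every
    entry of \<open>off\<close> non-negative.\<close>
  define \<rho> where "\<rho> = (\<Sum>n\<in>set ns. \<Sum>m\<in>UNIV. \<bar>n $ m\<bar>)"
  define off where "off x = nat (ns ! (x div d) $ (axes ! (x mod d)) + \<rho>)" for x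
  obtain en :: "nat \<Rightarrow> 's" where en: "bij_betw en {..<CARD('s)} UNIV"
    using ex_bij_betw_nat_finite[of "UNIV :: 's set"] by (auto simp: atLeast0LessThan)
  define sc where "sc i = symbol_code (en i)" for i
  have off: "int (off (a * CARD('d) + j)) = ns ! a $ (axes ! j) + \<rho>" if "a < length ns" "j < CARD('d)" for a j
  proof -
    have "\<bar>ns ! a $ (axes ! j)\<bar> \<le> (\<Sum>m\<in>UNIV. \<bar>ns ! a $ m\<bar>)"
      by (rule member_le_sum) auto
    also have "\<dots> \<le> \<rho>"
      unfolding \<rho>_def using that(1) by (intro member_le_sum[of "ns ! a" "set ns"]) (auto intro: sum_nonneg)
    finally have "0 \<le> ns ! a $ (axes ! j) + \<rho>" by linarith
    moreover have "(a * CARD('d) + j) div d = a" "(a * CARD('d) + j) mod d = j"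
      using that(2) by (simp_all add: d_def)
    ultimately show ?thesis by (simp add: off_def)
  qed
  \<comment> \<open>\<open>P\<close> is fixed before the rule and its presentation are chosen; it is
    built from \<open>ns\<close>, \<open>N\<close> and the numbering of the alphabet.\<close>
  obtain P where P: "\<And>q s X. run q s P [X] =
     (if \<exists>z. sampling_program.accepted_code CARD('s) (length ns) CARD('d) N off sc q s X z
      then Some (sampling_program.pattern_code CARD('s) sc X
        (LEAST z. sampling_program.accepted_code CARD('s) (length ns) CARD('d) N off sc q s X z)) else None)"
    using sampling_program.exists_sampling_algorithm[where c = "CARD('s)" and r = "length ns"
        and d = "CARD('d)" and N = N and off = off and sc = sc] by blast
  have "perfect_sampler q P \<pi>" if \<phi>': "pca_local_rule ns \<phi>' \<Phi>" and q: "presents q ns \<phi>'" for \<phi>' q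
  proof -
    \<comment> \<open>\<open>T\<close> is defined from \<open>\<Phi>\<close> alone, so
      \<open>contraction\<close> carries over to every rule \<open>\<phi>'\<close> of the same
      kernel.\<close>
    interpret S: pca_sampler ns \<phi>' \<Phi> N off sc en \<rho>
      by unfold_locales (use \<phi>' N_pos contraction en off in \<open>auto simp: sc_def\<close>)
    show ?thesis by (rule S.perfect_sampler_if_run[OF q inv P])
  qed
  then show ?thesis unfolding admits_perfect_sampling_def by blast
qed

theorem theorem3p9:
  fixes F :: "('d::finite, 's::finite) config \<Rightarrow> ('d, 's) config"
    and ns :: "(int ^ 'd) list"
  assumes "ca_neighbourhood ns F"
    and "nilpotent F"
  shows "\<exists>\<epsilon>\<^sub>c>0. \<forall>\<epsilon><\<epsilon>\<^sub>c. \<forall>\<Phi>. perturbation ns \<epsilon> F \<Phi> \<longrightarrow>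
           uniformly_ergodic \<Phi> \<and>
           (\<forall>\<pi>. invariant \<Phi> \<pi> \<longrightarrow>
              spatially_mixing \<pi> \<and> admits_perfect_sampling ns \<Phi> \<pi>)"
proof -
  obtain N0 c where "\<And>x. (F ^^ N0) x = c"
    using assms(2) by (auto simp: nilpotent_def)
  \<comment> \<open>One more step keeps the constant, as \<open>F ^^ N0\<close> is applied to
    \<open>F x\<close>, and makes the number of steps positive, so that \<open>t div N\<close> grows
    with \<open>t\<close>.\<close>
  then have nil: "(F ^^ Suc N0) x = c" for x
    by (simp only: funpow_Suc_right comp_apply)
  define C where "C = error_coeff (real CARD('s) ^ length ns) (length ns) (Suc N0) * length ns ^ Suc N0"
  have C: "0 \<le> C" unfolding C_def by (intro mult_nonneg_nonneg error_coeff_nonneg) auto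
  \<comment> \<open>\<open>C\<close> is 0 for an empty neighbourhood; adding 1 keeps the threshold
    well defined and \<open>\<epsilon> * C\<close> at most 1/2.\<close>
  define \<epsilon>c where "\<epsilon>c = 1 / (2 * (C + 1))"
  have "uniformly_ergodic \<Phi> \<and> (\<forall>\<pi>. invariant \<Phi> \<pi> \<longrightarrow> spatially_mixing \<pi> \<and> admits_perfect_sampling ns \<Phi> \<pi>)"
    if \<epsilon>: "\<epsilon> < \<epsilon>c" and pert: "perturbation ns \<epsilon> F \<Phi>" for \<epsilon> \<Phi>
  proof -
    obtain f \<phi> where f: "ca_local_rule ns f F" "pca_local_rule ns \<phi> \<Phi>"
      "\<And>a. length a = length ns \<Longrightarrow> pmf (\<phi> a) (f a) \<ge> 1 - \<epsilon>"
      using pert by (auto simp: perturbation_def)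
    interpret noisy: noisy_ca ns \<phi> \<Phi> f F \<epsilon>
      by unfold_locales (use f in auto)
    have "\<epsilon> * C \<le> \<epsilon>c * C" using \<epsilon> C by (intro mult_right_mono) auto
    also have "\<dots> \<le> 1 / 2" using C by (simp add: \<epsilon>c_def field_simps)
    finally have small: "noisy.error_bound (Suc N0) * length ns ^ Suc N0 \<le> 1 / 2"
      unfolding noisy.error_bound_eq by (simp only: C_def mult.assoc)
    interpret contracting_pca ns \<phi> \<Phi> "Suc N0"
      by unfold_locales (use noisy.contraction[OF nil small] in auto)
    show ?thesis
      using uniformly_ergodic spatially_mixing admits_perfect_sampling by blast
  qed
  moreover have "0 < \<epsilon>c" using C by (simp add: \<epsilon>c_def)
  ultimately show ?thesis by blast
qed

end
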